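(* Let $(X,f)$ be a dynamical system with a sequence of nondecreasing $f$-invariant compact subsets $\{X_n\subseteq X:n\in\mathbb N^+\}$ such that $\overline{\bigcup_{n\ge1}X_n}=X$. Let $K$ be a non-empty compact connected subset of $\overline{\{\mu\in\mathcal M_f(X):\mu(\bigcup_{n\ge1}X_n)=1\}}$ for which there is $\mu\in K$ with $\mu=\theta\mu_1+(1-\theta)\mu_2$, where $\theta\in[0,1]$, $\mu_1,\mu_2\in\mathcal M_f(X)$ ($\mu_1=\mu_2$ is allowed), $\mu(X_{l_0})=1$ for some $l_0\ge1$, and for $i\in\{1,2\}$ the set $G_{\mu_i}$ has a distal pair $p_i,q_i$ with $p_i,q_i\in X_{l_0}$. (1) If $(X_n,f|_{X_n})$ has the specification property for every $n\in\mathbb N^+$, then for any non-empty open set $U\subseteq X$, the set $G_K\cap U\cap Trans$ is $1$-chaotic. (2) If $(X_n,f|_{X_n})$ has the exponential specification property for every $n\in\mathbb N^+$, then for any non-empty open set $U\subseteq X$, the set $G_K\cap U\cap Trans$ is strongly distributional chaotic. If further $f$ is a homeomorphism, then for any $z\in\bigcup_{n\ge1}X_n$ and any $\varepsilon>0$, the set $U$ can be replaced by the local unstable manifold $W^u_\varepsilon(z)$, i.e. $G_K\cap W^u_\varepsilon(z)\cap Trans$ is strongly distributional chaotic.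
   Context: A dynamical system $(X,f)$ is a nondegenerate (at least two points) compact metric space $(X,d)$ with a continuous map $f:X\to X$. A subset $A$ is $f$-invariant if $f(A)\subset A$ (and $f(A)=A$ when $f$ is a homeomorphism of $X$ onto $X$). $\mathcal M_f(X)$ is the set of $f$-invariant Borel probability measures with the weak* topology. $V_f(x)$ is the set of weak* accumulation points of $\frac1n\sum_{i=0}^{n-1}\delta_{f^i(x)}$. $G_K=\{x\in X:V_f(x)=K\}$, and $G_\nu=\{x:V_f(x)=\{\nu\}\}$. $Trans$ is the set of points with dense forward orbit in $X$. A pair $p,q\in X$ is distal if $\liminf_{i\to\infty}d(f^i(p),f^i(q))>0$; "$G_\nu$ has distal pair $p,q$" means $p,q\in G_\nu$ and $p,q$ is distal. The local unstable manifold is $W^u_\varepsilon(z)=\{y\in X:\lim_{n\to\infty}d(f^{-n}(z),f^{-n}(y))=0 \text{ and } d(f^{-n}(z),f^{-n}(y))\le\varepsilon\ \forall n\ge0\}$. Specification: $x$ $\varepsilon$-traces $y$ on $[a,b]$ if $d(f^i(x),f^{i-a}(y))<\varepsilon$ for $a\le i\le b$; $x$ $\varepsilon$-traces $y$ on $[a,b]$ with exponent $\lambda$ if $d(f^i(x),f^{i-a}(y))<\varepsilon e^{-\lambda\min\{i-a,b-i\}}$ for $a\le i\le b$. A system has the specification property if for any $\varepsilon>0$ there is a positive integer $K_\varepsilon$ such that for any $s\ge2$, any points $y_1,\dots,y_s$ of the space and any integers $0=a_1\le b_1<a_2\le b_2<\dots<a_s\le b_s$ with $a_{m+1}-b_m\ge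 K_\varepsilon$ for $m=1,\dots,s-1$, there is a point $x$ of the space that $\varepsilon$-traces $y_m$ on $[a_m,b_m]$ for all $m\le s$. It has the exponential specification property if there is $\lambda>0$ (depending only on the system) such that the same holds with "$\varepsilon$-traces with exponent $\lambda$"; when the map is a homeomorphism, in the exponential specification property $a_1\le b_1<\dots<a_s\le b_s$ are allowed to be any integers. Chaos: let $\mathcal A$ be the set of nondecreasing maps $\alpha:\mathbb N\to[0,+\infty)$ with $\alpha(n)\to+\infty$ and $\alpha(n)/n\to0$. For $x,y\in X$, $t\in\mathbb R$, $\alpha\in\mathcal A$, let $\Phi^{(n)}_{xy}(t,f)=\frac1n|\{0\le i\le n-1:d(f^i(x),f^i(y))<t\}|$, $\Phi_{xy}(t,f)=\liminf_n\Phi^{(n)}_{xy}(t,f)$, $\Phi^*_{xy}(t,f)=\limsup_n\Phi^{(n)}_{xy}(t,f)$, and $$\Phi^*_{xy}(t,f,\alpha)=\limsup_{n\to\infty}\tfrac1n|\{1\le i\le n:\textstyle\sum_{j=0}^{i-1}d(f^j(x),f^j(y))<\alpha(i)t\}|.$$ The pair $x,y$ is DC1-scrambled (resp. $\alpha$-DC1-scrambled) if $\Phi_{xy}(t_0,f)=0$ for some $t_0>0$ and $\Phi^*_{xy}(t,f)=1$ (resp. $\Phi^*_{xy}(t,f,\alpha)=1$) for all $t>0$. A set is DC1-scrambled (resp. $\alpha$-DC1-scrambled) if any pair of its distinct points is. A subset $Y\subset X$ is $1$-chaotic if it contains an uncountable DC1-scrambled set, and strongly distributional chaotic if for every $\alpha\in\mathcal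 A$ it contains an uncountable $\alpha$-DC1-scrambled set. *)

theory Defs
  imports "HOL-Probability.Probability"
begin

section \<open>Dynamical systems\<close>

definition dynamical_system :: "'a::metric_space set \<Rightarrow> ('a \<Rightarrow> 'a) \<Rightarrow> bool" where
  "dynamical_system X f \<longleftrightarrow>
     compact X \<and> (\<exists>x\<in>X. \<exists>y\<in>X. x \<noteq> y) \<and> continuous_on X f \<and> f ` X \<subseteq> X"

definition is_homeo :: "'a::metric_space set \<Rightarrow> ('a \<Rightarrow> 'a) \<Rightarrow> bool" where
  "is_homeo X f \<longleftrightarrow> (\<exists>g. homeomorphism X X f g)"

definition invariant_subset :: "'a::metric_space set \<Rightarrow> ('a \<Rightarrow> 'a) \<Rightarrow> 'a set \<Rightarrow> bool" where
  "invariant_subset X f A \<longleftrightarrow> A \<subseteq> X \<and> f ` A \<subseteq> A \<and> (is_homeo X f \<longrightarrow> f ` A = A)"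

text \<open>The integer iterate of a self-map of \<open>X\<close>. Negative exponents are only meaningful if the map
  is a bijection of \<open>X\<close>.\<close>

definition int_iterate :: "'a set \<Rightarrow> ('a \<Rightarrow> 'a) \<Rightarrow> int \<Rightarrow> 'a \<Rightarrow> 'a" where
  "int_iterate X f i x = (if 0 \<le> i then (f ^^ nat i) x else (inv_into X f ^^ nat (- i)) x)"

definition Trans :: "'a::metric_space set \<Rightarrow> ('a \<Rightarrow> 'a) \<Rightarrow> 'a set" where
  "Trans X f = {x \<in> X. X \<subseteq> closure (range (\<lambda>n. (f ^^ n) x))}"

definition distal_pair :: "('a::metric_space \<Rightarrow> 'a) \<Rightarrow> 'a \<Rightarrow> 'a \<Rightarrow> bool" where
  "distal_pair f p q \<longleftrightarrow> liminf (\<lambda>i. ereal (dist ((f ^^ i) p) ((f ^^ i) q))) > 0"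

definition local_unstable :: "'a::metric_space set \<Rightarrow> ('a \<Rightarrow> 'a) \<Rightarrow> real \<Rightarrow> 'a \<Rightarrow> 'a set" where
  "local_unstable X f \<epsilon> z = {y \<in> X.
     (\<lambda>n. dist (int_iterate X f (- int n) z) (int_iterate X f (- int n) y)) \<longlonglongrightarrow> 0 \<and>
     (\<forall>n. dist (int_iterate X f (- int n) z) (int_iterate X f (- int n) y) \<le> \<epsilon>)}"


section \<open>Invariant measures and the weak* topology\<close>

definition borel_probs :: "'a::metric_space set \<Rightarrow> 'a measure set" where
  "borel_probs X = {\<mu>. prob_space \<mu> \<and> sets \<mu> = sets (restrict_space borel X)}"

definition weak_star :: "'a::metric_space set \<Rightarrow> 'a measure topology" where
  "weak_star X = topology_generated_by
     {{\<mu> \<in> borel_probs X. (\<integral>x. \<phi> x \<partial>\<mu>) \<in> V} | (\<phi> :: 'a \<Rightarrow> real) V. continuous_on X \<phi> \<and> open V}"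

definition inv_measures :: "'a::metric_space set \<Rightarrow> ('a \<Rightarrow> 'a) \<Rightarrow> 'a measure set" where
  "inv_measures X f = {\<mu> \<in> borel_probs X. distr \<mu> \<mu> f = \<mu>}"

definition inv_weak_star :: "'a::metric_space set \<Rightarrow> ('a \<Rightarrow> 'a) \<Rightarrow> 'a measure topology" where
  "inv_weak_star X f = subtopology (weak_star X) (inv_measures X f)"

text \<open>The measure \<open>1/n (\<delta>\<^bsub>x\<^esub> + \<dots> + \<delta>\<^bsub>f\<^sup>n\<^sup>-\<^sup>1 x\<^esub>)\<close> is the image of the uniform distribution on
  \<open>{0, \<dots>, n - 1}\<close> under \<open>i \<mapsto> f\<^sup>i x\<close>. It is a probability measure only for \<open>n \<ge> 1\<close>.\<close>

definition empirical_measure :: "'a::metric_space set \<Rightarrow> ('a \<Rightarrow> 'a) \<Rightarrow> 'a \<Rightarrow> nat \<Rightarrow> 'a measure" where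
  "empirical_measure X f x n =
     distr (uniform_count_measure {..<n}) (restrict_space borel X) (\<lambda>i. (f ^^ i) x)"

text \<open>Accumulation points are those of the sequence, not of its range: every neighbourhood contains
  infinitely many terms, so that a convergent sequence has exactly its limit as accumulation
  point.\<close>

definition V_set :: "'a::metric_space set \<Rightarrow> ('a \<Rightarrow> 'a) \<Rightarrow> 'a \<Rightarrow> 'a measure set" where
  "V_set X f x = {\<mu> \<in> borel_probs X. \<forall>W. openin (weak_star X) W \<and> \<mu> \<in> W \<longrightarrow>
     (\<exists>\<^sub>F n in sequentially. empirical_measure X f x n \<in> W)}"

definition G_set :: "'a::metric_space set \<Rightarrow> ('a \<Rightarrow> 'a) \<Rightarrow> 'a measure set \<Rightarrow> 'a set" where
  "G_set X f K = {x \<in> X. V_set X f x = K}"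


section \<open>Specification\<close>

definition traces ::
  "'a::metric_space set \<Rightarrow> ('a \<Rightarrow> 'a) \<Rightarrow> real \<Rightarrow> 'a \<Rightarrow> 'a \<Rightarrow> int \<Rightarrow> int \<Rightarrow> bool" where
  "traces X f \<epsilon> x y a b \<longleftrightarrow>
     (\<forall>i\<in>{a..b}. dist (int_iterate X f i x) (int_iterate X f (i - a) y) < \<epsilon>)"

definition exp_traces ::
  "'a::metric_space set \<Rightarrow> ('a \<Rightarrow> 'a) \<Rightarrow> real \<Rightarrow> real \<Rightarrow> 'a \<Rightarrow> 'a \<Rightarrow> int \<Rightarrow> int \<Rightarrow> bool" where
  "exp_traces X f \<kappa> \<epsilon> x y a b \<longleftrightarrow>
     (\<forall>i\<in>{a..b}. dist (int_iterate X f i x) (int_iterate X f (i - a) y)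
        < \<epsilon> * exp (- \<kappa> * real_of_int (min (i - a) (b - i))))"

definition spaced_intervals :: "nat \<Rightarrow> nat \<Rightarrow> (nat \<Rightarrow> int) \<Rightarrow> (nat \<Rightarrow> int) \<Rightarrow> bool" where
  "spaced_intervals k s a b \<longleftrightarrow>
     (\<forall>m\<in>{1..s}. a m \<le> b m) \<and> (\<forall>m\<in>{1..<s}. b m < a (m + 1) \<and> int k \<le> a (m + 1) - b m)"

definition specification_property :: "'a::metric_space set \<Rightarrow> ('a \<Rightarrow> 'a) \<Rightarrow> bool" where
  "specification_property X f \<longleftrightarrow>
     (\<forall>\<epsilon>>0. \<exists>k::nat. k > 0 \<and> (\<forall>s\<ge>2. \<forall>y a b.
        (\<forall>m\<in>{1..s}. y m \<in> X) \<and> a 1 = 0 \<and> spaced_intervals k s a b \<longrightarrow>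
        (\<exists>x\<in>X. \<forall>m\<in>{1..s}. traces X f \<epsilon> x (y m) (a m) (b m))))"

text \<open>For a homeomorphism of \<open>X\<close> the first interval may start at any integer.\<close>

definition exp_specification_property :: "'a::metric_space set \<Rightarrow> ('a \<Rightarrow> 'a) \<Rightarrow> bool" where
  "exp_specification_property X f \<longleftrightarrow>
     (\<exists>\<kappa>>0. \<forall>\<epsilon>>0. \<exists>k::nat. k > 0 \<and> (\<forall>s\<ge>2. \<forall>y a b.
        (\<forall>m\<in>{1..s}. y m \<in> X) \<and> (a 1 = 0 \<or> is_homeo X f) \<and> spaced_intervals k s a b \<longrightarrow>
        (\<exists>x\<in>X. \<forall>m\<in>{1..s}. exp_traces X f \<kappa> \<epsilon> x (y m) (a m) (b m))))"


section \<open>Distributional chaos\<close>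

definition growth_functions :: "(nat \<Rightarrow> real) set" where
  "growth_functions = {\<alpha>. mono \<alpha> \<and> (\<forall>n. 0 \<le> \<alpha> n) \<and> filterlim \<alpha> at_top sequentially \<and>
     (\<lambda>n. \<alpha> n / real n) \<longlonglongrightarrow> 0}"

definition Phi_n :: "('a::metric_space \<Rightarrow> 'a) \<Rightarrow> nat \<Rightarrow> 'a \<Rightarrow> 'a \<Rightarrow> real \<Rightarrow> real" where
  "Phi_n f n x y t = real (card {i\<in>{..<n}. dist ((f ^^ i) x) ((f ^^ i) y) < t}) / real n"

definition Phi_lower :: "('a::metric_space \<Rightarrow> 'a) \<Rightarrow> 'a \<Rightarrow> 'a \<Rightarrow> real \<Rightarrow> ereal" where
  "Phi_lower f x y t = liminf (\<lambda>n. ereal (Phi_n f n x y t))"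

definition Phi_upper :: "('a::metric_space \<Rightarrow> 'a) \<Rightarrow> 'a \<Rightarrow> 'a \<Rightarrow> real \<Rightarrow> ereal" where
  "Phi_upper f x y t = limsup (\<lambda>n. ereal (Phi_n f n x y t))"

definition Phi_upper_growth ::
  "('a::metric_space \<Rightarrow> 'a) \<Rightarrow> (nat \<Rightarrow> real) \<Rightarrow> 'a \<Rightarrow> 'a \<Rightarrow> real \<Rightarrow> ereal" where
  "Phi_upper_growth f \<alpha> x y t = limsup (\<lambda>n. ereal
     (real (card {i\<in>{1..n}. (\<Sum>j<i. dist ((f ^^ j) x) ((f ^^ j) y)) < \<alpha> i * t}) / real n))"

definition DC1_pair :: "('a::metric_space \<Rightarrow> 'a) \<Rightarrow> 'a \<Rightarrow> 'a \<Rightarrow> bool" where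
  "DC1_pair f x y \<longleftrightarrow> (\<exists>t0>0. Phi_lower f x y t0 = 0) \<and> (\<forall>t>0. Phi_upper f x y t = 1)"

definition growth_DC1_pair ::
  "('a::metric_space \<Rightarrow> 'a) \<Rightarrow> (nat \<Rightarrow> real) \<Rightarrow> 'a \<Rightarrow> 'a \<Rightarrow> bool" where
  "growth_DC1_pair f \<alpha> x y \<longleftrightarrow>
     (\<exists>t0>0. Phi_lower f x y t0 = 0) \<and> (\<forall>t>0. Phi_upper_growth f \<alpha> x y t = 1)"

definition one_chaotic :: "('a::metric_space \<Rightarrow> 'a) \<Rightarrow> 'a set \<Rightarrow> bool" where
  "one_chaotic f Y \<longleftrightarrow> (\<exists>S\<subseteq>Y. uncountable S \<and> pairwise (DC1_pair f) S)"

definition strongly_dist_chaotic :: "('a::metric_space \<Rightarrow> 'a) \<Rightarrow> 'a set \<Rightarrow> bool" where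
  "strongly_dist_chaotic f Y \<longleftrightarrow>
     (\<forall>\<alpha>\<in>growth_functions. \<exists>S\<subseteq>Y. uncountable S \<and> pairwise (growth_DC1_pair f \<alpha>) S)"

end

theory Submission imports Defs begin

text \<open>
  A measure is represented by its integrals against a countable family of continuous functions that is
  dense up to multiples (\<open>ex_weak_coordinates\<close>). This turns the weak* topology into a norm topology and
  the empirical measures of a point into Birkhoff averages \<open>A\<^sub>n\<close> of a continuous map \<open>E\<close> with values in a
  normed space (\<open>I_empirical\<close>). It remains to find points whose averages \<open>A\<^sub>n\<close> accumulate exactly at a
  given continuum.

  Every measure in \<open>K\<close> can be imitated for an arbitrarily long time by orbits in some \<open>X\<^sub>l\<close>. By
  hypothesis it is close to an invariant measure \<open>\<nu>\<close> with \<open>\<nu>(X\<^sub>l)\<close> close to \<open>1\<close>. Since \<open>\<integral>\<phi> d\<nu> = \<integral>A\<^sub>m\<phi> d\<nu>\<close>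
  for every \<open>m\<close>, and since integrals are approximated by finite averages, \<open>\<nu>\<close> is close to the mean of
  finitely many orbit segments of length \<open>m\<close> in \<open>X\<^sub>l\<close> (\<open>invariant_block_approximable\<close>), which
  specification allows to repeat periodically (\<open>specification_tracked\<close>). For \<open>\<mu>\<close> the segments are taken
  from \<open>p\<^sub>1, p\<^sub>2\<close> in the proportion \<open>\<theta> : (1 - \<theta>)\<close>, or alternatively from \<open>q\<^sub>1, q\<^sub>2\<close>, which gives two
  orbits near \<open>\<mu>\<close> that are apart most of the time (\<open>distal_block_approximable\<close>). Here the averages
  along \<open>p\<^sub>i\<close> and \<open>q\<^sub>i\<close> have to converge along the same times. They do because the probability measures on
  a compact space are weak* sequentially compact (\<open>weak_limit_exists\<close>), a fact that is reduced to Helly's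
  theorem on the real line by coding the points of \<open>X\<close> by real numbers.

  The continuum \<open>K\<close> is explored by a walk with steps tending to \<open>0\<close> that returns to \<open>\<mu>\<close> again and again
  (\<open>continuum_walk\<close>). A point with the required averages is the limit of a tower of points: each one
  shadows its predecessor as long as that was controlled, then follows a very long orbit near the next
  measure of the walk, and finally visits the next term of a dense sequence (\<open>tower_limit\<close>,
  \<open>tower_averages\<close>). Whenever the walk is at \<open>\<mu>\<close>, a binary digit chooses between the two orbits that are
  apart. This gives an uncountable family of points, any two of which are apart most of the time at the
  end of some stages, and shadow a common orbit most of the time at the end of others
  (\<open>scrambled_family\<close>).

  Exponential specification bounds the sum of the tracing errors along a segment independently of its
  length. If the precision, and hence the gap, is fixed first and the length of the segment last, then
  the accumulated distance of two points is bounded during a stage whose length can still be chosen,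
  and any growth function \<open>\<alpha>\<close> exceeds this bound for most of the stage (\<open>stage_proximal\<close>). For a
  homeomorphism the tracing can be arranged for all negative times as well, with errors tending to \<open>0\<close>
  in the past, so that the limit stays on the unstable manifold of the initial point
  (\<open>gluing_of_exp_specification_homeo\<close>).
\<close>

section \<open>Walks in a continuum\<close>

definition delta_chain :: "'b::metric_space set \<Rightarrow> real \<Rightarrow> 'b list \<Rightarrow> bool" where
  "delta_chain K \<delta> xs \<longleftrightarrow> set xs \<subseteq> K \<and> successively (\<lambda>a b. dist a b < \<delta>) xs"

text \<open>Being joined by a chain is an equivalence relation on \<open>K\<close> with open classes, so a connected set is a
single class.\<close>

lemma connected_delta_chain:
  fixes K :: "'b::metric_space set"
  assumes K: "connected K" and ab: "a \<in> K" "b \<in> K" and \<delta>: "\<delta> > 0"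
  obtains xs where "delta_chain K \<delta> (a # xs @ [b])"
proof -
  define R where "R a b \<longleftrightarrow> (\<exists>xs. delta_chain K \<delta> (a # xs @ [b]))" for a b
  have "R a b"
  proof (rule connected_equivalence_relation[OF K ab])
    show "R y x" if "R x y" for x y
    proof -
      from that obtain xs where "delta_chain K \<delta> (x # xs @ [y])" by (auto simp: R_def)
      moreover have "successively (\<lambda>a b. dist a b < \<delta>) (rev (x # xs @ [y]))"
        if "successively (\<lambda>a b. dist a b < \<delta>) (x # xs @ [y])"
        using that by (subst successively_rev) (simp add: dist_commute)
      ultimately have "delta_chain K \<delta> (rev (x # xs @ [y]))"
        by (auto simp: delta_chain_def)
      then have "delta_chain K \<delta> (y # rev xs @ [x])" by simp
      then show ?thesis unfolding R_def by blast
    qed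
    show "R x z" if "R x y" "R y z" for x y z
    proof -
      from that obtain xs ys where "delta_chain K \<delta> (x # xs @ [y])" "delta_chain K \<delta> (y # ys @ [z])"
        by (auto simp: R_def)
      then have "delta_chain K \<delta> (x # (xs @ y # ys) @ [z])"
        by (auto simp: delta_chain_def successively_append_iff successively_Cons hd_append)
      then show ?thesis unfolding R_def by blast
    qed
    show "\<exists>T. openin (top_of_set K) T \<and> a \<in> T \<and> (\<forall>x\<in>T. R a x)" if "a \<in> K" for a
    proof (intro exI conjI ballI)
      show "openin (top_of_set K) (K \<inter> ball a \<delta>)" by (simp add: openin_open_Int)
      show "a \<in> K \<inter> ball a \<delta>" using that \<delta> by simp
      show "R a x" if "x \<in> K \<inter> ball a \<delta>" for x
        unfolding R_def using that \<open>a \<in> K\<close>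
        by (intro exI[of _ "[]"]) (auto simp: delta_chain_def dist_commute)
    qed
  qed
  then show ?thesis using that by (auto simp: R_def)
qed

text \<open>The lists \<open>ls 0, ls 1, \<dots>\<close> are read one after another without end: after \<open>n\<close> steps the reader is in
list number \<open>fst (walk_pos ls n)\<close> at index \<open>snd (walk_pos ls n)\<close>.\<close>

fun walk_pos :: "(nat \<Rightarrow> 'b list) \<Rightarrow> nat \<Rightarrow> nat \<times> nat" where
  "walk_pos ls 0 = (0, 0)"
| "walk_pos ls (Suc n) = (let (j, i) = walk_pos ls n in if Suc i < length (ls j) then (j, Suc i) else (Suc j, 0))"

lemma walk_pos_valid:
  assumes "\<And>j. ls j \<noteq> []"
  shows "snd (walk_pos ls n) < length (ls (fst (walk_pos ls n)))"
  using assms by (induction n) (auto simp: Let_def split: prod.splits)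

lemma walk_pos_shift:
  assumes "walk_pos ls n = (j, 0)" "i < length (ls j)"
  shows "walk_pos ls (n + i) = (j, i)"
  using assms(2) by (induction i) (use assms(1) in auto)

lemma walk_pos_start:
  assumes ne: "\<And>j. ls j \<noteq> []"
  obtains n where "n \<ge> j" "walk_pos ls n = (j, 0)"
proof -
  have "\<exists>n\<ge>j. walk_pos ls n = (j, 0)"
  proof (induction j)
    case 0
    then show ?case by (intro exI[of _ 0]) auto
  next
    case (Suc j)
    then obtain n where n: "n \<ge> j" "walk_pos ls n = (j, 0)" by auto
    have len: "length (ls j) > 0" using ne by simp
    have "walk_pos ls (n + (length (ls j) - 1)) = (j, length (ls j) - 1)"
      by (rule walk_pos_shift) (use n len in auto)
    then have "walk_pos ls (Suc (n + (length (ls j) - 1))) = (Suc j, 0)"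
      using len by (simp only: walk_pos.simps) simp
    then show ?case using n by (intro exI[of _ "Suc (n + (length (ls j) - 1))"]) auto
  qed
  then show ?thesis using that by auto
qed

lemma walk_pos_mono: "n \<le> m \<Longrightarrow> fst (walk_pos ls n) \<le> fst (walk_pos ls m)"
proof (induction m rule: dec_induct)
  case (step m)
  then show ?case by (auto simp: Let_def split: prod.splits)
qed simp

lemma compact_countable_dense:
  fixes K :: "'b::metric_space set"
  assumes "compact K" "K \<noteq> {}"
  obtains s :: "nat \<Rightarrow> 'b" where "range s \<subseteq> K" "K \<subseteq> closure (range s)"
proof -
  have "\<exists>F. finite F \<and> F \<subseteq> K \<and> K \<subseteq> (\<Union>x\<in>F. ball x (1 / Suc n))" for n :: nat
    using assms(1) seq_compact_imp_totally_bounded[of K] by (auto simp: compact_eq_seq_compact_metric)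
  then obtain F where F: "\<And>n. finite (F n)" "\<And>n. F n \<subseteq> K" "\<And>n::nat. K \<subseteq> (\<Union>x\<in>F n. ball x (1 / Suc n))"
    by metis
  define D where "D = (\<Union>n. F n)"
  have D: "countable D" "D \<subseteq> K" using F by (auto simp: D_def intro: countable_finite)
  have cl: "K \<subseteq> closure D"
  proof
    fix x assume x: "x \<in> K"
    show "x \<in> closure D" unfolding closure_approachable
    proof (intro allI impI)
      fix e :: real assume "e > 0"
      then obtain n :: nat where n: "1 / Suc n < e" using nat_approx_posE by blast
      from x F(3)[of n] obtain y where "y \<in> F n" "dist y x < 1 / Suc n" by auto
      then show "\<exists>y\<in>D. dist y x < e" using n by (force simp: D_def)
    qed
  qed
  with assms(2) have ne: "D \<noteq> {}" by auto
  show ?thesis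
    by (rule that[of "from_nat_into D"]) (use D cl ne in \<open>auto simp: range_from_nat_into\<close>)
qed

text \<open>The walk is a concatenation of closed chains based at \<open>v\<close>: the \<open>j\<close>-th one has mesh
  \<open>1/(j+1)\<close> and passes through the \<open>j\<close>-th term of a sequence that repeats every point of a dense
  sequence infinitely often.\<close>

lemma continuum_walk:
  fixes K :: "'b::metric_space set"
  assumes K: "compact K" "connected K" and v: "v \<in> K"
  obtains w :: "nat \<Rightarrow> 'b" where
    "\<And>k. w k \<in> K" "(\<lambda>k. dist (w k) (w (Suc k))) \<longlonglongrightarrow> 0" "infinite {k. w k = v}"
    "\<And>u e. u \<in> K \<Longrightarrow> e > 0 \<Longrightarrow> \<exists>\<^sub>F k in sequentially. dist (w k) u < e"
proof -
  from v have ne: "K \<noteq> {}" by blast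
  obtain s0 :: "nat \<Rightarrow> 'b" where s0: "range s0 \<subseteq> K" "K \<subseteq> closure (range s0)"
    by (rule compact_countable_dense[OF K(1) ne])
  \<comment> \<open>Decoding pairs makes every point of the dense sequence recur.\<close>
  define s where "s j = s0 (fst (prod_decode j))" for j
  have sK: "s j \<in> K" for j using s0 by (auto simp: s_def)
  have "\<exists>l. delta_chain K (1 / real (Suc j)) (l @ [v]) \<and> l \<noteq> [] \<and> hd l = v \<and> s j \<in> set l" for j
  proof -
    have pos: "1 / real (Suc j) > 0" by simp
    obtain xs where xs: "delta_chain K (1 / real (Suc j)) (v # xs @ [s j])"
      using connected_delta_chain[OF K(2) v sK pos] by blast
    obtain ys where ys: "delta_chain K (1 / real (Suc j)) (s j # ys @ [v])"
      using connected_delta_chain[OF K(2) sK v pos] by blast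
    show ?thesis
      using xs ys by (intro exI[of _ "v # xs @ s j # ys"])
        (auto simp: delta_chain_def successively_append_iff successively_Cons hd_append)
  qed
  then obtain ls where ls: "\<And>j. delta_chain K (1 / real (Suc j)) (ls j @ [v])" "\<And>j. ls j \<noteq> []"
     "\<And>j. hd (ls j) = v" "\<And>j. s j \<in> set (ls j)" by metis
  define P where "P = walk_pos ls"
  define w where "w n = ls (fst (P n)) ! snd (P n)" for n
  have valid: "snd (P n) < length (ls (fst (P n)))" for n
    unfolding P_def by (rule walk_pos_valid) (rule ls)
  have wK: "w n \<in> K" for n
    using ls(1)[of "fst (P n)"] nth_mem[OF valid[of n]] by (auto simp: w_def delta_chain_def)
  have step: "dist (w n) (w (Suc n)) < 1 / real (Suc (fst (P n)))" for n
  proof -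
    define j where "j = fst (P n)"
    define i where "i = snd (P n)"
    \<comment> \<open>Every list starts at \<open>v\<close>, so appending \<open>v\<close> gives the next point of the walk also at the
      end of a list.\<close>
    have "w (Suc n) = (ls j @ [v]) ! Suc i"
    proof (cases "Suc i < length (ls j)")
      case True
      then have "P (Suc n) = (j, Suc i)" by (auto simp: P_def j_def i_def Let_def split: prod.splits)
      then show ?thesis using True by (simp add: w_def nth_append)
    next
      case False
      then have "P (Suc n) = (Suc j, 0)" by (auto simp: P_def j_def i_def Let_def split: prod.splits)
      moreover have "Suc i = length (ls j)" using False valid[of n] by (simp add: j_def i_def)
      moreover have "ls (Suc j) ! 0 = v" using ls(3)[of "Suc j"] ls(2)[of "Suc j"] by (simp add: hd_conv_nth)
      ultimately show ?thesis by (simp add: w_def nth_append)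
    qed
    moreover have "w n = (ls j @ [v]) ! i"
      using valid[of n] by (simp add: w_def nth_append j_def i_def)
    moreover have "Suc i < length (ls j @ [v])" using valid[of n] by (simp add: j_def i_def)
    ultimately show ?thesis
      using ls(1)[of j] by (simp add: delta_chain_def successively_conv_nth j_def)
  qed
  have reach: "\<exists>k\<ge>n. w k = a" if a: "\<exists>j\<ge>n. a \<in> set (ls j)" for a n
  proof -
    from a obtain j where j: "j \<ge> n" "a \<in> set (ls j)" by auto
    then obtain i where i: "i < length (ls j)" "ls j ! i = a" by (auto simp: in_set_conv_nth)
    obtain m where m: "m \<ge> j" "walk_pos ls m = (j, 0)" using walk_pos_start[of ls j] ls(2) by blast
    have "P (m + i) = (j, i)" unfolding P_def by (rule walk_pos_shift[OF m(2) i(1)])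
    then show ?thesis using i m j by (intro exI[of _ "m + i"]) (auto simp: w_def)
  qed
  show ?thesis
  proof (rule that[of w])
    show "w k \<in> K" for k by (rule wK)
    show "(\<lambda>k. dist (w k) (w (Suc k))) \<longlonglongrightarrow> 0"
    proof (rule LIMSEQ_I)
      fix r :: real assume "r > 0"
      then obtain j :: nat where j: "1 / Suc j < r" using nat_approx_posE by blast
      obtain m where m: "walk_pos ls m = (j, 0)" using walk_pos_start[of ls j] ls(2) by blast
      have "norm (dist (w n) (w (Suc n)) - 0) < r" if "n \<ge> m" for n
      proof -
        have "j \<le> fst (P n)" using walk_pos_mono[OF that, of ls] m by (simp add: P_def)
        then have "1 / real (Suc (fst (P n))) \<le> 1 / Suc j" by (simp add: frac_le)
        then show ?thesis using step[of n] j by simp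
      qed
      then show "\<exists>no. \<forall>n\<ge>no. norm (dist (w n) (w (Suc n)) - 0) < r" by blast
    qed
    show "infinite {k. w k = v}"
      unfolding infinite_nat_iff_unbounded_le
      using reach[of _ v] ls(2,3) hd_in_set by (metis mem_Collect_eq order_refl)
    show "\<exists>\<^sub>F k in sequentially. dist (w k) u < e" if u: "u \<in> K" and e: "e > 0" for u e
    proof -
      from u s0(2) have "u \<in> closure (range s0)" by auto
      then obtain m where m: "dist (s0 m) u < e" using e unfolding closure_approachable by auto
      show ?thesis unfolding frequently_sequentially
      proof
        fix n
        have "s (prod_encode (m, n)) = s0 m" by (simp add: s_def)
        moreover have "prod_encode (m, n) \<ge> n" by (rule le_prod_encode_2)
        ultimately obtain k where "k \<ge> n" "w k = s0 m" using reach[of n "s0 m"] ls(4) by metis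
        then show "\<exists>k\<ge>n. dist (w k) u < e" using m by auto
      qed
    qed
  qed
qed

text \<open>Repeating every coordinate of a \<open>0-1\<close>-sequence infinitely often turns distinct sequences into
  sequences that differ infinitely often.\<close>

lemma infinitely_often_distinct_coding:
  assumes J: "infinite (J :: nat set)"
  obtains b :: "nat \<Rightarrow> (nat \<Rightarrow> bool) \<Rightarrow> bool"
  where "\<And>\<xi> \<eta>. \<xi> \<noteq> \<eta> \<Longrightarrow> infinite {j \<in> J. b j \<xi> \<noteq> b j \<eta>}"
proof
  let ?r = "the_inv_into UNIV (enumerate J)"
  fix \<xi> \<eta> :: "nat \<Rightarrow> bool" assume "\<xi> \<noteq> \<eta>"
  then obtain m where m: "\<xi> m \<noteq> \<eta> m" by auto
  have inj: "inj (enumerate J)"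
    using strict_mono_enumerate[OF J] strict_mono_imp_inj_on by blast
  have "(\<lambda>i. enumerate J (prod_encode (m, i))) ` UNIV \<subseteq>
     {j \<in> J. \<xi> (fst (prod_decode (?r j))) \<noteq> \<eta> (fst (prod_decode (?r j)))}"
    using m J by (auto simp: enumerate_in_set the_inv_into_f_f[OF inj])
  moreover have "inj (\<lambda>i. enumerate J (prod_encode (m, i)))"
    using inj by (auto simp: inj_def dest!: injD[OF inj])
  ultimately show "infinite {j \<in> J. \<xi> (fst (prod_decode (?r j))) \<noteq> \<eta> (fst (prod_decode (?r j)))}"
    by (meson finite_subset range_inj_infinite)
qed

lemma uncountable_bool_sequences: "uncountable (UNIV :: (nat \<Rightarrow> bool) set)"
proof
  assume "countable (UNIV :: (nat \<Rightarrow> bool) set)"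
  then obtain g :: "nat \<Rightarrow> nat \<Rightarrow> bool" where "range g = UNIV"
    by (metis UNIV_not_empty uncountable_def)
  then obtain n where "g n = (\<lambda>i. \<not> g i i)" by (metis UNIV_I imageE)
  then show False by (metis (full_types))
qed

section \<open>Orbits with prescribed averages\<close>

definition birkhoff_sum :: "('a \<Rightarrow> 'a) \<Rightarrow> ('a \<Rightarrow> 'e::real_normed_vector) \<Rightarrow> nat \<Rightarrow> 'a \<Rightarrow> 'e" where
  "birkhoff_sum f \<psi> n x = (\<Sum>i<n. \<psi> ((f ^^ i) x))"

text \<open>Deviations from \<open>n u\<close> are not divided by \<open>n\<close>, so that they add up over consecutive stretches of an
orbit.\<close>

abbreviation deviation ::
  "('a \<Rightarrow> 'a) \<Rightarrow> ('a \<Rightarrow> 'e::real_normed_vector) \<Rightarrow> nat \<Rightarrow> 'a \<Rightarrow> 'e \<Rightarrow> real" where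
  "deviation f \<psi> n x u \<equiv> norm (birkhoff_sum f \<psi> n x - real n *\<^sub>R u)"

text \<open>A real-valued sum, so that it is subject to the same estimates as the Birkhoff sums.\<close>

definition close_time :: "('a::metric_space \<Rightarrow> 'a) \<Rightarrow> real \<Rightarrow> nat \<Rightarrow> 'a \<Rightarrow> 'a \<Rightarrow> real" where
  "close_time f \<tau> n x y = (\<Sum>i<n. of_bool (dist ((f ^^ i) x) ((f ^^ i) y) < \<tau>))"

lemma close_time_card:
  "close_time f \<tau> n x y = real (card {i\<in>{..<n}. dist ((f ^^ i) x) ((f ^^ i) y) < \<tau>})"
proof -
  have "{i\<in>{..<n}. dist ((f ^^ i) x) ((f ^^ i) y) < \<tau>} = {..<n} \<inter> {i. dist ((f ^^ i) x) ((f ^^ i) y) < \<tau>}"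
    by auto
  then show ?thesis unfolding close_time_def by (simp add: sum_of_bool_eq)
qed

lemma sum_lessThan_split:
  fixes D :: "nat \<Rightarrow> 'e::comm_monoid_add"
  shows "(\<Sum>i<a + b. D i) = (\<Sum>i<a. D i) + (\<Sum>i<b. D (a + i))"
  by (induction b) (auto simp: add.assoc)

lemma sum_lessThan_blocks:
  fixes D :: "nat \<Rightarrow> 'e::comm_monoid_add"
  shows "(\<Sum>i<r * b. D i) = (\<Sum>j<r. \<Sum>i<b. D (j * b + i))"
proof (induction r)
  case (Suc r)
  have "(\<Sum>i<Suc r * b. D i) = (\<Sum>i<r * b + b. D i)" by (simp add: add.commute)
  also have "\<dots> = (\<Sum>j<Suc r. \<Sum>i<b. D (j * b + i))"
    by (subst sum_lessThan_split) (simp add: Suc)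
  finally show ?case .
qed simp

lemma norm_sum_bound:
  fixes D :: "nat \<Rightarrow> 'e::real_normed_vector"
  assumes "\<And>i. i < n \<Longrightarrow> norm (D i) \<le> B"
  shows "norm (\<Sum>i<n. D i) \<le> real n * B"
  using sum_norm_bound[of "{..<n}" D B] assms by simp

text \<open>Whole periods contribute at most \<open>\<eta>\<close> per unit of time and the incomplete last period at most
\<open>P B\<close>. This serves both the deviation of Birkhoff sums from their target and the time during which
two orbits are close.\<close>

lemma periodic_sum_bound:
  fixes D :: "nat \<Rightarrow> 'e::real_normed_vector"
  assumes B: "\<And>i. norm (D i) \<le> B" and P: "P > 0" and \<eta>: "\<eta> \<ge> 0"
    and per: "\<And>t. t < c \<Longrightarrow> norm (\<Sum>i<P. D (t * P + i)) \<le> \<eta> * real P"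
    and n: "n \<le> c * P"
  shows "norm (\<Sum>i<n. D i) \<le> \<eta> * real n + real P * B"
proof -
  have full: "norm (\<Sum>i<t * P. D i) \<le> \<eta> * real (t * P)" if "t \<le> c" for t
    using that
  proof (induction t)
    case (Suc t)
    have "(\<Sum>i<Suc t * P. D i) = (\<Sum>i<t * P. D i) + (\<Sum>i<P. D (t * P + i))"
      using sum_lessThan_split[of D "t * P" P] by (simp add: add.commute)
    also have "norm \<dots> \<le> \<eta> * real (t * P) + \<eta> * real P"
      using Suc per[of t] by (intro norm_triangle_mono) auto
    finally show ?case by (simp add: algebra_simps)
  qed simp
  define q where "q = n div P"
  define r where "r = n mod P"
  have nq: "n = q * P + r" by (simp add: q_def r_def)
  have q: "q \<le> c" using n P by (metis div_le_mono div_mult_self_is_m q_def)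
  have B0: "B \<ge> 0" using B[of 0] norm_ge_zero order_trans by blast
  have rP: "r < P" using P by (simp add: r_def)
  have "(\<Sum>i<n. D i) = (\<Sum>i<q * P. D i) + (\<Sum>i<r. D (q * P + i))"
    unfolding nq by (rule sum_lessThan_split)
  also have "norm \<dots> \<le> \<eta> * real (q * P) + real r * B"
    using full[OF q] B by (intro norm_triangle_mono norm_sum_bound) auto
  also have "\<dots> \<le> \<eta> * real n + real P * B"
    using rP B0 \<eta> nq by (intro add_mono mult_left_mono mult_right_mono) auto
  finally show ?thesis .
qed

text \<open>The gap \<open>g\<close> depends on the precision only; it is negligible once the common length \<open>m\<close> of the
  segments is large compared with it.\<close>

lemma specification_blocks:
  assumes sp: "specification_property Y f" and \<epsilon>: "\<epsilon> > 0"
  obtains g where "\<And>x m c. (\<forall>j. x j \<in> Y) \<Longrightarrow>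
    \<exists>y\<in>Y. \<forall>j<c. \<forall>i\<le>m. dist ((f ^^ (j * (m + g) + i)) y) ((f ^^ i) (x j)) < \<epsilon>"
proof -
  obtain k :: nat where k: "k > 0 \<and> (\<forall>s\<ge>2. \<forall>y a b.
        (\<forall>m\<in>{1..s}. y m \<in> Y) \<and> a 1 = 0 \<and> spaced_intervals k s a b \<longrightarrow>
        (\<exists>x\<in>Y. \<forall>m\<in>{1..s}. traces Y f \<epsilon> x (y m) (a m) (b m)))"
    using sp[unfolded specification_property_def, rule_format, OF \<epsilon>] ..
  show ?thesis
  proof (rule that[of k])
    fix x m c assume x: "\<forall>j::nat. x j \<in> Y"
    define a where "a j = int ((j - 1) * (m + k))" for j
    define b where "b j = a j + int m" for j
    have gap: "a (j + 1) - b j = int k" if "j \<in> {1..<c + 2}" for j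
    proof -
      from that obtain i where "j = Suc i" by (cases j) auto
      then show ?thesis by (simp add: a_def b_def algebra_simps)
    qed
    have "spaced_intervals k (c + 2) a b"
      unfolding spaced_intervals_def using gap k by (force simp: b_def)
    moreover have "a 1 = 0" by (simp add: a_def)
    ultimately obtain y where y: "y \<in> Y" "\<And>j. j \<in> {1..c+2} \<Longrightarrow> traces Y f \<epsilon> y (x (j - 1)) (a j) (b j)"
      using conjunct2[OF k, THEN spec, of "c + 2", THEN mp, THEN spec, of "\<lambda>j. x (j - 1)", THEN spec, of a, THEN spec, of b] x
      by auto
    have "dist ((f ^^ (j * (m + k) + i)) y) ((f ^^ i) (x j)) < \<epsilon>" if "j < c" "i \<le> m" for i j
    proof -
      have "traces Y f \<epsilon> y (x j) (a (Suc j)) (b (Suc j))" using y(2)[of "Suc j"] that by simp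
      then have "dist (int_iterate Y f (a (Suc j) + int i) y) (int_iterate Y f (a (Suc j) + int i - a (Suc j)) (x j)) < \<epsilon>"
        using that unfolding traces_def b_def by (elim ballE[of _ _ "a (Suc j) + int i"]) auto
      moreover have "a (Suc j) + int i = int (j * (m + k) + i)" by (simp add: a_def)
      moreover have "a (Suc j) + int i - a (Suc j) = int i" by simp
      ultimately show ?thesis by (simp only: int_iterate_def of_nat_0_le_iff if_True nat_int)
    qed
    then show "\<exists>y\<in>Y. \<forall>j<c. \<forall>i\<le>m. dist ((f ^^ (j * (m + k) + i)) y) ((f ^^ i) (x j)) < \<epsilon>"
      using y(1) by blast
  qed
qed

lemma funpow_in: "f ` Y \<subseteq> Y \<Longrightarrow> y \<in> Y \<Longrightarrow> (f ^^ n) y \<in> Y"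
  by (induction n) auto

lemma continuous_on_funpow:
  assumes "continuous_on X f" "f ` X \<subseteq> X"
  shows "continuous_on X (f ^^ i)"
proof (induction i)
  case (Suc i)
  have "continuous_on X (f \<circ> (f ^^ i))"
    using funpow_in[OF assms(2)] by (intro continuous_on_compose Suc continuous_on_subset[OF assms(1)]) auto
  then show ?case by simp
qed (simp add: id_def)

text \<open>In \<open>Y\<close> there are finitely many orbit segments, of an arbitrarily large common length \<open>m\<close>, which on
average have mean \<open>u\<close>. Segments come in pairs, which for \<open>sep\<close> have to stay \<open>\<tau>\<close>-apart most of the
time; pairs on the diagonal do if no separation is asked for.\<close>

definition block_approximable ::
  "('a::metric_space \<Rightarrow> 'a) \<Rightarrow> ('a \<Rightarrow> 'e::real_normed_vector) \<Rightarrow> 'a set \<Rightarrow> 'e \<Rightarrow> bool \<Rightarrow> real \<Rightarrow> real \<Rightarrow> bool" where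
  "block_approximable f \<psi> Y u sep \<tau> \<delta> \<longleftrightarrow> (\<forall>n0. \<exists>m\<ge>n0. \<exists>zs. zs \<noteq> [] \<and> set zs \<subseteq> Y \<times> Y \<and>
     norm (\<Sum>z\<leftarrow>zs. birkhoff_sum f \<psi> m (fst z) - real m *\<^sub>R u) \<le> \<delta> * real (m * length zs) \<and>
     norm (\<Sum>z\<leftarrow>zs. birkhoff_sum f \<psi> m (snd z) - real m *\<^sub>R u) \<le> \<delta> * real (m * length zs) \<and>
     (sep \<longrightarrow> (\<forall>z\<in>set zs. close_time f \<tau> m (fst z) (snd z) \<le> \<delta> * real m)))"

text \<open>Whole periods of the glued orbit have the right average up to tracing errors and gaps, and
  an incomplete last period is negligible in the long run.\<close>

lemma glued_average:
  fixes \<psi> :: "'a::metric_space \<Rightarrow> 'e::real_normed_vector"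
  assumes M: "\<And>x. x \<in> X \<Longrightarrow> norm (\<psi> x) \<le> M" "norm u \<le> M"
    and uc: "\<And>x y. x \<in> X \<Longrightarrow> y \<in> X \<Longrightarrow> dist x y < \<epsilon> \<Longrightarrow> norm (\<psi> x - \<psi> y) \<le> \<delta>"
    and inv: "f ` X \<subseteq> X" and xs: "set xs \<subseteq> X" "xs \<noteq> []" and y: "y \<in> X"
    and m: "m > 0" and g: "real g * (2 * M) \<le> \<delta> * real m" and \<delta>: "\<delta> \<ge> 0"
    and avg: "norm (\<Sum>x\<leftarrow>xs. birkhoff_sum f \<psi> m x - real m *\<^sub>R u) \<le> \<delta> * real (m * length xs)"
    and tr: "\<And>i j. j < c * length xs \<Longrightarrow> i < m \<Longrightarrow>
      dist ((f ^^ (j * (m + g) + i)) y) ((f ^^ i) (xs ! (j mod length xs))) < \<epsilon>"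
    and n: "n \<le> c * (length xs * (m + g))"
  shows "deviation f \<psi> n y u \<le> 3 * \<delta> * real n + real (length xs * (m + g)) * (2 * M)"
proof -
  define r where "r = length xs"
  define D where "D i = \<psi> ((f ^^ i) y) - u" for i
  define b where "b = m + g"
  have r: "r > 0" using xs by (simp add: r_def)
  have D: "norm (D i) \<le> 2 * M" for i
    using norm_triangle_ineq4[of "\<psi> ((f ^^ i) y)" u] M(1)[OF funpow_in[OF inv y, of i]] M(2)
    by (simp add: D_def)
  have per: "norm (\<Sum>i<r * b. D (t * (r * b) + i)) \<le> 3 * \<delta> * real (r * b)" if t: "t < c" for t
  proof -
    have blk: "norm ((\<Sum>i<b. D ((t * r + j) * b + i)) - (birkhoff_sum f \<psi> m (xs ! j) - real m *\<^sub>R u))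
        \<le> 2 * \<delta> * real m" if j: "j < r" for j
    proof -
      have tj: "t * r + j < c * length xs"
      proof -
        have "t * r + j < Suc t * r" using j by simp
        also have "\<dots> \<le> c * r" using t by (intro mult_le_mono1) auto
        finally show ?thesis by (simp add: r_def)
      qed
      have "(t * r + j) mod length xs = j" using j by (simp add: r_def)
      then have tr': "dist ((f ^^ ((t * r + j) * b + i)) y) ((f ^^ i) (xs ! j)) < \<epsilon>" if "i < m" for i
        using tr[OF tj that] by (simp add: b_def)
      have xj: "xs ! j \<in> X" using xs j by (auto simp: r_def)
      have "(\<Sum>i<b. D ((t * r + j) * b + i)) - (birkhoff_sum f \<psi> m (xs ! j) - real m *\<^sub>R u) =
         (\<Sum>i<m. \<psi> ((f ^^ ((t * r + j) * b + i)) y) - \<psi> ((f ^^ i) (xs ! j))) +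
         (\<Sum>i<g. D ((t * r + j) * b + (m + i)))"
        unfolding b_def by (subst sum_lessThan_split) (simp add: D_def birkhoff_sum_def sum_subtractf scaleR_left.sum sum_constant_scaleR)
      also have "norm \<dots> \<le> real m * \<delta> + real g * (2 * M)"
        using tr' xj y inv D by (intro norm_triangle_mono norm_sum_bound uc funpow_in[of f X]) auto
      finally have "norm ((\<Sum>i<b. D ((t * r + j) * b + i)) - (birkhoff_sum f \<psi> m (xs ! j) - real m *\<^sub>R u))
        \<le> real m * \<delta> + real g * (2 * M)" .
      also have "\<dots> \<le> real m * \<delta> + \<delta> * real m" using g by (rule add_left_mono)
      also have "\<dots> = 2 * \<delta> * real m" by simp
      finally show ?thesis .
    qed
    have "(\<Sum>i<r * b. D (t * (r * b) + i)) = (\<Sum>j<r. \<Sum>i<b. D ((t * r + j) * b + i))"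
      by (subst sum_lessThan_blocks) (simp add: algebra_simps)
    also have "\<dots> = (\<Sum>j<r. (\<Sum>i<b. D ((t * r + j) * b + i)) - (birkhoff_sum f \<psi> m (xs ! j) - real m *\<^sub>R u)) +
       (\<Sum>x\<leftarrow>xs. birkhoff_sum f \<psi> m x - real m *\<^sub>R u)"
      by (simp add: sum_list_sum_nth r_def atLeast0LessThan sum_subtractf)
    also have "norm \<dots> \<le> real r * (2 * \<delta> * real m) + \<delta> * real (m * r)"
      using avg blk by (intro norm_triangle_mono norm_sum_bound) (auto simp: r_def)
    also have "\<dots> = 3 * \<delta> * real (r * m)" by simp
    also have "\<dots> \<le> 3 * \<delta> * real (r * b)" using \<delta> by (intro mult_left_mono) (auto simp: b_def intro: mult_left_mono)
    finally show ?thesis .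
  qed
  have "birkhoff_sum f \<psi> n y - real n *\<^sub>R u = (\<Sum>i<n. D i)"
    by (simp add: birkhoff_sum_def D_def sum_subtractf sum_constant_scaleR)
  also have "norm \<dots> \<le> 3 * \<delta> * real n + real (r * b) * (2 * M)"
    by (rule periodic_sum_bound[where c = c]) (use D per \<delta> r m n in \<open>auto simp: b_def r_def\<close>)
  finally show ?thesis by (simp add: r_def b_def)
qed

lemma glued_separation:
  assumes xs: "zs \<noteq> []" and m: "m > 0" and g: "real g \<le> \<delta> * real m" and \<delta>: "\<delta> \<ge> 0"
    and sep: "\<And>z. z \<in> set zs \<Longrightarrow> close_time f \<tau> m (fst z) (snd z) \<le> \<delta> * real m"
    and tr0: "\<And>i j. j < c * length zs \<Longrightarrow> i < m \<Longrightarrow>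
      dist ((f ^^ (j * (m + g) + i)) y) ((f ^^ i) (fst (zs ! (j mod length zs)))) < \<tau> / 4"
    and tr1: "\<And>i j. j < c * length zs \<Longrightarrow> i < m \<Longrightarrow>
      dist ((f ^^ (j * (m + g) + i)) y') ((f ^^ i) (snd (zs ! (j mod length zs)))) < \<tau> / 4"
    and n: "n \<le> c * (length zs * (m + g))"
  shows "close_time f (\<tau> / 2) n y y' \<le> 2 * \<delta> * real n + real (length zs * (m + g))"
proof -
  define r where "r = length zs"
  define D where "D i = (of_bool (dist ((f ^^ i) y) ((f ^^ i) y') < \<tau> / 2) :: real)" for i
  define b where "b = m + g"
  have r: "r > 0" using xs by (simp add: r_def)
  have D: "norm (D i) \<le> 1" for i by (simp add: D_def)
  have per: "norm (\<Sum>i<r * b. D (t * (r * b) + i)) \<le> 2 * \<delta> * real (r * b)" if t: "t < c" for t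
  proof -
    have blk: "norm (\<Sum>i<b. D ((t * r + j) * b + i)) \<le> 2 * \<delta> * real m" if j: "j < r" for j
    proof -
      have tj: "t * r + j < c * length zs"
      proof -
        have "t * r + j < Suc t * r" using j by simp
        also have "\<dots> \<le> c * r" using t by (intro mult_le_mono1) auto
        finally show ?thesis by (simp add: r_def)
      qed
      have jm: "(t * r + j) mod length zs = j" using j by (simp add: r_def)
      define z where "z = zs ! j"
      have z: "z \<in> set zs" using j by (auto simp: z_def r_def)
      have "D ((t * r + j) * b + i) \<le> of_bool (dist ((f ^^ i) (fst z)) ((f ^^ i) (snd z)) < \<tau>)" if i: "i < m" for i
      proof -
        have "dist ((f ^^ i) (fst z)) ((f ^^ i) (snd z)) \<le>
           dist ((f ^^ ((t * r + j) * b + i)) y) ((f ^^ i) (fst z)) +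
           dist ((f ^^ ((t * r + j) * b + i)) y) ((f ^^ ((t * r + j) * b + i)) y') +
           dist ((f ^^ ((t * r + j) * b + i)) y') ((f ^^ i) (snd z))"
          using dist_triangle[of "(f ^^ i) (fst z)" "(f ^^ i) (snd z)" "(f ^^ ((t * r + j) * b + i)) y"]
            dist_triangle[of "(f ^^ ((t * r + j) * b + i)) y" "(f ^^ i) (snd z)" "(f ^^ ((t * r + j) * b + i)) y'"]
          by (simp add: dist_commute)
        then show ?thesis
          using tr0[OF tj i] tr1[OF tj i] unfolding jm z_def[symmetric] b_def D_def by auto
      qed
      then have "(\<Sum>i<m. D ((t * r + j) * b + i)) \<le> close_time f \<tau> m (fst z) (snd z)"
        unfolding close_time_def by (intro sum_mono) auto
      moreover have "(\<Sum>i<g. D ((t * r + j) * b + (m + i))) \<le> (\<Sum>i<g. 1)"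
        by (intro sum_mono) (auto simp: D_def)
      ultimately have "(\<Sum>i<b. D ((t * r + j) * b + i)) \<le> 2 * \<delta> * real m"
        unfolding b_def using sep[OF z] g by (subst sum_lessThan_split) auto
      moreover have "(\<Sum>i<b. D ((t * r + j) * b + i)) \<ge> 0" by (intro sum_nonneg) (auto simp: D_def)
      ultimately show ?thesis by simp
    qed
    have "(\<Sum>i<r * b. D (t * (r * b) + i)) = (\<Sum>j<r. \<Sum>i<b. D ((t * r + j) * b + i))"
      by (subst sum_lessThan_blocks) (simp add: algebra_simps)
    also have "norm \<dots> \<le> real r * (2 * \<delta> * real m)"
      using blk by (intro norm_sum_bound) auto
    also have "\<dots> = 2 * \<delta> * real (r * m)" by simp
    also have "\<dots> \<le> 2 * \<delta> * real (r * b)" using \<delta> by (intro mult_left_mono) (auto simp: b_def intro: mult_left_mono)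
    finally show ?thesis .
  qed
  have "norm (\<Sum>i<n. D i) \<le> 2 * \<delta> * real n + real (r * b) * 1"
    by (rule periodic_sum_bound[where c = c]) (use D per \<delta> r m n in \<open>auto simp: b_def r_def\<close>)
  then show ?thesis by (simp add: r_def b_def close_time_def D_def)
qed

text \<open>What gluing yields: from time \<open>T\<close> up to time \<open>L\<close> the averages of the two points are near \<open>u\<close>. The two
points are apart most of the time if \<open>sep\<close> holds and coincide otherwise.\<close>

definition tracked ::
  "('a::metric_space \<Rightarrow> 'a) \<Rightarrow> ('a \<Rightarrow> 'e::real_normed_vector) \<Rightarrow> 'e \<Rightarrow> bool \<Rightarrow> real \<Rightarrow> real \<Rightarrow> nat \<Rightarrow> nat \<Rightarrow> 'a \<Rightarrow> 'a \<Rightarrow> bool" where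
  "tracked f \<psi> u sep \<tau> \<delta> T L y y' \<longleftrightarrow>
     (\<forall>n\<in>{T..L}. deviation f \<psi> n y u \<le> \<delta> * real n \<and>
        deviation f \<psi> n y' u \<le> \<delta> * real n \<and>
        (sep \<longrightarrow> close_time f \<tau> n y y' \<le> \<delta> * real n)) \<and>
     (\<not> sep \<longrightarrow> y = y')"

text \<open>The segments provided by block approximability are glued periodically. It is essential that \<open>T\<close> does
not depend on \<open>L\<close>: it will be fixed before the length of the orbit is chosen. Half of the separation
\<open>\<tau>\<close> is lost because each of the two orbits is traced up to \<open>\<tau>/4\<close>.\<close>

lemma specification_tracked:
  fixes \<psi> :: "'a::metric_space \<Rightarrow> 'e::real_normed_vector"
  assumes X: "compact X" "continuous_on X \<psi>" "f ` X \<subseteq> X"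
    and Y: "Y \<subseteq> X" "specification_property Y f"
    and \<tau>: "\<tau> > 0" and \<delta>: "\<delta> > 0"
    and app: "block_approximable f \<psi> Y u sep \<tau> (\<delta> / 4)"
  shows "\<exists>T. \<forall>L. \<exists>y\<in>Y. \<exists>y'\<in>Y. tracked f \<psi> u sep (\<tau> / 2) \<delta> T L y y'"
proof -
  obtain M0 where M0: "\<And>x. x \<in> X \<Longrightarrow> norm (\<psi> x) \<le> M0"
    using compact_imp_bounded[OF compact_continuous_image[OF X(2,1)]] unfolding bounded_iff by auto
  define M where "M = max (max M0 (norm u)) 1"
  have M: "\<And>x. x \<in> X \<Longrightarrow> norm (\<psi> x) \<le> M" "norm u \<le> M" "M \<ge> 1"
    using M0 unfolding M_def by fastforce+
  define \<delta>' where "\<delta>' = \<delta> / 4"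
  have \<delta>': "\<delta>' > 0" using \<delta> by (simp add: \<delta>'_def)
  obtain \<epsilon>0 where \<epsilon>0: "\<epsilon>0 > 0" "\<And>x y. x \<in> X \<Longrightarrow> y \<in> X \<Longrightarrow> dist x y < \<epsilon>0 \<Longrightarrow> dist (\<psi> x) (\<psi> y) < \<delta>'"
    using compact_uniformly_continuous[OF X(2,1)] \<delta>' unfolding uniformly_continuous_on_def by metis
  define \<epsilon> where "\<epsilon> = min \<epsilon>0 (\<tau> / 4)"
  have \<epsilon>: "\<epsilon> > 0" using \<epsilon>0 \<tau> by (simp add: \<epsilon>_def)
  obtain g where g: "\<And>x m c. (\<forall>j. x j \<in> Y) \<Longrightarrow>
    \<exists>y\<in>Y. \<forall>j<c. \<forall>i\<le>m. dist ((f ^^ (j * (m + g) + i)) y) ((f ^^ i) (x j)) < \<epsilon>"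
    using specification_blocks[OF Y(2) \<epsilon>] by blast
  obtain n0 :: nat where n0: "real g * (2 * M) / \<delta>' < real n0" using reals_Archimedean2 by blast
  from app obtain m zs where m: "m \<ge> Suc n0" and zs: "zs \<noteq> []" "set zs \<subseteq> Y \<times> Y"
    and av0: "norm (\<Sum>z\<leftarrow>zs. birkhoff_sum f \<psi> m (fst z) - real m *\<^sub>R u) \<le> \<delta>' * real (m * length zs)"
    and av1: "norm (\<Sum>z\<leftarrow>zs. birkhoff_sum f \<psi> m (snd z) - real m *\<^sub>R u) \<le> \<delta>' * real (m * length zs)"
    and sp: "sep \<longrightarrow> (\<forall>z\<in>set zs. close_time f \<tau> m (fst z) (snd z) \<le> \<delta>' * real m)"
    using app[unfolded block_approximable_def, THEN spec, of "Suc n0", folded \<delta>'_def] by blast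
  have "real g * (2 * M) < \<delta>' * real n0" using n0 \<delta>' by (simp add: field_simps)
  also have "\<dots> \<le> \<delta>' * real m" using m \<delta>' by simp
  finally have gM: "real g * (2 * M) \<le> \<delta>' * real m" by simp
  have "real g * 1 \<le> real g * (2 * M)" using M by (intro mult_left_mono) auto
  with gM have g1: "real g \<le> \<delta>' * real m" by simp
  define r where "r = length zs"
  define P where "P = r * (m + g)"
  have r: "r > 0" using zs by (simp add: r_def)
  obtain T :: nat where T: "real P * (2 * M) / \<delta>' < real T" using reals_Archimedean2 by blast
  show ?thesis
  proof (intro exI[of _ T] allI)
    fix L
    define x where "x j = zs ! (j mod r)" for j
    have xz: "x j \<in> set zs" for j using r by (simp add: x_def r_def)
    then have "x j \<in> Y \<times> Y" for j using zs(2) by (rule subsetD[rotated])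
    then have xY: "\<forall>j. fst (x j) \<in> Y" "\<forall>j. snd (x j) \<in> Y" by (simp_all add: mem_Times_iff)
    obtain y where y: "y \<in> Y" "\<forall>j<L * r. \<forall>i\<le>m. dist ((f ^^ (j * (m + g) + i)) y) ((f ^^ i) (fst (x j))) < \<epsilon>"
      using g[OF xY(1)] by blast
    obtain y1 where y1: "y1 \<in> Y" "\<forall>j<L * r. \<forall>i\<le>m. dist ((f ^^ (j * (m + g) + i)) y1) ((f ^^ i) (snd (x j))) < \<epsilon>"
      using g[OF xY(2)] by blast
    define y' where "y' = (if sep then y1 else y)"
    have LP: "n \<le> L * (r * (m + g))" if "n \<le> L" for n
    proof -
      have "1 \<le> r * (m + g)" using r m by simp
      then have "L * 1 \<le> L * (r * (m + g))" by (intro mult_le_mono2)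
      with that show ?thesis by (simp only: mult_1_right)
    qed
    have xsX: "set (map fst zs) \<subseteq> X" "set (map snd zs) \<subseteq> X" using zs(2) Y(1) by auto
    have fin: "3 * \<delta>' * real n + real P * (2 * M) \<le> \<delta> * real n" "2 * \<delta>' * real n + real P \<le> \<delta> * real n"
      if "n \<ge> T" for n
    proof -
      have "real P * (2 * M) < \<delta>' * real T" using T \<delta>' by (simp add: field_simps)
      also have "\<dots> \<le> \<delta>' * real n" using that \<delta>' by simp
      finally have 1: "real P * (2 * M) \<le> \<delta>' * real n" by simp
      then show "3 * \<delta>' * real n + real P * (2 * M) \<le> \<delta> * real n" by (simp add: \<delta>'_def)
      have "real P * 1 \<le> real P * (2 * M)" using M by (intro mult_left_mono) auto
      moreover have "0 \<le> \<delta>' * real n" using \<delta>' by simp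
      ultimately show "2 * \<delta>' * real n + real P \<le> \<delta> * real n" using 1 by (simp add: \<delta>'_def)
    qed
    have avy: "deviation f \<psi> n y u \<le> \<delta> * real n" if "n \<in> {T..L}" for n
    proof -
      have "deviation f \<psi> n y u \<le> 3 * \<delta>' * real n + real (length (map fst zs) * (m + g)) * (2 * M)"
        by (rule glued_average[where X = X and \<epsilon> = \<epsilon> and c = L])
          (use M \<epsilon>0 X xsX zs y Y m gM \<delta>' av0 LP that r in
            \<open>auto simp: \<epsilon>_def r_def x_def o_def dist_norm intro!: less_imp_le\<close>)
      then show ?thesis using fin(1)[of n] that by (simp add: P_def r_def)
    qed
    have avy1: "deviation f \<psi> n y1 u \<le> \<delta> * real n" if "n \<in> {T..L}" for n
    proof -
      have "deviation f \<psi> n y1 u \<le> 3 * \<delta>' * real n + real (length (map snd zs) * (m + g)) * (2 * M)"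
        by (rule glued_average[where X = X and \<epsilon> = \<epsilon> and c = L])
          (use M \<epsilon>0 X xsX zs y1 Y m gM \<delta>' av1 LP that r in
            \<open>auto simp: \<epsilon>_def r_def x_def o_def dist_norm intro!: less_imp_le\<close>)
      then show ?thesis using fin(1)[of n] that by (simp add: P_def r_def)
    qed
    have "close_time f (\<tau> / 2) n y y1 \<le> \<delta> * real n" if "n \<in> {T..L}" sep for n
    proof -
      have "close_time f (\<tau> / 2) n y y1 \<le> 2 * \<delta>' * real n + real (length zs * (m + g))"
        by (rule glued_separation[where c = L])
          (use zs m g1 \<delta>' sp y y1 LP that in \<open>auto simp: \<epsilon>_def x_def r_def\<close>)
      then show ?thesis using fin(2)[of n] that by (simp add: P_def r_def)
    qed
    with avy avy1 have "tracked f \<psi> u sep (\<tau> / 2) \<delta> T L y y'"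
      by (auto simp: tracked_def y'_def)
    moreover have "y' \<in> Y" using y y1 by (simp add: y'_def)
    ultimately show "\<exists>y\<in>Y. \<exists>y'\<in>Y. tracked f \<psi> u sep (\<tau> / 2) \<delta> T L y y'"
      using y(1) by blast
  qed
qed

section \<open>Gluing three orbit segments\<close>

text \<open>Specification bounds each of the distances. Exponential specification bounds also their sum, by a
constant that does not grow with the length of the segment; this is recorded by \<open>summed\<close>.\<close>

definition shadows ::
  "('a::metric_space \<Rightarrow> 'a) \<Rightarrow> bool \<Rightarrow> real \<Rightarrow> 'a \<Rightarrow> 'a \<Rightarrow> nat \<Rightarrow> nat \<Rightarrow> bool" where
  "shadows f summed \<epsilon> x y a L \<longleftrightarrow>
     (\<forall>i\<le>L. dist ((f ^^ (a + i)) x) ((f ^^ i) y) \<le> \<epsilon>) \<and>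
     (summed \<longrightarrow> (\<Sum>i\<le>L. dist ((f ^^ (a + i)) x) ((f ^^ i) y)) \<le> \<epsilon>)"

text \<open>One step of the main construction: \<open>y1\<close> is the point found so far, whose orbit up to time \<open>N\<close> is kept,
\<open>y2\<close> is the segment to be appended, and \<open>y3\<close> is a single point to be visited afterwards. The maps \<open>B j\<close>
stand for the past: they are the negative iterates where the result has to lie on an unstable
manifold, and constant where the past does not matter.\<close>

definition gluing ::
  "('a::metric_space \<Rightarrow> 'a) \<Rightarrow> (nat \<Rightarrow> 'a \<Rightarrow> 'a) \<Rightarrow> bool \<Rightarrow> 'a set \<Rightarrow> real \<Rightarrow> nat \<Rightarrow> bool" where
  "gluing f B summed Y \<epsilon> g \<longleftrightarrow> (\<forall>y1\<in>Y. \<forall>y2\<in>Y. \<forall>y3\<in>Y. \<forall>N L. \<exists>x\<in>Y.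
     shadows f summed \<epsilon> x y1 0 N \<and> shadows f summed \<epsilon> x y2 (N + g) L \<and>
     shadows f summed \<epsilon> x y3 (N + g + L + g) 0 \<and>
     (\<forall>j. dist (B j x) (B j y1) \<le> \<epsilon>) \<and> (\<lambda>j. dist (B j x) (B j y1)) \<longlonglongrightarrow> 0)"

lemma int_iterate_nat: "int_iterate Y f (int n) x = (f ^^ n) x"
  by (simp add: int_iterate_def)

lemma three_intervals:
  assumes "g > 0" and ab: "a = (\<lambda>m. if m = 1 then - int A else if m = 2 then int (N + g) else int (N + g + L + g))"
    "b = (\<lambda>m. if m = 1 then int N else if m = 2 then int (N + g + L) else int (N + g + L + g))"
  shows "spaced_intervals g 3 a b"
proof -
  have "m \<in> {1..3} \<Longrightarrow> m = 1 \<or> m = 2 \<or> m = 3" "m \<in> {1..<3} \<Longrightarrow> m = 1 \<or> m = 2" for m :: nat by auto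
  then show ?thesis unfolding spaced_intervals_def ab using assms(1) by fastforce
qed

lemma gluing_of_specification:
  assumes sp: "specification_property Y f" and \<epsilon>: "\<epsilon> > 0"
  shows "\<exists>g. gluing f (\<lambda>_ _. c) False Y \<epsilon> g"
proof -
  obtain g :: nat where g: "g > 0 \<and> (\<forall>s\<ge>2. \<forall>y a b.
        (\<forall>m\<in>{1..s}. y m \<in> Y) \<and> a 1 = 0 \<and> spaced_intervals g s a b \<longrightarrow>
        (\<exists>x\<in>Y. \<forall>m\<in>{1..s}. traces Y f \<epsilon> x (y m) (a m) (b m)))"
    using sp[unfolded specification_property_def, rule_format, OF \<epsilon>] ..
  have "gluing f (\<lambda>_ _. c) False Y \<epsilon> g"
    unfolding gluing_def
  proof (intro ballI allI)
    fix y1 y2 y3 N L assume y: "y1 \<in> Y" "y2 \<in> Y" "y3 \<in> Y"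
    define yy where "yy m = (if m = 1 then y1 else if m = 2 then y2 else y3)" for m :: nat
    define a where "a = (\<lambda>m. if m = 1 then - int 0 else if m = (2::nat) then int (N + g) else int (N + g + L + g))"
    define b where "b = (\<lambda>m. if m = 1 then int N else if m = (2::nat) then int (N + g + L) else int (N + g + L + g))"
    have "spaced_intervals g 3 a b" using three_intervals[OF conjunct1[OF g] a_def b_def] .
    moreover have "a 1 = 0" by (simp add: a_def)
    moreover have "\<forall>m\<in>{1..3}. yy m \<in> Y" using y by (simp add: yy_def)
    ultimately obtain x where x: "x \<in> Y" "\<And>m. m \<in> {1..3} \<Longrightarrow> traces Y f \<epsilon> x (yy m) (a m) (b m)"
      using conjunct2[OF g, THEN spec, of 3, THEN mp, THEN spec, of yy, THEN spec, of a, THEN spec, of b]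
      by auto
    have sh: "shadows f False \<epsilon> x y n L" if "traces Y f \<epsilon> x y (int n) (int (n + L))" for y n L
    proof -
      have "dist (int_iterate Y f (int (n + i)) x) (int_iterate Y f (int (n + i) - int n) y) < \<epsilon>" if "i \<le> L" for i
        using that \<open>traces Y f \<epsilon> x y (int n) (int (n + L))\<close> unfolding traces_def
        by (elim ballE[of _ _ "int (n + i)"]) auto
      moreover have "int (n + i) - int n = int i" for i by simp
      ultimately have "dist ((f ^^ (n + i)) x) ((f ^^ i) y) < \<epsilon>" if "i \<le> L" for i
        using that by (metis int_iterate_nat)
      then show ?thesis by (auto simp: shadows_def intro: less_imp_le)
    qed
    have "shadows f False \<epsilon> x y1 0 N" "shadows f False \<epsilon> x y2 (N + g) L"
      "shadows f False \<epsilon> x y3 (N + g + L + g) 0"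
      using x(2)[of 1] x(2)[of 2] x(2)[of 3]
      by (intro sh; simp add: yy_def a_def b_def)+
    then show "\<exists>x\<in>Y. shadows f False \<epsilon> x y1 0 N \<and> shadows f False \<epsilon> x y2 (N + g) L \<and>
     shadows f False \<epsilon> x y3 (N + g + L + g) 0 \<and>
     (\<forall>j::nat. dist c c \<le> \<epsilon>) \<and> (\<lambda>j. dist c c) \<longlonglongrightarrow> 0"
      using x(1) \<epsilon> by auto
  qed
  then show ?thesis by blast
qed

lemma sum_exp_min_le:
  fixes \<kappa> :: real
  assumes "\<kappa> > 0"
  shows "(\<Sum>i\<le>L. exp (- \<kappa> * real (min i (L - i)))) \<le> 2 / (1 - exp (- \<kappa>))"
proof -
  define q where "q = exp (- \<kappa>)"
  have q: "0 < q" "q < 1" using assms by (auto simp: q_def)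
  have geo: "(\<Sum>i\<le>L. q ^ i) \<le> 1 / (1 - q)"
  proof -
    have "(1 - q) * (\<Sum>i\<le>L. q ^ i) \<le> 1" using sum_gp_basic[of q L] q by simp
    then show ?thesis using q by (simp add: pos_le_divide_eq mult.commute)
  qed
  have rev: "(\<Sum>i\<le>L. q ^ (L - i)) = (\<Sum>i\<le>L. q ^ i)"
    by (rule sum.reindex_bij_witness[where i = "\<lambda>i. L - i" and j = "\<lambda>i. L - i"]) auto
  have "exp (- \<kappa> * real (min i (L - i))) \<le> q ^ i + q ^ (L - i)" for i
  proof -
    have "exp (- \<kappa> * real (min i (L - i))) = q ^ (min i (L - i))"
      by (simp add: q_def mult.commute flip: exp_of_nat_mult)
    also have "\<dots> \<le> q ^ i + q ^ (L - i)" using q by (simp add: min_def)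
    finally show ?thesis .
  qed
  then have "(\<Sum>i\<le>L. exp (- \<kappa> * real (min i (L - i)))) \<le> (\<Sum>i\<le>L. q ^ i + q ^ (L - i))"
    by (intro sum_mono) auto
  also have "\<dots> \<le> 2 / (1 - q)" using geo rev by (simp add: sum.distrib)
  finally show ?thesis by (simp add: q_def)
qed

text \<open>The errors decay geometrically away from both ends of the segment.\<close>

lemma shadows_of_exponential:
  assumes "\<kappa> > 0" "\<epsilon> \<ge> 0"
    and tr: "\<And>i. i \<le> L \<Longrightarrow> dist ((f ^^ (a + i)) x) ((f ^^ i) y) \<le> \<epsilon> * exp (- \<kappa> * real (min i (L - i)))"
  shows "shadows f summed (\<epsilon> * (2 / (1 - exp (- \<kappa>)))) x y a L"
proof -
  have "(\<Sum>i\<le>L. dist ((f ^^ (a + i)) x) ((f ^^ i) y)) \<le> (\<Sum>i\<le>L. \<epsilon> * exp (- \<kappa> * real (min i (L - i))))"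
    using tr by (intro sum_mono) auto
  also have "\<dots> \<le> \<epsilon> * (2 / (1 - exp (- \<kappa>)))"
    unfolding sum_distrib_left[symmetric] using sum_exp_min_le[OF assms(1)] assms(2) by (intro mult_left_mono)
  finally have S: "(\<Sum>i\<le>L. dist ((f ^^ (a + i)) x) ((f ^^ i) y)) \<le> \<epsilon> * (2 / (1 - exp (- \<kappa>)))" .
  moreover have "dist ((f ^^ (a + i)) x) ((f ^^ i) y) \<le> (\<Sum>i\<le>L. dist ((f ^^ (a + i)) x) ((f ^^ i) y))" if "i \<le> L" for i
    using that by (intro member_le_sum) auto
  ultimately show ?thesis unfolding shadows_def by (meson order_trans)
qed

text \<open>The specification for three segments, the first of which is \<open>[-A, N]\<close>; a positive \<open>A\<close> is available for
homeomorphisms. The point \<open>w\<close> is the position at time \<open>-A\<close>.\<close>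

definition exp_segments :: "'a::metric_space set \<Rightarrow> ('a \<Rightarrow> 'a) \<Rightarrow> real \<Rightarrow> real \<Rightarrow> nat \<Rightarrow> bool" where
  "exp_segments Y f \<kappa> \<epsilon> g \<longleftrightarrow> (\<forall>w\<in>Y. \<forall>y2\<in>Y. \<forall>y3\<in>Y. \<forall>N L A. A = 0 \<or> is_homeo Y f \<longrightarrow>
     (\<exists>x\<in>Y. (\<forall>i\<in>{- int A..int N}. dist (int_iterate Y f i x) (int_iterate Y f (i + int A) w)
           \<le> \<epsilon> * exp (- \<kappa> * real_of_int (min (i + int A) (int N - i)))) \<and>
        (\<forall>i\<le>L. dist ((f ^^ (N + g + i)) x) ((f ^^ i) y2) \<le> \<epsilon> * exp (- \<kappa> * real (min i (L - i)))) \<and>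
        dist ((f ^^ (N + g + L + g)) x) y3 \<le> \<epsilon>))"

lemma exp_specification_segments:
  assumes sp: "exp_specification_property Y f"
  obtains \<kappa> where "\<kappa> > 0" "\<And>\<epsilon>. \<epsilon> > 0 \<Longrightarrow> \<exists>g. exp_segments Y f \<kappa> \<epsilon> g"
proof -
  obtain \<kappa> where \<kappa>: "\<kappa> > 0 \<and> (\<forall>\<epsilon>>0. \<exists>k::nat. k > 0 \<and> (\<forall>s\<ge>2. \<forall>y a b.
        (\<forall>m\<in>{1..s}. y m \<in> Y) \<and> (a 1 = 0 \<or> is_homeo Y f) \<and> spaced_intervals k s a b \<longrightarrow>
        (\<exists>x\<in>Y. \<forall>m\<in>{1..s}. exp_traces Y f \<kappa> \<epsilon> x (y m) (a m) (b m))))"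
    using sp[unfolded exp_specification_property_def] ..
  show ?thesis
  proof (rule that[of \<kappa>])
    show "\<kappa> > 0" using \<kappa> ..
    fix \<epsilon> :: real assume \<epsilon>: "\<epsilon> > 0"
    obtain g :: nat where g: "g > 0 \<and> (\<forall>s\<ge>2. \<forall>y a b.
        (\<forall>m\<in>{1..s}. y m \<in> Y) \<and> (a 1 = 0 \<or> is_homeo Y f) \<and> spaced_intervals g s a b \<longrightarrow>
        (\<exists>x\<in>Y. \<forall>m\<in>{1..s}. exp_traces Y f \<kappa> \<epsilon> x (y m) (a m) (b m)))"
      using conjunct2[OF \<kappa>, rule_format, OF \<epsilon>] ..
    show "\<exists>g. exp_segments Y f \<kappa> \<epsilon> g"
      unfolding exp_segments_def
    proof (intro exI[of _ g] ballI allI impI)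
      fix w y2 y3 N L and A :: nat assume y: "w \<in> Y" "y2 \<in> Y" "y3 \<in> Y" and A: "A = 0 \<or> is_homeo Y f"
      define yy where "yy m = (if m = 1 then w else if m = 2 then y2 else y3)" for m :: nat
      define a where "a = (\<lambda>m. if m = 1 then - int A else if m = (2::nat) then int (N + g) else int (N + g + L + g))"
      define b where "b = (\<lambda>m. if m = 1 then int N else if m = (2::nat) then int (N + g + L) else int (N + g + L + g))"
      have "spaced_intervals g 3 a b" using three_intervals[OF conjunct1[OF g] a_def b_def] .
      moreover have "a 1 = 0 \<or> is_homeo Y f" using A by (auto simp: a_def)
      moreover have "\<forall>m\<in>{1..3}. yy m \<in> Y" using y by (simp add: yy_def)
      ultimately obtain x where x: "x \<in> Y" "\<And>m. m \<in> {1..3} \<Longrightarrow> exp_traces Y f \<kappa> \<epsilon> x (yy m) (a m) (b m)"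
        using conjunct2[OF g, THEN spec, of 3, THEN mp, THEN spec, of yy, THEN spec, of a, THEN spec, of b]
        by auto
      have 1: "exp_traces Y f \<kappa> \<epsilon> x w (- int A) (int N)" "exp_traces Y f \<kappa> \<epsilon> x y2 (int (N + g)) (int (N + g + L))"
        "exp_traces Y f \<kappa> \<epsilon> x y3 (int (N + g + L + g)) (int (N + g + L + g))"
        using x(2)[of 1] x(2)[of 2] x(2)[of 3] by (simp_all add: yy_def a_def b_def)
      have "dist ((f ^^ (N + g + i)) x) ((f ^^ i) y2) \<le> \<epsilon> * exp (- \<kappa> * real (min i (L - i)))" if "i \<le> L" for i
      proof -
        have "dist (int_iterate Y f (int (N + g + i)) x) (int_iterate Y f (int (N + g + i) - int (N + g)) y2)
          < \<epsilon> * exp (- \<kappa> * real_of_int (min (int (N + g + i) - int (N + g)) (int (N + g + L) - int (N + g + i))))"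
          using that 1(2) unfolding exp_traces_def by (elim ballE[of _ _ "int (N + g + i)"]) auto
        moreover have "int (N + g + i) - int (N + g) = int i" by simp
        moreover have "real_of_int (min (int i) (int (N + g + L) - int (N + g + i))) = real (min i (L - i))"
          using that by (auto simp: min_def)
        ultimately show ?thesis by (metis int_iterate_nat less_imp_le)
      qed
      moreover have "dist (int_iterate Y f (int (N + g + L + g)) x) (int_iterate Y f 0 y3) \<le> \<epsilon>"
        using 1(3) unfolding exp_traces_def by (simp add: less_imp_le)
      moreover have "\<forall>i\<in>{- int A..int N}. dist (int_iterate Y f i x) (int_iterate Y f (i + int A) w)
           \<le> \<epsilon> * exp (- \<kappa> * real_of_int (min (i + int A) (int N - i)))"
        using 1(1) unfolding exp_traces_def by (simp add: less_imp_le)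
      ultimately show "\<exists>x\<in>Y. (\<forall>i\<in>{- int A..int N}. dist (int_iterate Y f i x) (int_iterate Y f (i + int A) w)
           \<le> \<epsilon> * exp (- \<kappa> * real_of_int (min (i + int A) (int N - i)))) \<and>
        (\<forall>i\<le>L. dist ((f ^^ (N + g + i)) x) ((f ^^ i) y2) \<le> \<epsilon> * exp (- \<kappa> * real (min i (L - i)))) \<and>
        dist ((f ^^ (N + g + L + g)) x) y3 \<le> \<epsilon>"
        using x(1) by (intro bexI[of _ x] conjI allI impI) (simp_all only: int_iterate_nat int_iterate_nat[of _ _ 0, simplified])
    qed
  qed
qed

lemma exp_segments_scaled:
  assumes sp: "exp_specification_property Y f" and \<epsilon>: "\<epsilon> > 0"
  obtains \<kappa> \<epsilon>' g where "\<kappa> > 0" "\<epsilon>' > 0" "\<epsilon>' \<le> \<epsilon>" "\<epsilon>' * (2 / (1 - exp (- \<kappa>))) = \<epsilon>" "exp_segments Y f \<kappa> \<epsilon>' g"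
proof -
  obtain \<kappa> where \<kappa>: "\<kappa> > 0" "\<And>\<epsilon>. \<epsilon> > 0 \<Longrightarrow> \<exists>g. exp_segments Y f \<kappa> \<epsilon> g"
    using exp_specification_segments[OF sp] by metis
  define C where "C = 2 / (1 - exp (- \<kappa>))"
  have C: "C \<ge> 1" using \<kappa>(1) by (simp add: C_def field_simps)
  define \<epsilon>' where "\<epsilon>' = \<epsilon> / C"
  have \<epsilon>': "\<epsilon>' > 0" "\<epsilon>' * C = \<epsilon>" "\<epsilon>' \<le> \<epsilon>" using C \<epsilon> by (auto simp: \<epsilon>'_def field_simps)
  obtain g where "exp_segments Y f \<kappa> \<epsilon>' g" using \<kappa>(2)[OF \<epsilon>'(1)] ..
  with that[of \<kappa> \<epsilon>' g] \<kappa>(1) \<epsilon>' show ?thesis by (simp add: C_def)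
qed

lemma gluing_of_exp_specification:
  assumes sp: "exp_specification_property Y f" and \<epsilon>: "\<epsilon> > 0"
  shows "\<exists>g. gluing f (\<lambda>_ _. c) True Y \<epsilon> g"
proof -
  obtain \<kappa> \<epsilon>' g where \<kappa>: "\<kappa> > 0" and \<epsilon>': "\<epsilon>' > 0" "\<epsilon>' \<le> \<epsilon>" "\<epsilon>' * (2 / (1 - exp (- \<kappa>))) = \<epsilon>"
    and g: "exp_segments Y f \<kappa> \<epsilon>' g"
    by (rule exp_segments_scaled[OF sp \<epsilon>])
  note g = g[unfolded exp_segments_def]
  have "gluing f (\<lambda>_ _. c) True Y \<epsilon> g"
    unfolding gluing_def
  proof (intro ballI allI)
    fix y1 y2 y3 N L assume y: "y1 \<in> Y" "y2 \<in> Y" "y3 \<in> Y"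
    from g[rule_format, OF y, of 0 N L] obtain x where x: "x \<in> Y"
      "\<forall>i\<in>{- int 0..int N}. dist (int_iterate Y f i x) (int_iterate Y f (i + int 0) y1)
           \<le> \<epsilon>' * exp (- \<kappa> * real_of_int (min (i + int 0) (int N - i)))"
      "\<And>i. i \<le> L \<Longrightarrow> dist ((f ^^ (N + g + i)) x) ((f ^^ i) y2) \<le> \<epsilon>' * exp (- \<kappa> * real (min i (L - i)))"
      "dist ((f ^^ (N + g + L + g)) x) y3 \<le> \<epsilon>'" by blast
    have x2: "dist ((f ^^ (0 + i)) x) ((f ^^ i) y1) \<le> \<epsilon>' * exp (- \<kappa> * real (min i (N - i)))" if "i \<le> N" for i
    proof -
      have "dist (int_iterate Y f (int i) x) (int_iterate Y f (int i) y1)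
         \<le> \<epsilon>' * exp (- \<kappa> * real_of_int (min (int i) (int N - int i)))"
        using x(2) that by (elim ballE[of _ _ "int i"]) auto
      moreover have "real_of_int (min (int i) (int N - int i)) = real (min i (N - i))"
        using that by (auto simp: min_def)
      ultimately show ?thesis by (simp only: int_iterate_nat add_0)
    qed
    have "shadows f True \<epsilon> x y1 0 N"
      unfolding \<epsilon>'(3)[symmetric] by (rule shadows_of_exponential) (use x2 \<kappa> \<epsilon>' in auto)
    moreover have "shadows f True \<epsilon> x y2 (N + g) L"
      unfolding \<epsilon>'(3)[symmetric] by (rule shadows_of_exponential) (use x \<kappa> \<epsilon>' in auto)
    moreover have "shadows f True \<epsilon> x y3 (N + g + L + g) 0"
      unfolding \<epsilon>'(3)[symmetric] by (rule shadows_of_exponential) (use x \<kappa> \<epsilon>' in auto)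
    ultimately show "\<exists>x\<in>Y. shadows f True \<epsilon> x y1 0 N \<and> shadows f True \<epsilon> x y2 (N + g) L \<and>
     shadows f True \<epsilon> x y3 (N + g + L + g) 0 \<and>
     (\<forall>j::nat. dist c c \<le> \<epsilon>) \<and> (\<lambda>j. dist c c) \<longlonglongrightarrow> 0"
      using x(1) \<epsilon> by auto
  qed
  then show ?thesis by blast
qed

lemma specification_of_exp_specification:
  assumes "exp_specification_property Y f"
  shows "specification_property Y f"
  unfolding specification_property_def
proof (intro allI impI)
  fix \<epsilon> :: real assume \<epsilon>: "\<epsilon> > 0"
  obtain \<kappa> where \<kappa>: "\<kappa> > 0 \<and> (\<forall>\<epsilon>>0. \<exists>k::nat. k > 0 \<and> (\<forall>s\<ge>2. \<forall>y a b.
        (\<forall>m\<in>{1..s}. y m \<in> Y) \<and> (a 1 = 0 \<or> is_homeo Y f) \<and> spaced_intervals k s a b \<longrightarrow>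
        (\<exists>x\<in>Y. \<forall>m\<in>{1..s}. exp_traces Y f \<kappa> \<epsilon> x (y m) (a m) (b m))))"
    using assms[unfolded exp_specification_property_def] ..
  obtain g :: nat where g: "g > 0 \<and> (\<forall>s\<ge>2. \<forall>y a b.
        (\<forall>m\<in>{1..s}. y m \<in> Y) \<and> (a 1 = 0 \<or> is_homeo Y f) \<and> spaced_intervals g s a b \<longrightarrow>
        (\<exists>x\<in>Y. \<forall>m\<in>{1..s}. exp_traces Y f \<kappa> \<epsilon> x (y m) (a m) (b m)))"
    using conjunct2[OF \<kappa>, rule_format, OF \<epsilon>] ..
  have tr: "traces Y f \<epsilon> x y a b" if "exp_traces Y f \<kappa> \<epsilon> x y a b" for x y a b
    unfolding traces_def
  proof
    fix i assume i: "i \<in> {a..b}"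
    then have "dist (int_iterate Y f i x) (int_iterate Y f (i - a) y) < \<epsilon> * exp (- \<kappa> * real_of_int (min (i - a) (b - i)))"
      using that unfolding exp_traces_def by blast
    also have "\<dots> \<le> \<epsilon> * 1" using i \<kappa> \<epsilon> by (intro mult_left_mono) (auto simp: min_def)
    finally show "dist (int_iterate Y f i x) (int_iterate Y f (i - a) y) < \<epsilon>" by simp
  qed
  show "\<exists>k>0. \<forall>s\<ge>2. \<forall>y a b. (\<forall>m\<in>{1..s}. y m \<in> Y) \<and> a 1 = 0 \<and> spaced_intervals k s a b \<longrightarrow>
        (\<exists>x\<in>Y. \<forall>m\<in>{1..s}. traces Y f \<epsilon> x (y m) (a m) (b m))"
  proof (intro exI[of _ g] conjI allI impI)
    show "g > 0" using g ..
    fix s y a b assume "(2::nat) \<le> s" "(\<forall>m\<in>{1..s}. y m \<in> Y) \<and> a 1 = 0 \<and> spaced_intervals g s a b"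
    then obtain x where "x \<in> Y" "\<forall>m\<in>{1..s}. exp_traces Y f \<kappa> \<epsilon> x (y m) (a m) (b m)"
      using conjunct2[OF g, THEN spec, of s, THEN mp, THEN spec, of y, THEN spec, of a, THEN spec, of b] by blast
    then show "\<exists>x\<in>Y. \<forall>m\<in>{1..s}. traces Y f \<epsilon> x (y m) (a m) (b m)" using tr by blast
  qed
qed

lemma homeo_int_iterate:
  assumes "is_homeo Y f" and y: "y \<in> Y"
  shows "int_iterate Y f i y \<in> Y" "i + int A \<ge> 0 \<Longrightarrow> int_iterate Y f (i + int A) (int_iterate Y f (- int A) y) = int_iterate Y f i y"
    "continuous_on Y (int_iterate Y f i)"
proof -
  obtain h where h: "homeomorphism Y Y f h" using assms by (auto simp: is_homeo_def)
  have inj: "inj_on f Y" using h by (metis homeomorphism_def inj_on_inverseI)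
  have im: "f ` Y = Y" using h by (simp add: homeomorphism_def)
  let ?k = "inv_into Y f"
  have kh: "?k x = h x" if "x \<in> Y" for x
    using h that inj im unfolding homeomorphism_def by (metis imageI inv_into_f_f)
  have kY: "?k ` Y \<subseteq> Y" using im by (auto simp: inv_into_into)
  have kpow: "(?k ^^ n) y \<in> Y" if "y \<in> Y" for n y using that kY by (induction n) auto
  have fpow: "(f ^^ n) y \<in> Y" if "y \<in> Y" for n y using that im by (induction n) auto
  show "int_iterate Y f i y \<in> Y" using kpow fpow y by (simp add: int_iterate_def)
  have cancel: "(f ^^ n) ((?k ^^ n) z) = z" if "z \<in> Y" for n z
    using that
  proof (induction n arbitrary: z)
    case (Suc n)
    have "f (?k ((?k ^^ n) z)) = (?k ^^ n) z"
      using kpow[OF Suc.prems, of n] im by (intro f_inv_into_f) auto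
    then show ?case using Suc by (simp only: funpow_Suc_right o_apply funpow_swap1)
  qed simp
  show "int_iterate Y f (i + int A) (int_iterate Y f (- int A) y) = int_iterate Y f i y" if i: "i + int A \<ge> 0"
  proof -
    have neg: "int_iterate Y f (- int A) y = (?k ^^ A) y" by (cases "A = 0") (auto simp: int_iterate_def)
    show ?thesis
    proof (cases "i \<ge> 0")
      case True
      then have "nat (i + int A) = nat i + A" by simp
      then show ?thesis using True i cancel[OF y, of A] unfolding neg by (simp add: int_iterate_def funpow_add)
    next
      case False
      define j where "j = nat (- i)"
      have j: "j \<le> A" "nat (i + int A) = A - j" using False i by (auto simp: j_def)
      have "(?k ^^ A) y = (?k ^^ (A - j)) ((?k ^^ j) y)"
        using j(1) by (metis funpow_add le_add_diff_inverse2 o_apply)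
      then show ?thesis using False i cancel[OF kpow[OF y, of j], of "A - j"] j unfolding neg
        by (simp add: int_iterate_def j_def)
    qed
  qed
  have cf: "continuous_on Y f" using h by (simp add: homeomorphism_def)
  have ck: "continuous_on Y ?k"
    using h kh by (metis continuous_on_cong homeomorphism_def)
  have "continuous_on Y (f ^^ n)" for n using im by (intro continuous_on_funpow cf) auto
  moreover have "continuous_on Y (?k ^^ n)" for n by (rule continuous_on_funpow[OF ck kY])
  ultimately show "continuous_on Y (int_iterate Y f i)"
    by (cases "i \<ge> 0") (simp_all add: int_iterate_def[abs_def])
qed

text \<open>For a homeomorphism the first segment can be prolonged arbitrarily far into the past; a
  compactness argument then yields a point whose whole backward orbit is asymptotic to that of
  \<open>y1\<close>.\<close>

lemma gluing_of_exp_specification_homeo: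
  assumes sp: "exp_specification_property Y f" and \<epsilon>: "\<epsilon> > 0" and Y: "compact Y" "is_homeo Y f"
  shows "\<exists>g. gluing f (\<lambda>j. int_iterate Y f (- int j)) True Y \<epsilon> g"
proof -
  obtain \<kappa> \<epsilon>' g where \<kappa>: "\<kappa> > 0" and \<epsilon>': "\<epsilon>' > 0" "\<epsilon>' \<le> \<epsilon>" "\<epsilon>' * (2 / (1 - exp (- \<kappa>))) = \<epsilon>"
    and g: "exp_segments Y f \<kappa> \<epsilon>' g"
    by (rule exp_segments_scaled[OF sp \<epsilon>])
  note g = g[unfolded exp_segments_def]
  have "gluing f (\<lambda>j. int_iterate Y f (- int j)) True Y \<epsilon> g"
    unfolding gluing_def
  proof (intro ballI allI)
    fix y1 y2 y3 N L assume y: "y1 \<in> Y" "y2 \<in> Y" "y3 \<in> Y"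
    have "\<exists>x\<in>Y. (\<forall>i\<in>{- int A..int N}. dist (int_iterate Y f i x) (int_iterate Y f i y1)
           \<le> \<epsilon>' * exp (- \<kappa> * real_of_int (min (i + int A) (int N - i)))) \<and>
        (\<forall>i\<le>L. dist ((f ^^ (N + g + i)) x) ((f ^^ i) y2) \<le> \<epsilon>' * exp (- \<kappa> * real (min i (L - i)))) \<and>
        dist ((f ^^ (N + g + L + g)) x) y3 \<le> \<epsilon>'" for A
      using g[rule_format, OF homeo_int_iterate(1)[OF Y(2) y(1), of "- int A"] y(2,3), of A N L] Y(2)
        homeo_int_iterate(2)[OF Y(2) y(1)] by simp
    then obtain X where X: "\<And>A. X A \<in> Y" "\<And>A i. - int A \<le> i \<Longrightarrow> i \<le> int N \<Longrightarrow> dist (int_iterate Y f i (X A)) (int_iterate Y f i y1)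
           \<le> \<epsilon>' * exp (- \<kappa> * real_of_int (min (i + int A) (int N - i)))"
        "\<And>A i. i \<le> L \<Longrightarrow> dist ((f ^^ (N + g + i)) (X A)) ((f ^^ i) y2) \<le> \<epsilon>' * exp (- \<kappa> * real (min i (L - i)))"
        "\<And>A. dist ((f ^^ (N + g + L + g)) (X A)) y3 \<le> \<epsilon>'"
      unfolding Bex_def Ball_def atLeastAtMost_iff by metis
    obtain x r where x: "x \<in> Y" "strict_mono r" "(X \<circ> r) \<longlonglongrightarrow> x"
      using Y(1) X(1) unfolding compact_eq_seq_compact_metric seq_compact_def by metis
    have lim: "(\<lambda>n. dist (int_iterate Y f i (X (r n))) c) \<longlonglongrightarrow> dist (int_iterate Y f i x) c" for i c
      using continuous_on_tendsto_compose[OF homeo_int_iterate(3)[OF Y(2) y(1), of i] x(3) x(1)] X(1)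
      by (intro tendsto_dist tendsto_const) (auto simp: o_def)
    note limn = lim[of "int n" for n, unfolded int_iterate_nat]
    have 1: "dist (int_iterate Y f i x) (int_iterate Y f i y1) \<le> \<epsilon>' * exp (- \<kappa> * real_of_int (int N - i))"
      if "i \<le> int N" for i
    proof (rule tendsto_upperbound[OF lim])
      have "dist (int_iterate Y f i (X (r n))) (int_iterate Y f i y1) \<le> \<epsilon>' * exp (- \<kappa> * real_of_int (int N - i))"
        if n: "n \<ge> nat (int N - i) + nat (- i)" for n
      proof -
        have "r n \<ge> n" using x(2) seq_suble by blast
        then have "- int (r n) \<le> i" "min (i + int (r n)) (int N - i) = int N - i"
          using n \<open>i \<le> int N\<close> by (auto simp: min_def)
        then show ?thesis using X(2)[of "r n" i] \<open>i \<le> int N\<close> by simp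
      qed
      then show "\<forall>\<^sub>F n in sequentially. dist (int_iterate Y f i (X (r n))) (int_iterate Y f i y1) \<le> \<epsilon>' * exp (- \<kappa> * real_of_int (int N - i))"
        unfolding eventually_sequentially by blast
    qed simp
    have x1: "dist ((f ^^ (0 + i)) x) ((f ^^ i) y1) \<le> \<epsilon>' * exp (- \<kappa> * real (min i (N - i)))" if "i \<le> N" for i
    proof -
      have "dist ((f ^^ i) x) ((f ^^ i) y1) \<le> \<epsilon>' * exp (- \<kappa> * real_of_int (int N - int i))"
        using 1[of "int i"] that by (simp add: int_iterate_nat)
      also have "\<dots> \<le> \<epsilon>' * exp (- \<kappa> * real (min i (N - i)))"
        using that \<epsilon>' \<kappa> by (intro mult_left_mono) auto
      finally show ?thesis by simp
    qed
    have x2: "dist ((f ^^ (N + g + i)) x) ((f ^^ i) y2) \<le> \<epsilon>' * exp (- \<kappa> * real (min i (L - i)))" if "i \<le> L" for i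
      by (rule tendsto_upperbound[OF limn]) (use X(3)[OF that] in auto)
    have x3: "dist ((f ^^ (N + g + L + g)) x) y3 \<le> \<epsilon>'"
      by (rule tendsto_upperbound[OF limn]) (use X(4) in auto)
    have B: "dist (int_iterate Y f (- int j) x) (int_iterate Y f (- int j) y1) \<le> \<epsilon>' * exp (- \<kappa>) ^ j" for j
    proof -
      have "dist (int_iterate Y f (- int j) x) (int_iterate Y f (- int j) y1) \<le> \<epsilon>' * exp (- \<kappa> * real_of_int (int N + int j))"
        using 1[of "- int j"] by simp
      also have "\<dots> \<le> \<epsilon>' * exp (- \<kappa> * real j)"
        using \<epsilon>' \<kappa> by (intro mult_left_mono) auto
      also have "exp (- \<kappa> * real j) = exp (- \<kappa>) ^ j" by (simp add: mult.commute flip: exp_of_nat_mult)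
      finally show ?thesis .
    qed
    have "exp (- \<kappa>) ^ j \<le> 1" for j using \<kappa> by (intro power_le_one) auto
    then have "\<epsilon>' * exp (- \<kappa>) ^ j \<le> \<epsilon>' * 1" for j using \<epsilon>' by (intro mult_left_mono) auto
    then have "\<forall>j. dist (int_iterate Y f (- int j) x) (int_iterate Y f (- int j) y1) \<le> \<epsilon>"
      using B \<epsilon>'(2) by (smt (verit))
    moreover have "(\<lambda>j. dist (int_iterate Y f (- int j) x) (int_iterate Y f (- int j) y1)) \<longlonglongrightarrow> 0"
    proof (rule tendsto_sandwich[where f = "\<lambda>_. 0"])
      show "(\<lambda>j. \<epsilon>' * exp (- \<kappa>) ^ j) \<longlonglongrightarrow> 0"
        using \<kappa> by (intro tendsto_mult_right_zero LIMSEQ_power_zero) auto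
    qed (use B in auto)
    moreover have "shadows f True \<epsilon> x y1 0 N"
      unfolding \<epsilon>'(3)[symmetric] by (rule shadows_of_exponential) (use x1 \<kappa> \<epsilon>' in auto)
    moreover have "shadows f True \<epsilon> x y2 (N + g) L"
      unfolding \<epsilon>'(3)[symmetric] by (rule shadows_of_exponential) (use x2 \<kappa> \<epsilon>' in auto)
    moreover have "shadows f True \<epsilon> x y3 (N + g + L + g) 0"
      unfolding \<epsilon>'(3)[symmetric] by (rule shadows_of_exponential) (use x3 \<kappa> \<epsilon>' in auto)
    ultimately show "\<exists>x\<in>Y. shadows f True \<epsilon> x y1 0 N \<and> shadows f True \<epsilon> x y2 (N + g) L \<and>
     shadows f True \<epsilon> x y3 (N + g + L + g) 0 \<and>
     (\<forall>j. dist (int_iterate Y f (- int j) x) (int_iterate Y f (- int j) y1) \<le> \<epsilon>) \<and>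
     (\<lambda>j. dist (int_iterate Y f (- int j) x) (int_iterate Y f (- int j) y1)) \<longlonglongrightarrow> 0"
      using x(1) by blast
  qed
  then show ?thesis by blast
qed

section \<open>Limits of towers of glued orbits\<close>

text \<open>Each step size is at most half of the one before, so all steps from \<open>k\<close> on add up to at most \<open>2 \<epsilon> k\<close>.\<close>

lemma geometric_drift:
  fixes \<epsilon> :: "nat \<Rightarrow> real"
  assumes "p k = 0" "\<And>m. m \<ge> k \<Longrightarrow> p (Suc m) \<le> p m + \<epsilon> m" "\<And>m. \<epsilon> (Suc m) \<le> \<epsilon> m / 2" "\<And>m. \<epsilon> m > 0"
    and "m \<ge> k"
  shows "p m \<le> 2 * \<epsilon> k"
proof -
  have "p m \<le> 2 * \<epsilon> k - 2 * \<epsilon> m"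
    using \<open>m \<ge> k\<close>
  proof (induction m rule: dec_induct)
    case (step m)
    then show ?case using assms(2)[of m] assms(3)[of m] by simp
  qed (simp add: assms)
  then show ?thesis using assms(4)[of m] by simp
qed

text \<open>The point of stage \<open>k + 1\<close> shadows that of stage \<open>k\<close> up to time \<open>N k\<close>, follows \<open>y k\<close> and visits \<open>t k\<close>.
Since the precisions \<open>\<epsilon> k\<close> decrease geometrically these points converge, and what was achieved at
stage \<open>k\<close> holds for the limit up to twice the error. The sets \<open>Y k\<close> may grow with \<open>k\<close>, because the
point of stage \<open>k\<close> is itself available for tracing in the larger set. The precisions may be fixed in
advance, without regard to the times \<open>N k\<close>: it is the sums of the errors, not just the errors, that
are bounded in the summed case.\<close>

lemma tower_limit:
  fixes f :: "'a::metric_space \<Rightarrow> 'a"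
  assumes X: "compact X" "continuous_on X f" "f ` X \<subseteq> X" and B: "\<And>j. continuous_on X (B j)"
    and Y: "\<And>k. Y k \<subseteq> X" "\<And>k. Y k \<subseteq> Y (Suc k)"
    and gl: "\<And>k. gluing f B summed (Y k) (\<epsilon> k) (g k)"
    and \<epsilon>: "\<And>k. \<epsilon> k > 0" "\<And>k. \<epsilon> (Suc k) \<le> \<epsilon> k / 2"
    and N: "\<And>k. N (Suc k) = N k + g k + L k + g k"
    and pts: "\<And>k. y k \<in> Y k" "\<And>k. t k \<in> Y k" "z0 \<in> Y 0"
  obtains x where "x \<in> X" "\<And>k. shadows f summed (2 * \<epsilon> k) x (y k) (N k + g k) (L k)"
    "\<And>k. dist ((f ^^ N (Suc k)) x) (t k) \<le> 2 * \<epsilon> k" "dist x z0 \<le> 2 * \<epsilon> 0"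
    "\<And>j. dist (B j x) (B j z0) \<le> 2 * \<epsilon> 0" "(\<lambda>j. dist (B j x) (B j z0)) \<longlonglongrightarrow> 0"
proof -
  have "\<exists>z. (z 0 = z0 \<and> z 0 \<in> Y 0) \<and> (\<forall>k. (z k \<in> Y k \<and> (k = 0 \<longrightarrow> z k = z0)) \<and> (z (Suc k) \<in> Y k \<and>
     shadows f summed (\<epsilon> k) (z (Suc k)) (z k) 0 (N k) \<and> shadows f summed (\<epsilon> k) (z (Suc k)) (y k) (N k + g k) (L k) \<and>
     shadows f summed (\<epsilon> k) (z (Suc k)) (t k) (N k + g k + L k + g k) 0 \<and>
     (\<forall>j. dist (B j (z (Suc k))) (B j (z k)) \<le> \<epsilon> k) \<and> (\<lambda>j. dist (B j (z (Suc k))) (B j (z k))) \<longlonglongrightarrow> 0))"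
  proof -
    have "\<exists>z. \<forall>k. (z k \<in> Y k \<and> (k = 0 \<longrightarrow> z k = z0)) \<and> (z (Suc k) \<in> Y k \<and>
     shadows f summed (\<epsilon> k) (z (Suc k)) (z k) 0 (N k) \<and> shadows f summed (\<epsilon> k) (z (Suc k)) (y k) (N k + g k) (L k) \<and>
     shadows f summed (\<epsilon> k) (z (Suc k)) (t k) (N k + g k + L k + g k) 0 \<and>
     (\<forall>j. dist (B j (z (Suc k))) (B j (z k)) \<le> \<epsilon> k) \<and> (\<lambda>j. dist (B j (z (Suc k))) (B j (z k))) \<longlonglongrightarrow> 0)"
    proof (rule dependent_nat_choice)
      show "\<exists>z. z \<in> Y 0 \<and> (0 = (0::nat) \<longrightarrow> z = z0)" using pts by auto
      fix z k assume z: "z \<in> Y k \<and> (k = 0 \<longrightarrow> z = z0)"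
      obtain z' where "z' \<in> Y k" "shadows f summed (\<epsilon> k) z' z 0 (N k) \<and> shadows f summed (\<epsilon> k) z' (y k) (N k + g k) (L k) \<and>
         shadows f summed (\<epsilon> k) z' (t k) (N k + g k + L k + g k) 0 \<and>
         (\<forall>j. dist (B j z') (B j z) \<le> \<epsilon> k) \<and> (\<lambda>j. dist (B j z') (B j z)) \<longlonglongrightarrow> 0"
        using gl[of k, unfolded gluing_def, THEN bspec, OF conjunct1[OF z], THEN bspec, OF pts(1)[of k], THEN bspec, OF pts(2)[of k]]
        by blast
      then show "\<exists>z'. (z' \<in> Y (Suc k) \<and> (Suc k = 0 \<longrightarrow> z' = z0)) \<and> (z' \<in> Y k \<and>
         shadows f summed (\<epsilon> k) z' z 0 (N k) \<and> shadows f summed (\<epsilon> k) z' (y k) (N k + g k) (L k) \<and>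
         shadows f summed (\<epsilon> k) z' (t k) (N k + g k + L k + g k) 0 \<and>
         (\<forall>j. dist (B j z') (B j z) \<le> \<epsilon> k) \<and> (\<lambda>j. dist (B j z') (B j z)) \<longlonglongrightarrow> 0)"
        using Y(2)[of k] by blast
    qed
    then show ?thesis by blast
  qed
  then obtain z where z: "z 0 = z0" "\<And>k. z k \<in> Y k"
     "\<And>k. shadows f summed (\<epsilon> k) (z (Suc k)) (z k) 0 (N k)"
     "\<And>k. shadows f summed (\<epsilon> k) (z (Suc k)) (y k) (N k + g k) (L k)"
     "\<And>k. shadows f summed (\<epsilon> k) (z (Suc k)) (t k) (N (Suc k)) 0"
     "\<And>k j. dist (B j (z (Suc k))) (B j (z k)) \<le> \<epsilon> k" "\<And>k. (\<lambda>j. dist (B j (z (Suc k))) (B j (z k))) \<longlonglongrightarrow> 0"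
    unfolding N by blast
  have zX: "z k \<in> X" for k using z(2) Y(1) by blast
  have Nmono: "N k \<le> N m" if "k \<le> m" for k m
    using that by (rule lift_Suc_mono_le[rotated]) (simp add: N)
  have \<epsilon>pow: "\<epsilon> k \<le> \<epsilon> 0 * (1/2) ^ k" for k
  proof (induction k)
    case (Suc k)
    then show ?case using \<epsilon>(2)[of k] by simp
  qed simp
  have \<epsilon>0: "\<epsilon> \<longlonglongrightarrow> 0"
  proof (rule tendsto_sandwich[where f = "\<lambda>_. 0"])
    show "(\<lambda>k. \<epsilon> 0 * (1/2) ^ k) \<longlonglongrightarrow> 0" by (intro tendsto_mult_right_zero LIMSEQ_power_zero) simp
  qed (use \<epsilon>(1) \<epsilon>pow in \<open>auto intro!: always_eventually less_imp_le\<close>)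
  have step: "dist ((f ^^ i) (z (Suc m))) ((f ^^ i) (z m)) \<le> \<epsilon> m" if "i \<le> N m" for i m
    using z(3)[of m] that by (simp add: shadows_def)
  have drift: "dist (F (z m)) (F (z k)) \<le> 2 * \<epsilon> k"
    if "\<And>m. m \<ge> k \<Longrightarrow> dist (F (z (Suc m))) (F (z m)) \<le> \<epsilon> m" "m \<ge> k" for F :: "'a \<Rightarrow> 'a" and k m
  proof (rule geometric_drift[where p = "\<lambda>m. dist (F (z m)) (F (z k))"])
    show "dist (F (z (Suc m))) (F (z k)) \<le> dist (F (z m)) (F (z k)) + \<epsilon> m" if "m \<ge> k" for m
      using dist_triangle[of "F (z (Suc m))" "F (z k)" "F (z m)"]
        \<open>\<And>m. m \<ge> k \<Longrightarrow> dist (F (z (Suc m))) (F (z m)) \<le> \<epsilon> m\<close>[OF that] by linarith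
  qed (use \<epsilon> that in auto)
  have "Cauchy z"
  proof (rule metric_CauchyI)
    fix e :: real assume "e > 0"
    then obtain k where k: "\<epsilon> k < e / 4"
      using order_tendstoD(2)[OF \<epsilon>0, of "e / 4"] unfolding eventually_sequentially by auto
    have "dist (z m) (z n) < e" if "m \<ge> k" "n \<ge> k" for m n
    proof -
      have "dist (id (z m)) (id (z k)) \<le> 2 * \<epsilon> k" "dist (id (z n)) (id (z k)) \<le> 2 * \<epsilon> k"
        using step[of 0] that by (intro drift; simp)+
      then show ?thesis using k dist_triangle2[of "z m" "z n" "z k"] by simp
    qed
    then show "\<exists>M. \<forall>m\<ge>M. \<forall>n\<ge>M. dist (z m) (z n) < e" by blast
  qed
  then obtain x where x: "x \<in> X" "z \<longlonglongrightarrow> x"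
    using compact_imp_complete[OF X(1)] zX unfolding complete_def by blast
  have cf: "continuous_on X (f ^^ i)" for i by (rule continuous_on_funpow[OF X(2,3)])
  have lim: "(\<lambda>m. dist (F (z m)) c) \<longlonglongrightarrow> dist (F x) c" if "continuous_on X F" for F :: "'a \<Rightarrow> 'a" and c
    by (intro tendsto_dist tendsto_const continuous_on_tendsto_compose[OF that x(2) x(1)]) (simp add: zX)
  have close: "dist (F x) (F (z k)) \<le> 2 * \<epsilon> k"
    if "continuous_on X F" "\<And>m. m \<ge> k \<Longrightarrow> dist (F (z (Suc m))) (F (z m)) \<le> \<epsilon> m" for F :: "'a \<Rightarrow> 'a" and k
    by (rule tendsto_upperbound[OF lim[OF that(1)]])
      (use drift[OF that(2)] in \<open>auto simp: eventually_sequentially\<close>)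
  have near: "dist ((f ^^ i) x) ((f ^^ i) (z k)) \<le> 2 * \<epsilon> k" if "i \<le> N k" for i k
    by (rule close[OF cf]) (use step that Nmono order_trans in blast)
  have near_sum: "(\<Sum>i\<le>N k. dist ((f ^^ i) x) ((f ^^ i) (z k))) \<le> 2 * \<epsilon> k" if summed for k
  proof (rule tendsto_upperbound)
    show "(\<lambda>m. \<Sum>i\<le>N k. dist ((f ^^ i) (z m)) ((f ^^ i) (z k))) \<longlonglongrightarrow> (\<Sum>i\<le>N k. dist ((f ^^ i) x) ((f ^^ i) (z k)))"
      by (intro tendsto_sum lim cf)
    have "(\<Sum>i\<le>N k. dist ((f ^^ i) (z m)) ((f ^^ i) (z k))) \<le> 2 * \<epsilon> k" if "m \<ge> k" for m
    proof (rule geometric_drift[where p = "\<lambda>m. \<Sum>i\<le>N k. dist ((f ^^ i) (z m)) ((f ^^ i) (z k))"])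
      fix m assume m: "m \<ge> k"
      have "(\<Sum>i\<le>N k. dist ((f ^^ i) (z (Suc m))) ((f ^^ i) (z k))) \<le>
        (\<Sum>i\<le>N k. dist ((f ^^ i) (z m)) ((f ^^ i) (z k)) + dist ((f ^^ i) (z (Suc m))) ((f ^^ i) (z m)))"
        by (intro sum_mono) (metis add.commute dist_triangle)
      also have "\<dots> \<le> (\<Sum>i\<le>N k. dist ((f ^^ i) (z m)) ((f ^^ i) (z k))) + (\<Sum>i\<le>N m. dist ((f ^^ i) (z (Suc m))) ((f ^^ i) (z m)))"
        unfolding sum.distrib using Nmono[OF m] by (intro add_left_mono sum_mono2) auto
      also have "\<dots> \<le> (\<Sum>i\<le>N k. dist ((f ^^ i) (z m)) ((f ^^ i) (z k))) + \<epsilon> m"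
        using z(3)[of m] \<open>summed\<close> by (simp add: shadows_def)
      finally show "(\<Sum>i\<le>N k. dist ((f ^^ i) (z (Suc m))) ((f ^^ i) (z k))) \<le>
        (\<Sum>i\<le>N k. dist ((f ^^ i) (z m)) ((f ^^ i) (z k))) + \<epsilon> m" .
    qed (use \<epsilon> that in auto)
    then show "\<forall>\<^sub>F m in sequentially. (\<Sum>i\<le>N k. dist ((f ^^ i) (z m)) ((f ^^ i) (z k))) \<le> 2 * \<epsilon> k"
      unfolding eventually_sequentially by blast
  qed simp
  have seg: "shadows f summed (2 * \<epsilon> k) x (y k) (N k + g k) (L k)" for k
  proof -
    have le: "N k + g k + i \<le> N (Suc k)" if "i \<le> L k" for i using that by (simp add: N)
    have tri: "dist ((f ^^ (N k + g k + i)) x) ((f ^^ i) (y k)) \<le>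
       dist ((f ^^ (N k + g k + i)) x) ((f ^^ (N k + g k + i)) (z (Suc k))) +
       dist ((f ^^ (N k + g k + i)) (z (Suc k))) ((f ^^ i) (y k))" for i by (rule dist_triangle)
    have p: "dist ((f ^^ (N k + g k + i)) x) ((f ^^ i) (y k)) \<le> 2 * \<epsilon> k" if "i \<le> L k" for i
      using tri[of i] near[OF le[OF that]] z(4)[of k] \<epsilon>(2)[of k] that unfolding shadows_def by fastforce
    have s: "(\<Sum>i\<le>L k. dist ((f ^^ (N k + g k + i)) x) ((f ^^ i) (y k))) \<le> 2 * \<epsilon> k" if summed
    proof -
      let ?h = "\<lambda>i. dist ((f ^^ i) x) ((f ^^ i) (z (Suc k)))"
      have "(\<Sum>i\<le>L k. dist ((f ^^ (N k + g k + i)) x) ((f ^^ i) (y k))) \<le>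
        (\<Sum>i\<le>L k. ?h (N k + g k + i) + dist ((f ^^ (N k + g k + i)) (z (Suc k))) ((f ^^ i) (y k)))"
        using tri by (intro sum_mono)
      also have "\<dots> = (\<Sum>i\<le>L k. ?h (N k + g k + i)) + (\<Sum>i\<le>L k. dist ((f ^^ (N k + g k + i)) (z (Suc k))) ((f ^^ i) (y k)))"
        by (rule sum.distrib)
      also have "(\<Sum>i\<le>L k. ?h (N k + g k + i)) = sum ?h ((\<lambda>i. N k + g k + i) ` {..L k})"
        by (subst sum.reindex) (auto simp: inj_on_def)
      also have "\<dots> \<le> sum ?h {..N (Suc k)}" using le by (intro sum_mono2) auto
      also have "\<dots> \<le> 2 * \<epsilon> (Suc k)" by (rule near_sum[OF that])
      also have "(\<Sum>i\<le>L k. dist ((f ^^ (N k + g k + i)) (z (Suc k))) ((f ^^ i) (y k))) \<le> \<epsilon> k"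
        using z(4)[of k] that by (simp add: shadows_def)
      finally show ?thesis using \<epsilon>(2)[of k] by simp
    qed
    show ?thesis using p s by (simp add: shadows_def)
  qed
  have tk: "dist ((f ^^ N (Suc k)) x) (t k) \<le> 2 * \<epsilon> k" for k
  proof -
    have "dist ((f ^^ N (Suc k)) (z (Suc k))) (t k) \<le> \<epsilon> k" using z(5)[of k] by (simp add: shadows_def)
    then show ?thesis
      using near[of "N (Suc k)" "Suc k"] \<epsilon>(2)[of k]
        dist_triangle[of "(f ^^ N (Suc k)) x" "t k" "(f ^^ N (Suc k)) (z (Suc k))"] by linarith
  qed
  have Bnear: "dist (B j x) (B j (z k)) \<le> 2 * \<epsilon> k" for j k
    by (rule close[OF B]) (rule z(6))
  have Bz: "(\<lambda>j. dist (B j (z k)) (B j z0)) \<longlonglongrightarrow> 0" for k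
  proof (induction k)
    case (Suc k)
    show ?case
    proof (rule tendsto_sandwich[where f = "\<lambda>_. 0"])
      show "(\<lambda>j. dist (B j (z (Suc k))) (B j (z k)) + dist (B j (z k)) (B j z0)) \<longlonglongrightarrow> 0"
        using tendsto_add[OF z(7)[of k] Suc] by simp
    qed (auto intro!: always_eventually dist_triangle)
  qed (simp add: z(1))
  have Blim: "(\<lambda>j. dist (B j x) (B j z0)) \<longlonglongrightarrow> 0"
  proof (rule LIMSEQ_I)
    fix e :: real assume e: "e > 0"
    then obtain k where k: "\<epsilon> k < e / 4"
      using order_tendstoD(2)[OF \<epsilon>0, of "e / 4"] unfolding eventually_sequentially by auto
    have "\<forall>\<^sub>F j in sequentially. dist (B j (z k)) (B j z0) < e / 2"
      using order_tendstoD(2)[OF Bz, of "e / 2" k] e by simp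
    then have "\<forall>\<^sub>F j in sequentially. norm (dist (B j x) (B j z0) - 0) < e"
    proof eventually_elim
      case (elim j)
      then show ?case using Bnear[of j k] k dist_triangle[of "B j x" "B j z0" "B j (z k)"] by simp
    qed
    then show "\<exists>no. \<forall>n\<ge>no. norm (dist (B n x) (B n z0) - 0) < e" by (simp add: eventually_sequentially)
  qed
  show ?thesis
    using that[of x] x(1) seg tk near[of 0 0] Bnear[of _ 0] Blim z(1) by simp
qed

section \<open>Statistics of a shadowing orbit\<close>

text \<open>One stage consists of a gap, a shadowed segment and another gap, seen from its starting time:
  the sum of the deviations from \<open>u\<close> is small relative to the elapsed time up to a bounded
  contribution of the gaps and of the initial part of the segment.\<close>

lemma stage_deviation:
  fixes \<psi> :: "'a::metric_space \<Rightarrow> 'e::real_normed_vector"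
  assumes M: "\<And>i. norm (\<psi> ((f ^^ i) x) - u) \<le> M" and \<delta>: "\<delta> \<ge> 0"
    and sh: "\<And>i. i < L \<Longrightarrow> norm (\<psi> ((f ^^ (N + g + i)) x) - \<psi> ((f ^^ i) y)) \<le> \<delta>"
    and av: "\<And>n. T \<le> n \<Longrightarrow> n \<le> L \<Longrightarrow> deviation f \<psi> n y u \<le> \<delta> * real n"
    and TL: "T \<le> L" and r: "r \<le> g + L + g"
  shows "norm (\<Sum>i<r. \<psi> ((f ^^ (N + i)) x) - u) \<le> real (2 * g + T) * M + 2 * \<delta> * real r"
proof -
  have M0: "M \<ge> 0" using M[of 0] norm_ge_zero order_trans by blast
  let ?D = "\<lambda>i. \<psi> ((f ^^ (N + i)) x) - u"
  show ?thesis
  proof (cases "r \<le> g + T")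
    case True
    have "norm (\<Sum>i<r. ?D i) \<le> real r * M" using M by (intro norm_sum_bound) auto
    also have "\<dots> \<le> real (2 * g + T) * M" using True M0 by (intro mult_right_mono) auto
    finally show ?thesis using \<delta> by (simp add: add_increasing2)
  next
    case False
    \<comment> \<open>Of the \<open>r\<close> steps, \<open>s\<close> fall into the segment and \<open>q\<close> into the second gap.\<close>
    define s where "s = min (r - g) L"
    define q where "q = r - g - s"
    have s: "T \<le> s" "s \<le> L" "s \<le> r" "q \<le> g" and req: "r = (g + s) + q"
      using False TL r by (auto simp: s_def q_def min_def)
    have "(\<Sum>i<r. ?D i) = (\<Sum>i<g. ?D i) + (\<Sum>i<s. ?D (g + i)) + (\<Sum>i<q. ?D (g + s + i))"
      unfolding req by (subst sum_lessThan_split, subst sum_lessThan_split) simp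
    also have "(\<Sum>i<s. ?D (g + i)) = (\<Sum>i<s. \<psi> ((f ^^ (N + g + i)) x) - \<psi> ((f ^^ i) y)) +
       (birkhoff_sum f \<psi> s y - real s *\<^sub>R u)"
      by (simp add: birkhoff_sum_def sum_subtractf sum_constant_scaleR add.assoc)
    finally have eq: "(\<Sum>i<r. ?D i) = (\<Sum>i<g. ?D i) + ((\<Sum>i<s. \<psi> ((f ^^ (N + g + i)) x) - \<psi> ((f ^^ i) y)) +
       (birkhoff_sum f \<psi> s y - real s *\<^sub>R u)) + (\<Sum>i<q. ?D (g + s + i))" .
    have "norm (\<Sum>i<r. ?D i) \<le> real g * M + (real s * \<delta> + \<delta> * real s) + real q * M"
      unfolding eq using M sh av s by (intro norm_triangle_mono norm_sum_bound) auto
    also have "real q * M \<le> real g * M" using s M0 by (intro mult_right_mono) auto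
    also have "real g * M + (real s * \<delta> + \<delta> * real s) + real g * M = real (2 * g) * M + 2 * \<delta> * real s"
      by (simp add: algebra_simps)
    also have "\<dots> \<le> real (2 * g + T) * M + 2 * \<delta> * real r"
      using s \<delta> M0 by (intro add_mono mult_right_mono mult_left_mono) auto
    finally show ?thesis by simp
  qed
qed

text \<open>Stage \<open>k\<close> is so long that at its end, which is time \<open>N (k + 1)\<close>, the average is near \<open>u k\<close>. During the
next stage the average is a convex combination of that one with one near \<open>u (k + 1)\<close>, except for the
gap and the initial time \<open>T (k + 1)\<close>, which are negligible compared with the time elapsed. As
consecutive targets are close, the averages never leave a small neighbourhood of the targets.\<close>

lemma tower_averages:
  fixes \<psi> :: "'a::metric_space \<Rightarrow> 'e::real_normed_vector"
  assumes M: "\<And>i k. norm (\<psi> ((f ^^ i) x) - u k) \<le> M"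
    and \<delta>: "\<And>k. \<delta> k > 0" "\<delta> \<longlonglongrightarrow> 0" and u: "(\<lambda>k. dist (u k) (u (Suc k))) \<longlonglongrightarrow> 0"
    and N: "N 0 = 0" "\<And>k. N (Suc k) = N k + g k + L k + g k" "\<And>k. L k > 0"
    and sh: "\<And>k i. i \<le> L k \<Longrightarrow> norm (\<psi> ((f ^^ (N k + g k + i)) x) - \<psi> ((f ^^ i) (y k))) \<le> \<delta> k"
    and av: "\<And>k n. T k \<le> n \<Longrightarrow> n \<le> L k \<Longrightarrow> deviation f \<psi> n (y k) (u k) \<le> \<delta> k * real n"
    and big: "\<And>k. T k \<le> L k" "\<And>k. real (N k + 2 * g k + T k) * M \<le> \<delta> k * real (L k)"
      "\<And>k. real (2 * g (Suc k) + T (Suc k)) * M \<le> \<delta> k * real (L k)"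
  shows "\<And>e. e > 0 \<Longrightarrow> \<forall>\<^sub>F n in sequentially. \<exists>k. deviation f \<psi> n x (u k) \<le> e * real n"
    and "\<And>e. e > 0 \<Longrightarrow> \<forall>\<^sub>F k in sequentially. deviation f \<psi> (N (Suc k)) x (u k) \<le> e * real (N (Suc k))"
proof -
  have dev: "birkhoff_sum f \<psi> n x - real n *\<^sub>R v = (\<Sum>i<n. \<psi> ((f ^^ i) x) - v)" for n v
    by (simp add: birkhoff_sum_def sum_subtractf sum_constant_scaleR)
  have Nmono: "N k < N (Suc k)" for k using N(2)[of k] N(3)[of k] by simp
  then have Nge: "k \<le> N k" for k by (induction k) (auto simp: Suc_le_eq intro: le_less_trans)
  have LN: "real (L k) \<le> real (N (Suc k))" for k by (simp add: N)
  have stage: "norm (\<Sum>i<r. \<psi> ((f ^^ (N k + i)) x) - u k) \<le> real (2 * g k + T k) * M + 2 * \<delta> k * real r"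
    if "r \<le> g k + L k + g k" for r k
    by (rule stage_deviation[where L = "L k" and y = "y k"]) (use M \<delta> sh av big that in \<open>auto intro: less_imp_le\<close>)
  have E1: "deviation f \<psi> (N (Suc k)) x (u k) \<le> 3 * \<delta> k * real (N (Suc k))" for k
  proof -
    define r where "r = g k + L k + g k"
    have Nr: "N (Suc k) = N k + r" by (simp add: N r_def)
    have "birkhoff_sum f \<psi> (N (Suc k)) x - real (N (Suc k)) *\<^sub>R u k =
      (\<Sum>i<N k. \<psi> ((f ^^ i) x) - u k) + (\<Sum>i<r. \<psi> ((f ^^ (N k + i)) x) - u k)"
      unfolding dev Nr by (rule sum_lessThan_split)
    also have "norm \<dots> \<le> real (N k) * M + (real (2 * g k + T k) * M + 2 * \<delta> k * real r)"
      using M by (intro norm_triangle_mono norm_sum_bound stage) (auto simp: r_def)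
    also have "\<dots> = real (N k + 2 * g k + T k) * M + 2 * \<delta> k * real r"
      by (simp add: algebra_simps)
    also have "\<dots> \<le> \<delta> k * real (N (Suc k)) + 2 * \<delta> k * real (N (Suc k))"
    proof (intro add_mono)
      show "real (N k + 2 * g k + T k) * M \<le> \<delta> k * real (N (Suc k))"
        using big(2)[of k] mult_left_mono[OF LN[of k], of "\<delta> k"] \<delta>(1)[of k] by linarith
    qed (use \<delta>(1)[of k] Nr in \<open>auto intro!: mult_left_mono\<close>)
    finally show ?thesis by simp
  qed
  have E2: "norm (birkhoff_sum f \<psi> n x - real n *\<^sub>R u (Suc k)) \<le> (4 * \<delta> k + dist (u k) (u (Suc k)) + 2 * \<delta> (Suc k)) * real n"
    if n: "N (Suc k) \<le> n" "n \<le> N (Suc (Suc k))" for n k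
  proof -
    define r where "r = n - N (Suc k)"
    have nr: "n = N (Suc k) + r" and r: "r \<le> g (Suc k) + L (Suc k) + g (Suc k)"
      using n by (auto simp: r_def N(2)[of "Suc k"])
    have "birkhoff_sum f \<psi> n x - real n *\<^sub>R u (Suc k) =
       (\<Sum>i<N (Suc k). \<psi> ((f ^^ i) x) - u (Suc k)) + (\<Sum>i<r. \<psi> ((f ^^ (N (Suc k) + i)) x) - u (Suc k))"
      unfolding dev nr by (rule sum_lessThan_split)
    also have "(\<Sum>i<N (Suc k). \<psi> ((f ^^ i) x) - u (Suc k)) =
      (birkhoff_sum f \<psi> (N (Suc k)) x - real (N (Suc k)) *\<^sub>R u k) + real (N (Suc k)) *\<^sub>R (u k - u (Suc k))"
      unfolding dev by (simp add: sum_subtractf sum_constant_scaleR scaleR_diff_right)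
    finally have "norm (birkhoff_sum f \<psi> n x - real n *\<^sub>R u (Suc k)) \<le>
      (3 * \<delta> k * real (N (Suc k)) + real (N (Suc k)) * dist (u k) (u (Suc k))) +
      (real (2 * g (Suc k) + T (Suc k)) * M + 2 * \<delta> (Suc k) * real r)"
      using E1[of k] stage[OF r] by (auto simp: dist_norm intro!: norm_triangle_mono)
    also have "\<dots> \<le> (3 * \<delta> k * real n + real n * dist (u k) (u (Suc k))) + (\<delta> k * real n + 2 * \<delta> (Suc k) * real n)"
    proof (intro add_mono)
      have "real (L k) \<le> real n" using LN[of k] n by simp
      then show "real (2 * g (Suc k) + T (Suc k)) * M \<le> \<delta> k * real n"
        using big(3)[of k] mult_left_mono[of "real (L k)" "real n" "\<delta> k"] \<delta>(1)[of k] by linarith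
      show "3 * \<delta> k * real (N (Suc k)) \<le> 3 * \<delta> k * real n"
        using \<delta>(1)[of k] n by (intro mult_left_mono) auto
      show "real (N (Suc k)) * dist (u k) (u (Suc k)) \<le> real n * dist (u k) (u (Suc k))"
        using n by (intro mult_right_mono) auto
      show "2 * \<delta> (Suc k) * real r \<le> 2 * \<delta> (Suc k) * real n"
        using \<delta>(1)[of "Suc k"] nr by (intro mult_left_mono) auto
    qed
    finally show ?thesis by (simp add: algebra_simps)
  qed
  show "\<forall>\<^sub>F k in sequentially. deviation f \<psi> (N (Suc k)) x (u k) \<le> e * real (N (Suc k))"
    if e: "e > 0" for e
  proof -
    have "\<forall>\<^sub>F k in sequentially. \<delta> k < e / 3" using order_tendstoD(2)[OF \<delta>(2), of "e / 3"] e by simp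
    then show ?thesis
    proof eventually_elim
      case (elim k)
      then have "3 * \<delta> k * real (N (Suc k)) \<le> e * real (N (Suc k))" by (intro mult_right_mono) auto
      then show ?case using E1[of k] by linarith
    qed
  qed
  show "\<forall>\<^sub>F n in sequentially. \<exists>k. deviation f \<psi> n x (u k) \<le> e * real n" if e: "e > 0" for e
  proof -
    have "(\<lambda>k. 4 * \<delta> k + dist (u k) (u (Suc k)) + 2 * \<delta> (Suc k)) \<longlonglongrightarrow> 4 * 0 + 0 + 2 * 0"
      using \<delta>(2) u by (intro tendsto_intros) (simp_all add: filterlim_sequentially_Suc)
    then have "\<forall>\<^sub>F k in sequentially. 4 * \<delta> k + dist (u k) (u (Suc k)) + 2 * \<delta> (Suc k) < e"
      using e by (intro order_tendstoD(2)) auto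
    then obtain k0 where k0: "\<And>k. k \<ge> k0 \<Longrightarrow> 4 * \<delta> k + dist (u k) (u (Suc k)) + 2 * \<delta> (Suc k) < e"
      unfolding eventually_sequentially by blast
    have "\<exists>k. deviation f \<psi> n x (u k) \<le> e * real n" if n: "n \<ge> N (Suc k0)" for n
    proof -
      define m where "m = (LEAST m. n < N m)"
      have "n < N (Suc n)" using Nge[of "Suc n"] by simp
      then have m: "n < N m" "\<And>m'. m' < m \<Longrightarrow> N m' \<le> n"
        unfolding m_def by (rule LeastI, metis not_less_Least not_less)
      have "strict_mono N" using Nmono by (simp add: strict_mono_Suc_iff)
      then have "m > Suc k0" using m(1) n by (metis le_less_trans strict_mono_less)
      then obtain k where k: "m = Suc (Suc k)" "k \<ge> k0"
        by (cases m; cases "m - 1") auto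
      have "norm (birkhoff_sum f \<psi> n x - real n *\<^sub>R u (Suc k)) \<le> (4 * \<delta> k + dist (u k) (u (Suc k)) + 2 * \<delta> (Suc k)) * real n"
        using m k by (intro E2) auto
      also have "\<dots> \<le> e * real n" using k0[OF k(2)] by (intro mult_right_mono) auto
      finally show ?thesis by blast
    qed
    then show ?thesis unfolding eventually_sequentially by blast
  qed
qed

text \<open>If two orbits shadow the same segment from time \<open>a\<close> on, their distances at these times are at most
  \<open>2 \<epsilon>\<close>, and in the summed case they even add up to at most \<open>2 \<epsilon>\<close>. What was accumulated before time
  \<open>a\<close> is overtaken by \<open>\<alpha>\<close> from some time \<open>start\<close> on, which is early in a long segment.\<close>

lemma stage_proximal:
  assumes sh: "shadows f summed \<epsilon> x y a L" "shadows f summed \<epsilon> x' y a L"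
    and a: "real a \<le> \<delta> * real L" and \<delta>: "\<delta> \<ge> 0"
  shows "2 * \<epsilon> < t \<Longrightarrow> close_time f t (a + L) x x' \<ge> (1 - \<delta>) * real (a + L)"
    and "summed \<Longrightarrow> (\<And>i. dist ((f ^^ i) x) ((f ^^ i) x') \<le> M) \<Longrightarrow> real start \<le> \<delta> * real L \<Longrightarrow>
      (\<And>i. i \<ge> start \<Longrightarrow> real a * M + 2 * \<epsilon> < \<alpha> i * t) \<Longrightarrow>
      real (card {i\<in>{1..a + L}. (\<Sum>j<i. dist ((f ^^ j) x) ((f ^^ j) x')) < \<alpha> i * t}) \<ge> (1 - \<delta>) * real (a + L)"
proof -
  have tri: "dist ((f ^^ (a + i)) x) ((f ^^ (a + i)) x') \<le>
     dist ((f ^^ (a + i)) x) ((f ^^ i) y) + dist ((f ^^ (a + i)) x') ((f ^^ i) y)" for i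
    by (rule dist_triangle2)
  have \<delta>L: "\<delta> * real L \<le> \<delta> * real (a + L)" using \<delta> by (intro mult_left_mono) auto
  show "close_time f t (a + L) x x' \<ge> (1 - \<delta>) * real (a + L)" if t: "2 * \<epsilon> < t"
  proof -
    have "dist ((f ^^ (a + i)) x) ((f ^^ (a + i)) x') < t" if "i < L" for i
    proof -
      have "dist ((f ^^ (a + i)) x) ((f ^^ i) y) \<le> \<epsilon>" "dist ((f ^^ (a + i)) x') ((f ^^ i) y) \<le> \<epsilon>"
        using sh that by (auto simp: shadows_def)
      then show ?thesis using tri[of i] t by linarith
    qed
    then have "(\<Sum>i<L. of_bool (dist ((f ^^ (a + i)) x) ((f ^^ (a + i)) x') < t)) = real L"
      by simp
    moreover have "(\<Sum>i<a. of_bool (dist ((f ^^ i) x) ((f ^^ i) x') < t)) \<ge> (0::real)"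
      by (intro sum_nonneg) auto
    ultimately have "close_time f t (a + L) x x' \<ge> real L"
      unfolding close_time_def by (subst sum_lessThan_split) linarith
    then show ?thesis using a \<delta>L by (simp add: algebra_simps)
  qed
  assume s: summed and M: "\<And>i. dist ((f ^^ i) x) ((f ^^ i) x') \<le> M" and start: "real start \<le> \<delta> * real L"
    and \<alpha>: "\<And>i. i \<ge> start \<Longrightarrow> real a * M + 2 * \<epsilon> < \<alpha> i * t"
  let ?d = "\<lambda>j. dist ((f ^^ j) x) ((f ^^ j) x')"
  have total: "(\<Sum>j<a + L. ?d j) \<le> real a * M + 2 * \<epsilon>"
  proof -
    have "(\<Sum>i<L. ?d (a + i)) \<le> (\<Sum>i\<le>L. dist ((f ^^ (a + i)) x) ((f ^^ i) y) + dist ((f ^^ (a + i)) x') ((f ^^ i) y))"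
      using tri by (intro order_trans[OF sum_mono sum_mono2]) auto
    also have "\<dots> \<le> 2 * \<epsilon>" using sh s unfolding sum.distrib shadows_def by simp
    finally have "(\<Sum>i<L. ?d (a + i)) \<le> 2 * \<epsilon>" .
    moreover have "(\<Sum>j<a. ?d j) \<le> real a * M" using sum_mono[of "{..<a}" ?d "\<lambda>_. M"] M by simp
    ultimately show ?thesis by (subst sum_lessThan_split) linarith
  qed
  have "{Suc start..a + L} \<subseteq> {i\<in>{1..a + L}. (\<Sum>j<i. ?d j) < \<alpha> i * t}"
  proof
    fix i assume i: "i \<in> {Suc start..a + L}"
    have "(\<Sum>j<i. ?d j) \<le> (\<Sum>j<a + L. ?d j)" using i by (intro sum_mono2) auto
    then show "i \<in> {i\<in>{1..a + L}. (\<Sum>j<i. ?d j) < \<alpha> i * t}" using \<alpha>[of i] total i by auto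
  qed
  then have "card {Suc start..a + L} \<le> card {i\<in>{1..a + L}. (\<Sum>j<i. ?d j) < \<alpha> i * t}"
    by (intro card_mono) auto
  then have "real (a + L) - real start \<le> real (card {i\<in>{1..a + L}. (\<Sum>j<i. ?d j) < \<alpha> i * t})"
    by simp
  then show "real (card {i\<in>{1..a + L}. (\<Sum>j<i. ?d j) < \<alpha> i * t}) \<ge> (1 - \<delta>) * real (a + L)"
    using start \<delta>L by (simp add: algebra_simps)
qed

lemma stage_separated:
  assumes sh: "shadows f summed \<epsilon> x y a L" "shadows f summed \<epsilon> x' y' a L"
    and a: "real a \<le> \<delta> * real L" and \<delta>: "\<delta> \<ge> 0" and \<epsilon>: "4 * \<epsilon> \<le> \<tau>"
    and sep: "close_time f \<tau> L y y' \<le> \<delta> * real L"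
  shows "close_time f (\<tau> / 2) (a + L) x x' \<le> 2 * \<delta> * real (a + L)"
proof -
  have "of_bool (dist ((f ^^ (a + i)) x) ((f ^^ (a + i)) x') < \<tau> / 2) \<le> (of_bool (dist ((f ^^ i) y) ((f ^^ i) y') < \<tau>) :: real)"
    if "i < L" for i
  proof -
    have "dist ((f ^^ (a + i)) x) ((f ^^ i) y) \<le> \<epsilon>" "dist ((f ^^ (a + i)) x') ((f ^^ i) y') \<le> \<epsilon>"
      using sh that by (auto simp: shadows_def)
    moreover have "dist ((f ^^ i) y) ((f ^^ i) y') \<le> dist ((f ^^ (a + i)) x) ((f ^^ i) y) +
       dist ((f ^^ (a + i)) x) ((f ^^ (a + i)) x') + dist ((f ^^ (a + i)) x') ((f ^^ i) y')"
      using dist_triangle[of "(f ^^ i) y" "(f ^^ i) y'" "(f ^^ (a + i)) x"]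
        dist_triangle[of "(f ^^ (a + i)) x" "(f ^^ i) y'" "(f ^^ (a + i)) x'"] by (simp add: dist_commute)
    ultimately show ?thesis using \<epsilon> by auto
  qed
  then have "(\<Sum>i<L. of_bool (dist ((f ^^ (a + i)) x) ((f ^^ (a + i)) x') < \<tau> / 2)) \<le> close_time f \<tau> L y y'"
    unfolding close_time_def by (intro sum_mono) auto
  moreover have "(\<Sum>i<a. of_bool (dist ((f ^^ i) x) ((f ^^ i) x') < \<tau> / 2)) \<le> (\<Sum>i<a. 1 :: real)"
    by (intro sum_mono) auto
  ultimately have "close_time f (\<tau> / 2) (a + L) x x' \<le> real a + \<delta> * real L"
    unfolding close_time_def using sep[unfolded close_time_def] by (subst sum_lessThan_split) auto
  also have "\<dots> \<le> 2 * \<delta> * real (a + L)"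
  proof -
    have "\<delta> * real L \<le> \<delta> * real (a + L)" using \<delta> by (intro mult_left_mono) auto
    then show ?thesis using a by linarith
  qed
  finally show ?thesis .
qed

section \<open>A scrambled family with prescribed averages\<close>

text \<open>The targets form a walk in \<open>K\<close> with smaller and smaller steps which returns to \<open>v\<close> infinitely often.
At each visit to \<open>v\<close> one stage offers two segments which stay apart, and the binary sequence \<open>\<xi>\<close>
decides which of them is followed; at all other stages the segment is the same for all \<open>\<xi>\<close>. Two
different sequences make different choices infinitely often, so the corresponding points are far
apart most of the time at the end of some stages and close most of the time at the end of others. All
stages end at times that do not depend on \<open>\<xi>\<close>.\<close>

lemma scrambled_family:
  fixes \<psi> :: "'a::metric_space \<Rightarrow> 'e::real_normed_vector" and \<alpha> :: "nat \<Rightarrow> real"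
    and Xs :: "nat \<Rightarrow> 'a set"
  assumes X: "compact X" "continuous_on X f" "f ` X \<subseteq> X" and B: "\<And>j. continuous_on X (B j)"
    and Xs: "\<And>l. l \<ge> 1 \<Longrightarrow> Xs l \<subseteq> X" "\<And>m n. 1 \<le> m \<Longrightarrow> m \<le> n \<Longrightarrow> Xs m \<subseteq> Xs n"
      "X \<subseteq> closure (\<Union>l\<in>{1..}. Xs l)"
    and gl: "\<And>l \<epsilon>. l \<ge> 1 \<Longrightarrow> \<epsilon> > 0 \<Longrightarrow> \<exists>g. gluing f B summed (Xs l) \<epsilon> g"
    and \<psi>: "continuous_on X \<psi>"
    and K: "compact K" "connected K" "v \<in> K" and \<tau>: "\<tau> > 0"
    and app: "\<And>u \<delta>. u \<in> K \<Longrightarrow> \<delta> > 0 \<Longrightarrow> \<exists>l\<ge>1. \<exists>T. \<forall>L. \<exists>y\<in>Xs l. \<exists>y'\<in>Xs l. tracked f \<psi> u False \<tau> \<delta> T L y y'"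
    and appv: "\<And>\<delta>. \<delta> > 0 \<Longrightarrow> \<exists>l\<ge>1. \<exists>T. \<forall>L. \<exists>y\<in>Xs l. \<exists>y'\<in>Xs l. tracked f \<psi> v True \<tau> \<delta> T L y y'"
    and z0: "lz \<ge> 1" "z0 \<in> Xs lz" and r: "r > 0" and \<alpha>: "filterlim \<alpha> at_top sequentially"
  shows "\<exists>x :: (nat \<Rightarrow> bool) \<Rightarrow> 'a.
    (\<forall>\<xi>. x \<xi> \<in> X \<and> dist (x \<xi>) z0 \<le> r \<and> (\<forall>j. dist (B j (x \<xi>)) (B j z0) \<le> r) \<and>
      (\<lambda>j. dist (B j (x \<xi>)) (B j z0)) \<longlonglongrightarrow> 0 \<and> x \<xi> \<in> Trans X f) \<and>
    (\<forall>\<xi>. \<forall>e>0. \<forall>\<^sub>F n in sequentially. \<exists>u\<in>K. deviation f \<psi> n (x \<xi>) u \<le> e * real n) \<and>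
    (\<forall>\<xi>. \<forall>u\<in>K. \<forall>e>0. \<exists>\<^sub>F n in sequentially. deviation f \<psi> n (x \<xi>) u \<le> e * real n) \<and>
    (\<forall>\<xi> \<eta>. \<forall>e>0. \<xi> \<noteq> \<eta> \<longrightarrow> (\<exists>\<^sub>F n in sequentially. close_time f (\<tau> / 2) n (x \<xi>) (x \<eta>) \<le> e * real n)) \<and>
    (\<forall>\<xi> \<eta>. \<forall>t>0. \<forall>e>0. \<exists>\<^sub>F n in sequentially. close_time f t n (x \<xi>) (x \<eta>) \<ge> (1 - e) * real n) \<and>
    (summed \<longrightarrow> (\<forall>\<xi> \<eta>. \<forall>t>0. \<forall>e>0. \<exists>\<^sub>F n in sequentially.
       real (card {i\<in>{1..n}. (\<Sum>j<i. dist ((f ^^ j) (x \<xi>)) ((f ^^ j) (x \<eta>))) < \<alpha> i * t}) \<ge> (1 - e) * real n))"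
proof -
  define \<delta> where "\<delta> k = 1 / real (Suc k)" for k
  have \<delta>: "\<delta> k > 0" for k by (simp add: \<delta>_def)
  have \<delta>0: "\<delta> \<longlonglongrightarrow> 0" unfolding \<delta>_def by (rule LIMSEQ_Suc[OF lim_1_over_n])
  have \<delta>ev: "\<forall>\<^sub>F k in sequentially. \<delta> k < e" if "e > 0" for e
    using order_tendstoD(2)[OF \<delta>0 that] .
  obtain M1 where M1: "\<And>y. y \<in> X \<Longrightarrow> norm (\<psi> y) \<le> M1"
    using compact_imp_bounded[OF compact_continuous_image[OF \<psi> X(1)]] unfolding bounded_iff by auto
  obtain M2 where M2: "\<And>u. u \<in> K \<Longrightarrow> norm u \<le> M2"
    using compact_imp_bounded[OF K(1)] unfolding bounded_iff by auto
  obtain D where D: "\<And>y y'. y \<in> X \<Longrightarrow> y' \<in> X \<Longrightarrow> dist y y' \<le> D"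
    using compact_imp_bounded[OF X(1)] unfolding bounded_two_points by blast
  define M where "M = M1 + M2"
  have M: "norm (\<psi> y - u) \<le> M" if "y \<in> X" "u \<in> K" for y u
    using norm_triangle_ineq4[of "\<psi> y" u] M1[OF that(1)] M2[OF that(2)] by (simp add: M_def)
  have "\<exists>\<epsilon>>0. \<forall>y\<in>X. \<forall>y'\<in>X. dist y y' < \<epsilon> \<longrightarrow> norm (\<psi> y - \<psi> y') < \<delta> k" for k
    using compact_uniformly_continuous[OF \<psi> X(1)] \<delta>[of k]
    unfolding uniformly_continuous_on_def by (metis dist_norm)
  then obtain \<omega> where \<omega>: "\<And>k. \<omega> k > 0" "\<And>k y y'. y \<in> X \<Longrightarrow> y' \<in> X \<Longrightarrow> dist y y' < \<omega> k \<Longrightarrow> norm (\<psi> y - \<psi> y') < \<delta> k"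
    by metis
  \<comment> \<open>The targets: every point of the walk is used for two consecutive stages, and the second of
    them is used for separation whenever the walk is at \<open>v\<close>.\<close>
  obtain w where w: "\<And>k. w k \<in> K" "(\<lambda>k. dist (w k) (w (Suc k))) \<longlonglongrightarrow> 0" "infinite {k. w k = v}"
    "\<And>u e. u \<in> K \<Longrightarrow> e > 0 \<Longrightarrow> \<exists>\<^sub>F k in sequentially. dist (w k) u < e"
    using continuum_walk[OF K] by metis
  define u where "u k = w (k div 2)" for k
  define sep where "sep k \<longleftrightarrow> odd k \<and> w (k div 2) = v" for k
  have uK: "u k \<in> K" for k using w(1) by (simp add: u_def)
  have u0: "(\<lambda>k. dist (u k) (u (Suc k))) \<longlonglongrightarrow> 0"
  proof (rule tendsto_sandwich[where f = "\<lambda>_. 0"])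
    have "filterlim (\<lambda>k::nat. k div 2) at_top sequentially"
      unfolding filterlim_at_top eventually_sequentially by (metis div_le_mono nonzero_mult_div_cancel_left zero_neq_numeral)
    then show "(\<lambda>k. dist (w (k div 2)) (w (Suc (k div 2)))) \<longlonglongrightarrow> 0"
      using filterlim_compose[OF w(2)] by blast
    have "dist (u k) (u (Suc k)) \<le> dist (w (k div 2)) (w (Suc (k div 2)))" for k
      by (cases "even k") (auto simp: u_def elim!: evenE oddE)
    then show "\<forall>\<^sub>F k in sequentially. dist (u k) (u (Suc k)) \<le> dist (w (k div 2)) (w (Suc (k div 2)))" by simp
  qed auto
  define J where "J = {k. sep k}"
  have J: "infinite J"
  proof -
    have "(\<lambda>k. 2 * k + 1) ` {k. w k = v} \<subseteq> J" by (auto simp: J_def sep_def)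
    moreover have "infinite ((\<lambda>k. 2 * k + 1) ` {k. w k = v})"
      using w(3) by (subst finite_image_iff) (auto simp: inj_on_def)
    ultimately show ?thesis using finite_subset by blast
  qed
  obtain b :: "nat \<Rightarrow> (nat \<Rightarrow> bool) \<Rightarrow> bool" where b: "\<And>\<xi> \<eta>. \<xi> \<noteq> \<eta> \<Longrightarrow> infinite {j \<in> J. b j \<xi> \<noteq> b j \<eta>}"
    using infinitely_often_distinct_coding[OF J] by metis
  have "\<exists>l\<ge>1. \<exists>T. \<forall>L. \<exists>y\<in>Xs l. \<exists>y'\<in>Xs l. tracked f \<psi> (u k) (sep k) \<tau> (\<delta> k) T L y y'" for k
  proof (cases "sep k")
    case True
    then show ?thesis using appv[OF \<delta>[of k]] by (simp add: sep_def u_def)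
  next
    case False
    then show ?thesis using app[OF uK[of k] \<delta>[of k]] by simp
  qed
  then obtain lq T where lq: "\<And>k. lq k \<ge> 1"
     "\<And>k L. \<exists>y\<in>Xs (lq k). \<exists>y'\<in>Xs (lq k). tracked f \<psi> (u k) (sep k) \<tau> (\<delta> k) (T k) L y y'"
    by metis
  then obtain ya yb where yab: "\<And>k L. ya k L \<in> Xs (lq k)" "\<And>k L. yb k L \<in> Xs (lq k)"
     "\<And>k L. tracked f \<psi> (u k) (sep k) \<tau> (\<delta> k) (T k) L (ya k L) (yb k L)"
    by metis
  \<comment> \<open>Visiting points \<open>t k\<close> such that every tail of the sequence is dense makes the orbit dense.\<close>
  have z0X: "z0 \<in> X" using z0 Xs(1) by blast
  then have Xne: "X \<noteq> {}" by blast
  obtain s :: "nat \<Rightarrow> 'a" where s: "range s \<subseteq> X" "X \<subseteq> closure (range s)"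
    by (rule compact_countable_dense[OF X(1) Xne])
  have "\<exists>l t. l \<ge> 1 \<and> t \<in> Xs l \<and> dist t (s (fst (prod_decode k))) < \<delta> k" for k
  proof -
    have "s (fst (prod_decode k)) \<in> closure (\<Union>l\<in>{1..}. Xs l)" using s(1) Xs(3) by blast
    then show ?thesis using \<delta>[of k] unfolding closure_approachable by fastforce
  qed
  then obtain lt t where t: "\<And>k. lt k \<ge> 1" "\<And>k. t k \<in> Xs (lt k)" "\<And>k. dist (t k) (s (fst (prod_decode k))) < \<delta> k"
    by metis
  \<comment> \<open>Levels, precisions and gaps are fixed before any time is chosen.\<close>
  define l where "l k = lz + (\<Sum>i\<le>k. lq i + lt i)" for k
  have l1: "l k \<ge> 1" for k using z0 by (simp add: l_def)
  have llq: "lq k \<le> l k" for k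
    using member_le_sum[of k "{..k}" "\<lambda>i. lq i + lt i"] by (simp add: l_def)
  have llt: "lt k \<le> l k" for k
    using member_le_sum[of k "{..k}" "\<lambda>i. lq i + lt i"] by (simp add: l_def)
  have lSuc: "l k \<le> l (Suc k)" for k by (simp add: l_def)
  \<comment> \<open>The bounds \<open>1/2\<close> and \<open>r/2\<close> make the precisions halve and keep the point near \<open>z0\<close>; \<open>\<omega> k\<close>
    controls \<open>\<psi>\<close>, \<open>\<tau>/8\<close> preserves separation, and \<open>\<delta> k\<close> makes the precisions tend to \<open>0\<close>.\<close>
  define e where "e k = min (min (1/2) (r / 2)) (min (\<omega> k / 4) (min (\<tau> / 8) (\<delta> k)))" for k
  have e0: "e k > 0" for k using r \<omega>(1)[of k] \<tau> \<delta>[of k] by (simp add: e_def)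
  have ele: "e k \<le> 1/2" "e k \<le> r / 2" "e k \<le> \<omega> k / 4" "e k \<le> \<tau> / 8" "e k \<le> \<delta> k" for k
    by (simp_all add: e_def)
  define \<epsilon> where "\<epsilon> k = (\<Prod>i\<le>k. e i)" for k
  have \<epsilon>0: "\<epsilon> k > 0" for k using e0 by (simp add: \<epsilon>_def prod_pos)
  have \<epsilon>1: "\<epsilon> k \<le> 1" for k unfolding \<epsilon>_def using e0 ele(1) by (intro prod_le_1) (smt (verit) field_sum_of_halves)
  have \<epsilon>Suc: "\<epsilon> (Suc k) = \<epsilon> k * e (Suc k)" for k by (simp add: \<epsilon>_def)
  have \<epsilon>half: "\<epsilon> (Suc k) \<le> \<epsilon> k / 2" for k
    unfolding \<epsilon>Suc using mult_left_mono[OF ele(1)[of "Suc k"], of "\<epsilon> k"] \<epsilon>0[of k] by simp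
  have \<epsilon>e: "\<epsilon> k \<le> e k" for k
  proof (cases k)
    case (Suc m)
    then show ?thesis using \<epsilon>Suc[of m] mult_right_mono[OF \<epsilon>1[of m], of "e k"] e0[of k] by simp
  qed (simp add: \<epsilon>_def)
  have "\<exists>g. gluing f B summed (Xs (l k)) (\<epsilon> k) g" for k using gl[OF l1 \<epsilon>0] .
  then obtain g where g: "\<And>k. gluing f B summed (Xs (l k)) (\<epsilon> k) (g k)" by metis
  \<comment> \<open>The lengths of the segments are chosen last, each one huge compared with everything that
    was fixed or has happened before.\<close>
  have "\<exists>i0. \<forall>i\<ge>i0. real (N + g k) * D + 4 * \<epsilon> k < \<alpha> i * \<delta> k \<and> 0 \<le> \<alpha> i" for N k
  proof -
    have "\<forall>\<^sub>F i in sequentially. max 0 ((real (N + g k) * D + 4 * \<epsilon> k) / \<delta> k) < \<alpha> i"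
      using \<alpha> unfolding filterlim_at_top_dense by blast
    then obtain i0 where i0: "\<And>i. i \<ge> i0 \<Longrightarrow> max 0 ((real (N + g k) * D + 4 * \<epsilon> k) / \<delta> k) < \<alpha> i"
      unfolding eventually_sequentially by blast
    then show ?thesis using \<delta>[of k] by (intro exI[of _ i0] allI impI) (auto simp: pos_divide_less_eq less_imp_le)
  qed
  then obtain i0 where i0: "\<And>N k i. i \<ge> i0 N k \<Longrightarrow> real (N + g k) * D + 4 * \<epsilon> k < \<alpha> i * \<delta> k"
      "\<And>N k i. i \<ge> i0 N k \<Longrightarrow> 0 \<le> \<alpha> i" by metis
  define long where "long N k L \<longleftrightarrow> L > 0 \<and> T k \<le> L \<and> real (N + 2 * g k + T k) * M \<le> \<delta> k * real L \<and>
    real (2 * g (Suc k) + T (Suc k)) * M \<le> \<delta> k * real L \<and> real (N + g k) \<le> \<delta> k * real L \<and>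
    real (i0 N k) \<le> \<delta> k * real L" for N k L
  have "\<exists>L. long N k L" for N k
  proof -
    have ev: "\<forall>\<^sub>F L in sequentially. c \<le> \<delta> k * real L" for c
    proof -
      have "filterlim (\<lambda>L. \<delta> k * real L) at_top sequentially"
        using filterlim_tendsto_pos_mult_at_top[OF tendsto_const \<delta> filterlim_real_sequentially] .
      then show ?thesis unfolding filterlim_at_top by blast
    qed
    have "\<forall>\<^sub>F L in sequentially. long N k L"
      unfolding long_def by (intro eventually_conj ev eventually_gt_at_top eventually_ge_at_top)
    then show ?thesis using eventually_happens' sequentially_bot by blast
  qed
  then obtain Lf where "\<And>N k. long N k (Lf N k)" by metis
  then have Lf: "\<And>N k. Lf N k > 0" "\<And>N k. T k \<le> Lf N k"
     "\<And>N k. real (N + 2 * g k + T k) * M \<le> \<delta> k * real (Lf N k)"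
     "\<And>N k. real (2 * g (Suc k) + T (Suc k)) * M \<le> \<delta> k * real (Lf N k)"
     "\<And>N k. real (N + g k) \<le> \<delta> k * real (Lf N k)" "\<And>N k. real (i0 N k) \<le> \<delta> k * real (Lf N k)"
    unfolding long_def by blast+
  define N where "N = rec_nat 0 (\<lambda>k n. n + g k + Lf n k + g k)"
  define L where "L k = Lf (N k) k" for k
  define a where "a k = N k + g k" for k
  have N0: "N 0 = 0" and NS: "N (Suc k) = N k + g k + L k + g k" for k by (simp_all add: N_def L_def)
  have NSuc: "N k < N (Suc k)" for k using Lf(1)[of "N k" k] by (simp add: NS L_def)
  then have Nge: "k \<le> N k" for k by (induction k) (auto simp: Suc_le_eq intro: le_less_trans)
  have aL_ge: "k \<le> a k + L k" for k using Nge[of k] by (simp add: a_def)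
  define y where "y \<xi> k = (if b k \<xi> then ya k (L k) else yb k (L k))" for \<xi> k
  have yX: "y \<xi> k \<in> Xs (l k)" "t k \<in> Xs (l k)" for \<xi> k
    using yab(1,2)[of k "L k"] Xs(2)[OF lq(1)[of k] llq] t(2)[of k] Xs(2)[OF t(1)[of k] llt]
    by (auto simp: y_def)
  define good where "good \<xi> x \<longleftrightarrow> x \<in> X \<and> (\<forall>k. shadows f summed (2 * \<epsilon> k) x (y \<xi> k) (a k) (L k)) \<and>
     (\<forall>k. dist ((f ^^ N (Suc k)) x) (t k) \<le> 2 * \<epsilon> k) \<and> dist x z0 \<le> 2 * \<epsilon> 0 \<and>
     (\<forall>j. dist (B j x) (B j z0) \<le> 2 * \<epsilon> 0) \<and> (\<lambda>j. dist (B j x) (B j z0)) \<longlonglongrightarrow> 0" for \<xi> x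
  have "\<exists>x. good \<xi> x" for \<xi>
  proof -
    have "z0 \<in> Xs (l 0)" using z0 Xs(2)[of lz "l 0"] by (auto simp: l_def)
    then show ?thesis
      unfolding good_def a_def
      by (rule tower_limit[where Y = "\<lambda>k. Xs (l k)" and y = "y \<xi>" and t = t,
            OF X B Xs(1)[OF l1] Xs(2)[OF l1 lSuc] g \<epsilon>0 \<epsilon>half NS yX]) blast
  qed
  then obtain x where "\<And>\<xi>. good \<xi> (x \<xi>)" by metis
  then have x: "\<And>\<xi>. x \<xi> \<in> X" "\<And>\<xi> k. shadows f summed (2 * \<epsilon> k) (x \<xi>) (y \<xi> k) (a k) (L k)"
     "\<And>\<xi> k. dist ((f ^^ N (Suc k)) (x \<xi>)) (t k) \<le> 2 * \<epsilon> k" "\<And>\<xi>. dist (x \<xi>) z0 \<le> 2 * \<epsilon> 0"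
     "\<And>\<xi> j. dist (B j (x \<xi>)) (B j z0) \<le> 2 * \<epsilon> 0" "\<And>\<xi>. (\<lambda>j. dist (B j (x \<xi>)) (B j z0)) \<longlonglongrightarrow> 0"
    unfolding good_def by blast+
  have \<epsilon>r: "2 * \<epsilon> 0 \<le> r" using \<epsilon>e[of 0] ele(2)[of 0] by simp
  have trans: "x \<xi> \<in> Trans X f" for \<xi>
  proof -
    have "p \<in> closure (range (\<lambda>n. (f ^^ n) (x \<xi>)))" if p: "p \<in> X" for p
      unfolding closure_approachable
    proof (intro allI impI)
      fix c :: real assume c: "c > 0"
      then obtain m where m: "dist (s m) p < c / 4"
        using p s(2) unfolding closure_approachable subset_iff by (metis (no_types, lifting) rangeE zero_less_divide_iff zero_less_numeral)
      obtain k0 where k0: "\<And>k. k \<ge> k0 \<Longrightarrow> \<delta> k < c / 4"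
        using \<delta>ev[of "c / 4"] c unfolding eventually_sequentially by auto
      define k where "k = prod_encode (m, k0)"
      have k: "k \<ge> k0" "fst (prod_decode k) = m" by (simp_all add: k_def le_prod_encode_2)
      have "dist ((f ^^ N (Suc k)) (x \<xi>)) p \<le> dist ((f ^^ N (Suc k)) (x \<xi>)) (t k) + dist (t k) (s m) + dist (s m) p"
        using dist_triangle[of "(f ^^ N (Suc k)) (x \<xi>)" p "t k"] dist_triangle[of "t k" p "s m"] by simp
      also have "\<dots> < c"
        using x(3)[where k = k and \<xi> = \<xi>] t(3)[of k] m k0[OF k(1)] k(2) \<epsilon>e[of k] ele(5)[of k] by simp
      finally show "\<exists>q\<in>range (\<lambda>n. (f ^^ n) (x \<xi>)). dist q p < c" by blast
    qed
    then show ?thesis using x(1) by (auto simp: Trans_def)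
  qed
  have orbX: "(f ^^ i) (x \<xi>) \<in> X" for i \<xi> using funpow_in[OF X(3) x(1)] .
  have yXX: "y \<xi> k \<in> X" for \<xi> k using yX(1) Xs(1)[OF l1] by blast
  have shN: "norm (\<psi> ((f ^^ (N k + g k + i)) (x \<xi>)) - \<psi> ((f ^^ i) (y \<xi> k))) \<le> \<delta> k" if "i \<le> L k" for i k \<xi>
  proof (rule less_imp_le, rule \<omega>(2)[OF orbX funpow_in[OF X(3) yXX]])
    show "dist ((f ^^ (N k + g k + i)) (x \<xi>)) ((f ^^ i) (y \<xi> k)) < \<omega> k"
      using x(2)[of k \<xi>] that \<epsilon>e[of k] ele(3)[of k] \<omega>(1)[of k] unfolding shadows_def a_def by fastforce
  qed
  have avN: "deviation f \<psi> n (y \<xi> k) (u k) \<le> \<delta> k * real n" if "T k \<le> n" "n \<le> L k" for n k \<xi>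
    using yab(3)[of k "L k"] that by (auto simp: tracked_def y_def)
  have Lk: "L k > 0" "T k \<le> L k" "real (N k + 2 * g k + T k) * M \<le> \<delta> k * real (L k)"
    "real (2 * g (Suc k) + T (Suc k)) * M \<le> \<delta> k * real (L k)" for k
    unfolding L_def by (rule Lf)+
  have averages1: "\<forall>\<^sub>F n in sequentially. \<exists>k. deviation f \<psi> n (x \<xi>) (u k) \<le> c * real n" if "c > 0" for c \<xi>
    by (rule tower_averages(1)[where M = M and \<delta> = \<delta> and u = u and N = N and g = g and L = L and T = T and y = "y \<xi>"];
        (rule M[OF orbX uK] \<delta> \<delta>0 u0 N0 NS Lk shN avN that; assumption)?)
  have averages2: "\<forall>\<^sub>F k in sequentially. deviation f \<psi> (N (Suc k)) (x \<xi>) (u k) \<le> c * real (N (Suc k))" if "c > 0" for c \<xi>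
    by (rule tower_averages(2)[where M = M and \<delta> = \<delta> and u = u and N = N and g = g and L = L and T = T and y = "y \<xi>"];
        (rule M[OF orbX uK] \<delta> \<delta>0 u0 N0 NS Lk shN avN that; assumption)?)
  have freq: "\<exists>\<^sub>F n in sequentially. P n" if A: "infinite A" and PA: "\<And>k. k \<in> A \<Longrightarrow> k \<ge> k0 \<Longrightarrow> P (a k + L k)" for P A and k0 :: nat
    unfolding frequently_sequentially
  proof
    fix n
    obtain k where "k \<in> A" "k \<ge> max n k0" using A unfolding infinite_nat_iff_unbounded_le by blast
    then show "\<exists>m\<ge>n. P m" using PA[of k] aL_ge[of k] by (intro exI[of _ "a k + L k"]) auto
  qed
  have aL: "real (a k) \<le> \<delta> k * real (L k)" for k using Lf(5)[of "N k" k] by (simp add: a_def L_def)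
  have nonsep: "infinite {k. \<not> sep k}"
  proof -
    have "range (\<lambda>k. 2 * k) \<subseteq> {k. \<not> sep k}" by (auto simp: sep_def)
    moreover have "infinite (range (\<lambda>k::nat. 2 * k))" by (rule range_inj_infinite) (auto simp: inj_def)
    ultimately show ?thesis using finite_subset by blast
  qed
  have same: "y \<xi> k = y \<eta> k" if "\<not> sep k" for \<xi> \<eta> k
    using yab(3)[of k "L k"] that by (simp add: tracked_def y_def)
  show ?thesis
  proof (intro exI[of _ x] conjI allI impI ballI)
    show "x \<xi> \<in> X" "(\<lambda>j. dist (B j (x \<xi>)) (B j z0)) \<longlonglongrightarrow> 0" "x \<xi> \<in> Trans X f" for \<xi>
      by (rule x(1), rule x(6), rule trans)
    show "dist (x \<xi>) z0 \<le> r" for \<xi> using x(4)[of \<xi>] \<epsilon>r by linarith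
    show "dist (B j (x \<xi>)) (B j z0) \<le> r" for \<xi> j using x(5)[of j \<xi>] \<epsilon>r by linarith
    show "\<forall>\<^sub>F n in sequentially. \<exists>u\<in>K. deviation f \<psi> n (x \<xi>) u \<le> c * real n" if "c > 0" for \<xi> c
      using averages1[OF that, of \<xi>] by eventually_elim (use uK in blast)
    show "\<exists>\<^sub>F n in sequentially. deviation f \<psi> n (x \<xi>) p \<le> c * real n"
      if p: "p \<in> K" and c: "c > 0" for \<xi> p c
      unfolding frequently_sequentially
    proof
      fix n
      obtain k0 where k0: "\<And>k. k \<ge> k0 \<Longrightarrow> deviation f \<psi> (N (Suc k)) (x \<xi>) (u k) \<le> c / 2 * real (N (Suc k))"
        using averages2[of "c / 2" \<xi>] c unfolding eventually_sequentially by auto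
      have c2: "c / 2 > 0" using c by simp
      obtain j where j: "j \<ge> max n k0" "dist (w j) p < c / 2"
        using w(4)[OF p c2] unfolding frequently_sequentially by blast
      define k where "k = 2 * j"
      have k: "k \<ge> n" "k \<ge> k0" "u k = w j" using j by (auto simp: k_def u_def)
      let ?n = "N (Suc k)"
      have "deviation f \<psi> ?n (x \<xi>) p =
        norm ((birkhoff_sum f \<psi> ?n (x \<xi>) - real ?n *\<^sub>R u k) + real ?n *\<^sub>R (u k - p))"
        by (simp add: scaleR_diff_right)
      also have "\<dots> \<le> c / 2 * real ?n + real ?n * dist (u k) p"
        using k0[OF k(2)] by (intro norm_triangle_mono) (auto simp: dist_norm)
      also have "real ?n * dist (u k) p \<le> real ?n * (c / 2)"
        using j k by (intro mult_left_mono) auto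
      finally have "deviation f \<psi> ?n (x \<xi>) p \<le> c * real ?n" by simp
      then show "\<exists>m\<ge>n. deviation f \<psi> m (x \<xi>) p \<le> c * real m"
        using Nge[of "Suc k"] k(1) by (intro exI[of _ ?n]) auto
    qed
    show "\<exists>\<^sub>F n in sequentially. close_time f (\<tau> / 2) n (x \<xi>) (x \<eta>) \<le> c * real n" if ne: "\<xi> \<noteq> \<eta>" and c: "c > 0" for \<xi> \<eta> c
    proof -
      obtain k0 where k0: "\<And>k. k \<ge> k0 \<Longrightarrow> \<delta> k < c / 2" using \<delta>ev[of "c / 2"] c unfolding eventually_sequentially by auto
      show ?thesis
      proof (rule freq[OF b[OF ne], of k0])
        fix k assume k: "k \<in> {j \<in> J. b j \<xi> \<noteq> b j \<eta>}" "k \<ge> k0"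
        have "close_time f \<tau> (L k) (ya k (L k)) (yb k (L k)) \<le> \<delta> k * real (L k)"
          using yab(3)[of k "L k"] k Lf(2)[of k "N k"] by (simp add: tracked_def J_def L_def)
        moreover have "close_time f \<tau> (L k) p q = close_time f \<tau> (L k) q p" for p q
          by (simp add: close_time_def dist_commute)
        ultimately have sp: "close_time f \<tau> (L k) (y \<xi> k) (y \<eta> k) \<le> \<delta> k * real (L k)"
          using k by (auto simp: y_def)
        have "close_time f (\<tau> / 2) (a k + L k) (x \<xi>) (x \<eta>) \<le> 2 * \<delta> k * real (a k + L k)"
          by (rule stage_separated[OF x(2) x(2) aL _ _ sp]) (use \<delta>[of k] \<epsilon>e[of k] ele(4)[of k] in auto)
        also have "\<dots> \<le> c * real (a k + L k)" using k0[OF k(2)] by (intro mult_right_mono) auto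
        finally show "close_time f (\<tau> / 2) (a k + L k) (x \<xi>) (x \<eta>) \<le> c * real (a k + L k)" .
      qed
    qed
    have mono_e: "(1 - c) * real n \<le> (1 - \<delta> k) * real n" if "\<delta> k < c" for c k and n :: nat
      using that by (intro mult_right_mono) auto
    show "\<exists>\<^sub>F n in sequentially. close_time f t n (x \<xi>) (x \<eta>) \<ge> (1 - c) * real n" if "t > 0" and c: "c > 0" for \<xi> \<eta> t c
    proof -
      obtain k0 where k0: "\<And>k. k \<ge> k0 \<Longrightarrow> \<delta> k < min c (t / 4)"
        using \<delta>ev[of "min c (t / 4)"] c \<open>t > 0\<close> unfolding eventually_sequentially by auto
      show ?thesis
      proof (rule freq[OF nonsep, of k0])
        fix k assume k: "k \<in> {k. \<not> sep k}" "k \<ge> k0"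
        have "shadows f summed (2 * \<epsilon> k) (x \<eta>) (y \<xi> k) (a k) (L k)" using x(2)[of k \<eta>] same[of k \<xi> \<eta>] k by simp
        then have "(1 - \<delta> k) * real (a k + L k) \<le> close_time f t (a k + L k) (x \<xi>) (x \<eta>)"
          by (rule stage_proximal(1)[OF x(2) _ aL]) (use \<delta>[of k] \<epsilon>e[of k] ele(5)[of k] k0[OF k(2)] in auto)
        then show "close_time f t (a k + L k) (x \<xi>) (x \<eta>) \<ge> (1 - c) * real (a k + L k)"
          using mono_e[of k c "a k + L k"] k0[OF k(2)] by simp
      qed
    qed
    show "\<exists>\<^sub>F n in sequentially.
       real (card {i\<in>{1..n}. (\<Sum>j<i. dist ((f ^^ j) (x \<xi>)) ((f ^^ j) (x \<eta>))) < \<alpha> i * t}) \<ge> (1 - c) * real n"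
      if summed "t > 0" and c: "c > 0" for \<xi> \<eta> t c
    proof -
      obtain k0 where k0: "\<And>k. k \<ge> k0 \<Longrightarrow> \<delta> k < min c t"
        using \<delta>ev[of "min c t"] c \<open>t > 0\<close> unfolding eventually_sequentially by auto
      show ?thesis
      proof (rule freq[OF nonsep, of k0])
        fix k assume k: "k \<in> {k. \<not> sep k}" "k \<ge> k0"
        have sh: "shadows f summed (2 * \<epsilon> k) (x \<eta>) (y \<xi> k) (a k) (L k)" using x(2)[of k \<eta>] same[of k \<xi> \<eta>] k by simp
        have "(1 - \<delta> k) * real (a k + L k) \<le>
          real (card {i\<in>{1..a k + L k}. (\<Sum>j<i. dist ((f ^^ j) (x \<xi>)) ((f ^^ j) (x \<eta>))) < \<alpha> i * t})"
        proof (rule stage_proximal(2)[OF x(2) sh aL _ \<open>summed\<close>, where M = D and start = "i0 (N k) k"])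
          show "real (i0 (N k) k) \<le> \<delta> k * real (L k)" using Lf(6)[of "N k" k] by (simp add: L_def)
          fix i assume i: "i0 (N k) k \<le> i"
          have "\<alpha> i * \<delta> k \<le> \<alpha> i * t" using i0(2)[OF i] k0[OF k(2)] by (intro mult_left_mono) auto
          then show "real (a k) * D + 2 * (2 * \<epsilon> k) < \<alpha> i * t" using i0(1)[OF i] by (simp add: a_def)
        qed (use \<delta>[of k] D orbX in auto)
        then show "real (card {i\<in>{1..a k + L k}. (\<Sum>j<i. dist ((f ^^ j) (x \<xi>)) ((f ^^ j) (x \<eta>))) < \<alpha> i * t}) \<ge> (1 - c) * real (a k + L k)"
          using mono_e[of k c "a k + L k"] k0[OF k(2)] by simp
      qed
    qed
  qed
qed

section \<open>Embedding the probability measures into a normed space\<close>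

text \<open>The function \<open>x \<mapsto> max\<^sub>j (r\<^sub>j - n d(x, s\<^sub>j))\<close> with rational \<open>r\<^sub>j\<close>, cut off at \<open>-n\<close> so that the maximum
is over a nonempty set. There are countably many of them for a given sequence \<open>s\<close>.\<close>

fun sup_convolution :: "(nat \<Rightarrow> 'a::metric_space) \<Rightarrow> nat \<Rightarrow> (rat \<times> nat) list \<Rightarrow> 'a \<Rightarrow> real" where
  "sup_convolution s n [] x = - real n"
| "sup_convolution s n (p # ps) x =
     max (of_rat (fst p) - real n * dist x (s (snd p))) (sup_convolution s n ps x)"

lemma continuous_on_sup_convolution: "continuous_on A (sup_convolution s n ps)"
proof (induction ps)
  case Nil
  then show ?case by (simp add: continuous_on_const)
next
  case (Cons p ps)
  then show ?case by (simp add: fun_eq_iff[symmetric]) (intro continuous_intros; simp)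
qed

lemma sup_convolution_ge: "p \<in> set ps \<Longrightarrow> of_rat (fst p) - real n * dist x (s (snd p)) \<le> sup_convolution s n ps x"
  by (induction ps) auto

lemma sup_convolution_le:
  "(\<And>p. p \<in> set ps \<Longrightarrow> of_rat (fst p) - real n * dist x (s (snd p)) \<le> c) \<Longrightarrow> - real n \<le> c \<Longrightarrow>
     sup_convolution s n ps x \<le> c"
  by (induction ps) auto

text \<open>With \<open>r\<^sub>j\<close> close to \<open>\<phi> s\<^sub>j\<close> and \<open>n\<close> large, the penalty \<open>n d(x, s\<^sub>j)\<close> excludes all indices for which \<open>s\<^sub>j\<close> is
not near \<open>x\<close>, and it is small for some \<open>j\<close> if the finitely many \<open>s\<^sub>j\<close> form a fine net.\<close>

lemma sup_convolution_approx:
  fixes X :: "'a::metric_space set"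
  assumes X: "compact X" and s: "range s \<subseteq> X" "X \<subseteq> closure (range s)"
    and \<phi>: "continuous_on X \<phi>" and e: "e > (0::real)"
  shows "\<exists>n ps. \<forall>x\<in>X. \<bar>\<phi> x - sup_convolution s n ps x\<bar> \<le> 3 * e"
proof -
  obtain M where M: "\<And>x. x \<in> X \<Longrightarrow> \<bar>\<phi> x\<bar> \<le> M"
    using compact_imp_bounded[OF compact_continuous_image[OF \<phi> X]] unfolding bounded_iff by auto
  obtain d where d: "d > 0" "\<And>x y. x \<in> X \<Longrightarrow> y \<in> X \<Longrightarrow> dist x y < d \<Longrightarrow> \<bar>\<phi> x - \<phi> y\<bar> < e"
    using compact_uniformly_continuous[OF \<phi> X] e unfolding uniformly_continuous_on_def dist_real_def
    by (metis abs_minus_commute)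
  obtain n :: nat where n: "max M ((2 * M + e) / d) < real n" using reals_Archimedean2 by blast
  define \<eta> where "\<eta> = min d (e / (real n + 1))"
  have \<eta>: "\<eta> > 0" "\<eta> \<le> d" "real n * \<eta> \<le> e"
  proof -
    show "\<eta> > 0" "\<eta> \<le> d" using d e by (auto simp: \<eta>_def)
    have "real n * \<eta> \<le> real n * (e / (real n + 1))" by (intro mult_left_mono) (auto simp: \<eta>_def)
    also have "\<dots> \<le> e" using e by (simp add: field_simps)
    finally show "real n * \<eta> \<le> e" .
  qed
  have cover: "X \<subseteq> (\<Union>j\<in>UNIV. ball (s j) \<eta>)"
    using s(2) \<eta>(1) unfolding closure_approachable subset_iff by auto
  obtain J where J: "finite J" "X \<subseteq> (\<Union>j\<in>J. ball (s j) \<eta>)"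
    by (rule compactE_image[OF X _ cover]) auto
  have "\<exists>q. \<phi> (s j) - e < of_rat q \<and> of_rat q < \<phi> (s j) + e" for j
    by (rule of_rat_dense) (use e in simp)
  then obtain q where q: "\<And>j. \<phi> (s j) - e < of_rat (q j)" "\<And>j. of_rat (q j) < \<phi> (s j) + e" by metis
  define ps where "ps = map (\<lambda>j. (q j, j)) (sorted_list_of_set J)"
  have ps: "set ps = (\<lambda>j. (q j, j)) ` J" using J by (simp add: ps_def)
  have "\<bar>\<phi> x - sup_convolution s n ps x\<bar> \<le> 3 * e" if x: "x \<in> X" for x
  proof -
    have up: "sup_convolution s n ps x \<le> \<phi> x + 2 * e"
    proof (rule sup_convolution_le)
      show "- real n \<le> \<phi> x + 2 * e" using M[OF x] n e by linarith
      fix p assume "p \<in> set ps"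
      then obtain j where p: "p = (q j, j)" by (auto simp: ps)
      have sj: "s j \<in> X" using s by auto
      show "of_rat (fst p) - real n * dist x (s (snd p)) \<le> \<phi> x + 2 * e"
      proof (cases "dist x (s j) < d")
        case True
        have "real n * dist x (s j) \<ge> 0" by simp
        then show ?thesis using d(2)[OF x sj True] q(2)[of j] unfolding p fst_conv snd_conv by linarith
      next
        case False
        have "2 * M + e < real n * d" using n d by (simp add: field_simps)
        also have "\<dots> \<le> real n * dist x (s j)" using False by (intro mult_left_mono) auto
        finally show ?thesis using M[OF x] M[OF sj] q(2)[of j] e unfolding p fst_conv snd_conv by linarith
      qed
    qed
    obtain j where j: "j \<in> J" "dist x (s j) < \<eta>" using J(2) x by (auto simp: dist_commute)
    have sj: "s j \<in> X" using s by auto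
    have "real n * dist x (s j) \<le> real n * \<eta>" using j by (intro mult_left_mono) auto
    moreover have "\<bar>\<phi> x - \<phi> (s j)\<bar> < e" using d(2)[OF x sj] j \<eta> by simp
    moreover have "of_rat (q j) - real n * dist x (s j) \<le> sup_convolution s n ps x"
      using sup_convolution_ge[of "(q j, j)" ps n x s] j by (simp add: ps)
    ultimately show ?thesis using up q(1)[of j] \<eta>(3) unfolding abs_le_iff by linarith
  qed
  then show ?thesis by blast
qed

text \<open>Multiples of the functions \<open>\<Phi> c\<close> are dense among the continuous functions, so their integrals determine
a measure and its weak* neighbourhoods. The decay in \<open>c\<close> makes the sequence of integrals an element of
a normed space in which closeness concerns finitely many integrals only.\<close>

locale weak_coordinates =
  fixes X :: "'a::metric_space set" and \<Phi> :: "nat \<Rightarrow> 'a \<Rightarrow> real"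
  assumes X: "compact X" "X \<noteq> {}"
    and cont: "\<And>c. continuous_on X (\<Phi> c)" and bound: "\<And>c x. x \<in> X \<Longrightarrow> \<bar>\<Phi> c x\<bar> \<le> (1/2) ^ c"
    and approx: "\<And>\<phi> e. continuous_on X \<phi> \<Longrightarrow> e > 0 \<Longrightarrow> \<exists>c b. \<forall>x\<in>X. \<bar>\<phi> x - b * \<Phi> c x\<bar> \<le> e"

lemma ex_weak_coordinates:
  fixes X :: "'a::metric_space set"
  assumes X: "compact X" "X \<noteq> {}"
  shows "\<exists>\<Phi>. weak_coordinates X \<Phi>"
proof -
  obtain s :: "nat \<Rightarrow> 'a" where s: "range s \<subseteq> X" "X \<subseteq> closure (range s)"
    by (rule compact_countable_dense[OF X])
  define h where "h c = (case from_nat c of (n, ps) \<Rightarrow> sup_convolution s n ps)" for c :: nat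
  have h: "continuous_on X (h c)" for c
    by (auto simp: h_def continuous_on_sup_convolution split: prod.splits)
  have "\<exists>b>0. \<forall>x\<in>X. \<bar>h c x\<bar> \<le> b" for c
    using compact_imp_bounded[OF compact_continuous_image[OF h X(1)], of c] unfolding bounded_pos by auto
  then obtain b where b: "\<And>c. b c > 0" "\<And>c x. x \<in> X \<Longrightarrow> \<bar>h c x\<bar> \<le> b c" by metis
  have "weak_coordinates X (\<lambda>c x. h c x / (b c * 2 ^ c))"
  proof
    show "continuous_on X (\<lambda>x. h c x / (b c * 2 ^ c))" for c
      using b(1)[of c] by (intro continuous_intros h) auto
    show "\<bar>h c x / (b c * 2 ^ c)\<bar> \<le> (1/2) ^ c" if "x \<in> X" for c x
      using b(1)[of c] b(2)[OF that, of c] by (simp add: field_simps)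
    show "\<exists>c d. \<forall>x\<in>X. \<bar>\<phi> x - d * (h c x / (b c * 2 ^ c))\<bar> \<le> e" if \<phi>: "continuous_on X \<phi>" and e: "e > 0" for \<phi> and e :: real
    proof -
      obtain n ps where nps: "\<forall>x\<in>X. \<bar>\<phi> x - sup_convolution s n ps x\<bar> \<le> 3 * (e / 3)"
        using sup_convolution_approx[OF X(1) s \<phi>, of "e / 3"] e by auto
      define c where "c = to_nat (n, ps)"
      have "\<bar>\<phi> x - (b c * 2 ^ c) * (h c x / (b c * 2 ^ c))\<bar> \<le> e" if "x \<in> X" for x
        using nps that b(1)[of c] by (simp add: c_def h_def)
      then show ?thesis by blast
    qed
  qed (use X in auto)
  then show ?thesis by blast
qed

lemma borel_probs_space: "\<nu> \<in> borel_probs X \<Longrightarrow> space \<nu> = X"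
  using sets_eq_imp_space_eq[of \<nu> "restrict_space borel X"] by (simp add: borel_probs_def space_restrict_space)

lemma borel_probs_measurable:
  "\<nu> \<in> borel_probs X \<Longrightarrow> continuous_on X \<phi> \<Longrightarrow> \<phi> \<in> borel_measurable \<nu>"
  using borel_measurable_continuous_on_restrict[of X \<phi>]
  by (simp add: borel_probs_def cong: measurable_cong_sets)

lemma borel_probs_integrable:
  fixes \<phi> :: "'a::metric_space \<Rightarrow> real"
  assumes "compact X" "\<nu> \<in> borel_probs X" "continuous_on X \<phi>"
  shows "integrable \<nu> \<phi>"
proof -
  interpret prob_space \<nu> using assms by (simp add: borel_probs_def)
  obtain M where "\<And>x. x \<in> X \<Longrightarrow> norm (\<phi> x) \<le> M"
    using compact_imp_bounded[OF compact_continuous_image[OF assms(3,1)]] unfolding bounded_iff by auto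
  then show ?thesis
    using borel_probs_measurable[OF assms(2,3)] borel_probs_space[OF assms(2)]
    by (intro integrable_const_bound[of _ M]) auto
qed

lemma borel_probs_integral_diff:
  fixes \<phi> \<phi>' :: "'a::metric_space \<Rightarrow> real"
  assumes "compact X" "\<nu> \<in> borel_probs X" "continuous_on X \<phi>" "continuous_on X \<phi>'"
    and le: "\<And>x. x \<in> X \<Longrightarrow> \<bar>\<phi> x - \<phi>' x\<bar> \<le> e"
  shows "\<bar>(\<integral>x. \<phi> x \<partial>\<nu>) - (\<integral>x. \<phi>' x \<partial>\<nu>)\<bar> \<le> e"
proof -
  interpret prob_space \<nu> using assms by (simp add: borel_probs_def)
  have int: "integrable \<nu> \<phi>" "integrable \<nu> \<phi>'" using assms borel_probs_integrable by blast+
  have "(\<integral>x. \<phi> x \<partial>\<nu>) - (\<integral>x. \<phi>' x \<partial>\<nu>) = (\<integral>x. \<phi> x - \<phi>' x \<partial>\<nu>)" using int by simp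
  also have "\<bar>\<dots>\<bar> \<le> (\<integral>x. \<bar>\<phi> x - \<phi>' x\<bar> \<partial>\<nu>)" by (rule integral_abs_bound)
  also have "\<dots> \<le> (\<integral>x. e \<partial>\<nu>)"
    using int le borel_probs_space[OF assms(2)] by (intro integral_mono) auto
  finally show ?thesis by (simp add: prob_space)
qed

text \<open>The indicator of a closed set is the limit of the continuous functions
  \<open>max 0 (1 - n d(x, C))\<close>, and closed sets generate the Borel sets.\<close>

lemma borel_probs_eqI:
  fixes X :: "'a::metric_space set"
  assumes X: "compact X" and \<nu>: "\<nu> \<in> borel_probs X" "\<nu>' \<in> borel_probs X"
    and eq: "\<And>\<phi> :: 'a \<Rightarrow> real. continuous_on X \<phi> \<Longrightarrow> (\<integral>x. \<phi> x \<partial>\<nu>) = (\<integral>x. \<phi> x \<partial>\<nu>')"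
  shows "\<nu> = \<nu>'"
proof -
  define A where "A = (\<inter>) X ` {C. closed C}"
  have XS: "X \<in> sigma_sets UNIV {C. closed C}" using compact_imp_closed[OF X] by (intro sigma_sets.Basic) simp
  have "sets (restrict_space borel X) = (\<inter>) X ` sigma_sets UNIV {C. closed C}"
    unfolding sets_restrict_space borel_eq_closed by (simp add: sets_measure_of)
  also have "\<dots> = sigma_sets X A"
    unfolding A_def by (rule sigma_sets_Int[OF XS]) simp
  finally have sets: "sets \<nu> = sigma_sets X A" "sets \<nu>' = sigma_sets X A"
    using \<nu> by (auto simp: borel_probs_def)
  have lim: "(\<lambda>n. \<integral>x. max 0 (1 - real n * infdist x C) \<partial>\<rho>) \<longlonglongrightarrow> measure \<rho> C"
    if \<rho>: "\<rho> \<in> borel_probs X" and C: "closed C" "C \<noteq> {}" "C \<subseteq> X" for \<rho> C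
  proof -
    interpret prob_space \<rho> using \<rho> by (simp add: borel_probs_def)
    have Cs: "C \<in> sets \<rho>" using C \<rho> by (auto simp: borel_probs_def sets_restrict_space)
    have "(\<lambda>n. \<integral>x. max 0 (1 - real n * infdist x C) \<partial>\<rho>) \<longlonglongrightarrow> (\<integral>x. indicat_real C x \<partial>\<rho>)"
    proof (rule integral_dominated_convergence[where w = "\<lambda>_. 1"])
      show "(\<lambda>x. max 0 (1 - real n * infdist x C)) \<in> borel_measurable \<rho>" for n
        by (intro borel_probs_measurable[OF \<rho>] continuous_intros)
      show "AE x in \<rho>. (\<lambda>n. max 0 (1 - real n * infdist x C)) \<longlonglongrightarrow> indicat_real C x"
      proof (rule AE_I2)
        fix x
        show "(\<lambda>n. max 0 (1 - real n * infdist x C)) \<longlonglongrightarrow> indicat_real C x"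
        proof (cases "x \<in> C")
          case False
          then have pos: "infdist x C > 0" using C infdist_pos_not_in_closed by blast
          then obtain m :: nat where m: "1 / infdist x C < real m" using reals_Archimedean2 by blast
          have "max 0 (1 - real n * infdist x C) = 0" if "n \<ge> m" for n
          proof -
            have "1 < real m * infdist x C" using m pos by (simp add: field_simps)
            also have "\<dots> \<le> real n * infdist x C" using that pos by (intro mult_right_mono) auto
            finally show ?thesis by simp
          qed
          then have "\<forall>\<^sub>F n in sequentially. max 0 (1 - real n * infdist x C) = 0"
            unfolding eventually_sequentially by blast
          then show ?thesis using False by (simp add: tendsto_eventually)
        qed simp
      qed
      show "AE x in \<rho>. norm (max 0 (1 - real n * infdist x C)) \<le> 1" for n
        by (intro AE_I2) (auto simp: infdist_nonneg)
    qed (use Cs in auto)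
    then show ?thesis using Cs sets.sets_into_space[OF Cs] by (simp add: Int_absorb2)
  qed
  interpret p: prob_space \<nu> using \<nu> by (simp add: borel_probs_def)
  interpret p': prob_space \<nu>' using \<nu> by (simp add: borel_probs_def)
  show ?thesis
  proof (rule measure_eqI_generator_eq[where E = A and \<Omega> = X and A = "\<lambda>_. X"])
    show "Int_stable A"
    proof (rule Int_stableI)
      fix a b assume "a \<in> A" "b \<in> A"
      then obtain C D where "closed C" "closed D" "a = X \<inter> C" "b = X \<inter> D" by (auto simp: A_def)
      then have "a \<inter> b = X \<inter> (C \<inter> D)" "closed (C \<inter> D)" by auto
      then show "a \<inter> b \<in> A" unfolding A_def by blast
    qed
    show "A \<subseteq> Pow X" by (auto simp: A_def)
    show "range (\<lambda>_::nat. X) \<subseteq> A" using compact_imp_closed[OF X] by (auto simp: A_def)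
    show "emeasure \<nu> X \<noteq> \<infinity>" using p.emeasure_finite by simp
    fix C assume "C \<in> A"
    then have C: "closed C" "C \<subseteq> X" using compact_imp_closed[OF X] by (auto simp: A_def)
    show "emeasure \<nu> C = emeasure \<nu>' C"
    proof (cases "C = {}")
      case False
      have "(\<integral>x. max 0 (1 - real n * infdist x C) \<partial>\<nu>) = (\<integral>x. max 0 (1 - real n * infdist x C) \<partial>\<nu>')" for n
        by (rule eq) (intro continuous_intros)
      then have "measure \<nu> C = measure \<nu>' C"
        using LIMSEQ_unique[OF lim[OF \<nu>(1) C(1) False C(2)]] lim[OF \<nu>(2) C(1) False C(2)] by simp
      then show ?thesis by (simp add: p.emeasure_eq_measure p'.emeasure_eq_measure)
    qed simp
  qed (use sets in auto)
qed

lemma empirical_measure_borel_probs: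
  assumes X: "f ` X \<subseteq> X" "x \<in> X" and n: "n > 0"
  shows "empirical_measure X f x n \<in> borel_probs X"
    and "\<phi> \<in> borel_measurable (restrict_space borel X) \<Longrightarrow>
      (\<integral>y. \<phi> y \<partial>empirical_measure X f x n) = (\<Sum>i<n. \<phi> ((f ^^ i) x)) / real n"
proof -
  interpret p: prob_space "uniform_count_measure {..<n}" by (rule prob_space_uniform_count_measure) (use n in auto)
  have meas: "(\<lambda>i. (f ^^ i) x) \<in> measurable (uniform_count_measure {..<n}) (restrict_space borel X)"
    using funpow_in[OF X]
    by (auto simp: measurable_def space_uniform_count_measure sets_uniform_count_measure space_restrict_space)
  show "empirical_measure X f x n \<in> borel_probs X"
    unfolding borel_probs_def empirical_measure_def using p.prob_space_distr[OF meas] by simp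
  show "(\<integral>y. \<phi> y \<partial>empirical_measure X f x n) = (\<Sum>i<n. \<phi> ((f ^^ i) x)) / real n"
    if "\<phi> \<in> borel_measurable (restrict_space borel X)"
    unfolding empirical_measure_def
    by (simp add: integral_distr[OF meas that] integral_uniform_count_measure)
qed

text \<open>Points, like measures, are represented by their values under the functions \<open>\<Phi> c\<close>. The value outside
\<open>X\<close> is chosen so that the sequence is bounded.\<close>

definition coordinate_map :: "'a set \<Rightarrow> (nat \<Rightarrow> 'a \<Rightarrow> real) \<Rightarrow> 'a \<Rightarrow> (nat \<Rightarrow>\<^sub>C real)" where
  "coordinate_map X \<Phi> x = Bcontfun (\<lambda>c. if x \<in> X then \<Phi> c x else 0)"

definition mean_coordinates :: "(nat \<Rightarrow> 'a \<Rightarrow> real) \<Rightarrow> 'a measure \<Rightarrow> (nat \<Rightarrow>\<^sub>C real)" where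
  "mean_coordinates \<Phi> \<nu> = Bcontfun (\<lambda>c. \<integral>x. \<Phi> c x \<partial>\<nu>)"

lemma apply_Bcontfun_nat:
  fixes h :: "nat \<Rightarrow> real"
  assumes "\<And>c. \<bar>h c\<bar> \<le> b"
  shows "apply_bcontfun (Bcontfun h) = h"
proof (rule Bcontfun_inverse)
  show "h \<in> bcontfun" using assms by (auto simp: bcontfun_def bounded_iff intro: continuous_on_discrete)
qed

lemma sum_bcontfun_apply: "apply_bcontfun (\<Sum>i\<in>A. F i) c = (\<Sum>i\<in>A. apply_bcontfun (F i) c)"
  by (induction A rule: infinite_finite_induct) auto

context weak_coordinates
begin

abbreviation "E \<equiv> coordinate_map X \<Phi>"
abbreviation "I \<equiv> mean_coordinates \<Phi>"

lemma half_power_le_1: "(1/2) ^ c \<le> (1::real)" for c :: nat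
  by (rule power_le_one) auto

lemma E_apply:
  assumes "x \<in> X"
  shows "apply_bcontfun (E x) c = \<Phi> c x"
proof -
  have "\<bar>if x \<in> X then \<Phi> c x else 0\<bar> \<le> 1" for c
    using bound[of x c] half_power_le_1[of c] by auto
  then show ?thesis unfolding coordinate_map_def using assms by (subst apply_Bcontfun_nat[where b = 1]) auto
qed

lemma mean_bound: "\<nu> \<in> borel_probs X \<Longrightarrow> \<bar>\<integral>x. \<Phi> c x \<partial>\<nu>\<bar> \<le> (1/2) ^ c"
  using borel_probs_integral_diff[OF X(1) _ cont continuous_on_const, of \<nu> c 0 "(1/2)^c"] bound by simp

lemma I_apply:
  assumes "\<nu> \<in> borel_probs X"
  shows "apply_bcontfun (I \<nu>) c = (\<integral>x. \<Phi> c x \<partial>\<nu>)"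
proof -
  have "\<bar>\<integral>x. \<Phi> c x \<partial>\<nu>\<bar> \<le> 1" for c
    using mean_bound[OF assms, of c] half_power_le_1[of c] by linarith
  then show ?thesis unfolding mean_coordinates_def by (subst apply_Bcontfun_nat[where b = 1]) auto
qed

lemma norm_bcontfun_le:
  fixes p :: "nat \<Rightarrow>\<^sub>C real"
  assumes "\<And>c. \<bar>apply_bcontfun p c\<bar> \<le> b"
  shows "norm p \<le> b"
  using assms by (intro norm_bound) auto

text \<open>Coordinates with large index are uniformly small, so closeness of finitely many coordinates
  suffices.\<close>

lemma tail_small:
  assumes "e > 0"
  obtains C where "\<And>a b c. c \<ge> C \<Longrightarrow> \<bar>a\<bar> \<le> (1/2) ^ c \<Longrightarrow> \<bar>b\<bar> \<le> (1/2) ^ c \<Longrightarrow> \<bar>a - b\<bar> \<le> (e::real)"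
proof -
  obtain C where C: "(1/2) ^ C < e / 2" using real_arch_pow_inv[of "e / 2" "1/2"] assms by auto
  have "\<bar>a - b\<bar> \<le> e" if "c \<ge> C" "\<bar>a\<bar> \<le> (1/2) ^ c" "\<bar>b\<bar> \<le> (1/2) ^ c" for a b :: real and c
  proof -
    have "(1/2) ^ c \<le> (1/2 :: real) ^ C" using that(1) by (intro power_decreasing) auto
    then show ?thesis using that C by linarith
  qed
  then show ?thesis using that by blast
qed

lemma E_cont: "continuous_on X E"
  unfolding continuous_on_iff
proof (intro ballI allI impI)
  fix x e assume x: "x \<in> X" and e: "e > (0::real)"
  obtain C where C: "\<And>a b c. c \<ge> C \<Longrightarrow> \<bar>a\<bar> \<le> (1/2) ^ c \<Longrightarrow> \<bar>b\<bar> \<le> (1/2) ^ c \<Longrightarrow> \<bar>a - b\<bar> \<le> e / 2"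
    using tail_small[of "e / 2"] e by auto
  have "\<exists>d>0. \<forall>x'\<in>X. dist x' x < d \<longrightarrow> dist (\<Phi> c x') (\<Phi> c x) < e / 2" for c
    using cont[of c] x e unfolding continuous_on_iff by (meson half_gt_zero)
  then obtain d where d: "\<And>c. d c > 0" "\<And>c x'. x' \<in> X \<Longrightarrow> dist x' x < d c \<Longrightarrow> \<bar>\<Phi> c x' - \<Phi> c x\<bar> < e / 2"
    unfolding dist_real_def by metis
  define d0 where "d0 = Min (insert 1 (d ` {..<C}))"
  have d0: "d0 > 0" "\<And>c. c < C \<Longrightarrow> d0 \<le> d c" using d(1) by (auto simp: d0_def)
  have "dist (E x') (E x) < e" if x': "x' \<in> X" "dist x' x < d0" for x'
  proof -
    have "\<bar>\<Phi> c x' - \<Phi> c x\<bar> \<le> e / 2" for c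
    proof (cases "c < C")
      case True
      then show ?thesis using d(2)[OF x'(1), of c] d0(2)[OF True] x'(2) by simp
    qed (use C[of c] bound x x' in auto)
    then have "norm (E x' - E x) \<le> e / 2"
      by (intro norm_bcontfun_le) (simp add: E_apply x x')
    then show ?thesis using e by (simp add: dist_norm)
  qed
  then show "\<exists>d>0. \<forall>x'\<in>X. dist x' x < d \<longrightarrow> dist (E x') (E x) < e" using d0 by blast
qed

lemma openin_weak_star_integral:
  fixes \<phi> :: "'a \<Rightarrow> real"
  assumes "continuous_on X \<phi>" "open V"
  shows "openin (weak_star X) {\<mu> \<in> borel_probs X. (\<integral>x. \<phi> x \<partial>\<mu>) \<in> V}"
  unfolding weak_star_def by (rule topology_generated_by_Basis) (use assms in blast)

lemma topspace_weak_star: "topspace (weak_star X) = borel_probs X"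
proof
  show "topspace (weak_star X) \<subseteq> borel_probs X"
    unfolding weak_star_def topology_generated_by_topspace by blast
  have "openin (weak_star X) {\<mu> \<in> borel_probs X. (\<integral>x. 0 \<partial>\<mu>) \<in> (UNIV :: real set)}"
    by (rule openin_weak_star_integral) auto
  then show "borel_probs X \<subseteq> topspace (weak_star X)"
    using openin_subset by fastforce
qed

lemma continuous_map_I: "continuous_map (weak_star X) euclidean I"
  unfolding continuous_map_def topspace_weak_star
proof (intro conjI allI impI)
  fix U :: "(nat \<Rightarrow>\<^sub>C real) set" assume U: "openin euclidean U"
  show "openin (weak_star X) {\<nu> \<in> borel_probs X. I \<nu> \<in> U}"
  proof (subst openin_subopen, intro ballI)
    fix \<nu> assume \<nu>: "\<nu> \<in> {\<nu> \<in> borel_probs X. I \<nu> \<in> U}"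
    then obtain e where e: "e > 0" "ball (I \<nu>) e \<subseteq> U" using U unfolding open_contains_ball open_openin[symmetric] by blast
    obtain C where C: "\<And>a b c. c \<ge> C \<Longrightarrow> \<bar>a\<bar> \<le> (1/2) ^ c \<Longrightarrow> \<bar>b\<bar> \<le> (1/2) ^ c \<Longrightarrow> \<bar>a - b\<bar> \<le> e / 2"
      using tail_small[of "e / 2"] e by auto
    define W where "W c = {\<rho> \<in> borel_probs X. (\<integral>x. \<Phi> c x \<partial>\<rho>) \<in> ball (\<integral>x. \<Phi> c x \<partial>\<nu>) (e / 2)}" for c
    have Wo: "openin (weak_star X) (W c)" for c
      unfolding W_def by (intro openin_weak_star_integral cont open_ball)
    define T where "T = (\<Inter>c\<in>{..C}. W c)"
    have "openin (weak_star X) T" unfolding T_def using Wo by (intro openin_Inter) auto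
    moreover have "\<nu> \<in> T" using \<nu> e by (auto simp: T_def W_def)
    moreover have "T \<subseteq> {\<nu> \<in> borel_probs X. I \<nu> \<in> U}"
    proof
      fix \<rho> assume \<rho>: "\<rho> \<in> T"
      then have \<rho>X: "\<rho> \<in> borel_probs X" by (auto simp: T_def W_def)
      have "\<bar>(\<integral>x. \<Phi> c x \<partial>\<rho>) - (\<integral>x. \<Phi> c x \<partial>\<nu>)\<bar> \<le> e / 2" for c
      proof (cases "c \<le> C")
        case True
        then have "\<rho> \<in> W c" using \<rho> by (auto simp: T_def)
        then show ?thesis by (simp add: W_def dist_real_def abs_minus_commute)
      qed (use C[of c] mean_bound \<nu> \<rho>X in auto)
      then have "norm (I \<rho> - I \<nu>) \<le> e / 2" using \<nu> \<rho>X by (intro norm_bcontfun_le) (simp add: I_apply)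
      then have "I \<rho> \<in> ball (I \<nu>) e" using e by (simp add: dist_norm norm_minus_commute)
      then show "\<rho> \<in> {\<nu> \<in> borel_probs X. I \<nu> \<in> U}" using \<rho>X e by blast
    qed
    ultimately show "\<exists>T. openin (weak_star X) T \<and> \<nu> \<in> T \<and> T \<subseteq> {\<nu> \<in> borel_probs X. I \<nu> \<in> U}" by blast
  qed
qed auto

lemma integral_close:
  assumes \<nu>: "\<nu> \<in> borel_probs X" and \<phi>: "continuous_on X \<phi>" and e: "e > (0::real)"
  obtains d where "d > 0" "\<And>\<rho>. \<rho> \<in> borel_probs X \<Longrightarrow> norm (I \<rho> - I \<nu>) < d \<Longrightarrow> \<bar>(\<integral>x. \<phi> x \<partial>\<rho>) - (\<integral>x. \<phi> x \<partial>\<nu>)\<bar> < e"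
proof -
  obtain c b where cb: "\<forall>x\<in>X. \<bar>\<phi> x - b * \<Phi> c x\<bar> \<le> e / 4" using approx[OF \<phi>, of "e / 4"] e by auto
  define d where "d = e / (4 * (\<bar>b\<bar> + 1))"
  have d: "d > 0" using e by (simp add: d_def)
  have bd: "\<bar>b\<bar> * d \<le> e / 4"
  proof -
    have "\<bar>b\<bar> * d \<le> (\<bar>b\<bar> + 1) * d" using d by (intro mult_right_mono) auto
    also have "\<dots> = e / 4" by (simp add: d_def field_simps)
    finally show ?thesis .
  qed
  have "\<bar>(\<integral>x. \<phi> x \<partial>\<rho>) - (\<integral>x. \<phi> x \<partial>\<nu>)\<bar> < e" if \<rho>: "\<rho> \<in> borel_probs X" "norm (I \<rho> - I \<nu>) < d" for \<rho>
  proof -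
    have cc: "continuous_on X (\<lambda>x. b * \<Phi> c x)" by (intro continuous_intros cont)
    have "\<bar>apply_bcontfun (I \<rho> - I \<nu>) c\<bar> \<le> d"
      using norm_bounded[of "I \<rho> - I \<nu>" c] \<rho>(2) by simp
    then have "\<bar>b\<bar> * \<bar>(\<integral>x. \<Phi> c x \<partial>\<rho>) - (\<integral>x. \<Phi> c x \<partial>\<nu>)\<bar> \<le> \<bar>b\<bar> * d"
      by (intro mult_left_mono) (simp_all add: I_apply \<rho> \<nu>)
    then have "\<bar>(\<integral>x. b * \<Phi> c x \<partial>\<rho>) - (\<integral>x. b * \<Phi> c x \<partial>\<nu>)\<bar> \<le> e / 4"
      using bd by (simp add: abs_mult flip: right_diff_distrib)
    moreover have "\<bar>(\<integral>x. \<phi> x \<partial>\<rho>) - (\<integral>x. b * \<Phi> c x \<partial>\<rho>)\<bar> \<le> e / 4" "\<bar>(\<integral>x. \<phi> x \<partial>\<nu>) - (\<integral>x. b * \<Phi> c x \<partial>\<nu>)\<bar> \<le> e / 4"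
      using cb by (intro borel_probs_integral_diff[OF X(1) _ \<phi> cc] \<rho> \<nu>; simp)+
    ultimately show ?thesis using e by linarith
  qed
  then show ?thesis using that d by blast
qed

text \<open>Together with the continuity of \<open>I\<close> and its injectivity this says that \<open>I\<close> is a homeomorphism from
the probability measures onto a subset of the normed space.\<close>

lemma weak_star_nbhd:
  assumes "openin (weak_star X) W" "\<nu> \<in> W"
  obtains d where "d > 0" "\<And>\<rho>. \<rho> \<in> borel_probs X \<Longrightarrow> norm (I \<rho> - I \<nu>) < d \<Longrightarrow> \<rho> \<in> W"
proof -
  have "generate_topology_on {{\<mu> \<in> borel_probs X. (\<integral>x. \<phi> x \<partial>\<mu>) \<in> V} | (\<phi> :: 'a \<Rightarrow> real) V. continuous_on X \<phi> \<and> open V} W"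
    using assms(1) unfolding weak_star_def by (rule openin_topology_generated_by)
  then have "\<exists>d>0. \<forall>\<rho>\<in>borel_probs X. norm (I \<rho> - I \<nu>) < d \<longrightarrow> \<rho> \<in> W"
    using assms(2)
  proof induction
    case (Int a b)
    then obtain d1 d2 where "d1 > 0" "\<forall>\<rho>\<in>borel_probs X. norm (I \<rho> - I \<nu>) < d1 \<longrightarrow> \<rho> \<in> a"
      "d2 > 0" "\<forall>\<rho>\<in>borel_probs X. norm (I \<rho> - I \<nu>) < d2 \<longrightarrow> \<rho> \<in> b" by blast
    then show ?case by (intro exI[of _ "min d1 d2"]) auto
  next
    case (UN K)
    then obtain k where k: "k \<in> K" "\<nu> \<in> k" by blast
    then show ?case using UN.IH[OF k] by blast
  next
    case (Basis s)
    then obtain \<phi> :: "'a \<Rightarrow> real" and V where s: "s = {\<mu> \<in> borel_probs X. (\<integral>x. \<phi> x \<partial>\<mu>) \<in> V}" "continuous_on X \<phi>" "open V"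
      by blast
    obtain e where e: "e > 0" "ball (\<integral>x. \<phi> x \<partial>\<nu>) e \<subseteq> V" using s Basis(2) unfolding open_contains_ball by blast
    have \<nu>: "\<nu> \<in> borel_probs X" using s Basis by simp
    obtain d where d: "d > 0" "\<And>\<rho>. \<rho> \<in> borel_probs X \<Longrightarrow> norm (I \<rho> - I \<nu>) < d \<Longrightarrow> \<bar>(\<integral>x. \<phi> x \<partial>\<rho>) - (\<integral>x. \<phi> x \<partial>\<nu>)\<bar> < e"
      using integral_close[OF \<nu> s(2) e(1)] by blast
    have "\<rho> \<in> s" if "\<rho> \<in> borel_probs X" "norm (I \<rho> - I \<nu>) < d" for \<rho>
    proof -
      have "(\<integral>x. \<phi> x \<partial>\<rho>) \<in> ball (\<integral>x. \<phi> x \<partial>\<nu>) e" using d(2)[OF that] by (simp add: dist_real_def abs_minus_commute)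
      then show ?thesis using that e s by blast
    qed
    then show ?case using d(1) by blast
  qed auto
  then show ?thesis using that by blast
qed

lemma I_eqD:
  assumes "\<nu> \<in> borel_probs X" "\<rho> \<in> borel_probs X" "I \<nu> = I \<rho>"
  shows "\<nu> = \<rho>"
proof (rule borel_probs_eqI[OF X(1) assms(1,2)])
  fix \<phi> :: "'a \<Rightarrow> real" assume \<phi>: "continuous_on X \<phi>"
  have "\<bar>(\<integral>x. \<phi> x \<partial>\<nu>) - (\<integral>x. \<phi> x \<partial>\<rho>)\<bar> < e" if "e > 0" for e
    using integral_close[OF assms(2) \<phi> that] assms by (metis diff_self norm_zero)
  then show "(\<integral>x. \<phi> x \<partial>\<nu>) = (\<integral>x. \<phi> x \<partial>\<rho>)"
    by (metis diff_eq_eq less_irrefl zero_less_abs_iff add_0)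
qed

text \<open>This identity turns the question which measures the orbit of \<open>x\<close> accumulates at into one about
averages of a continuous map.\<close>

lemma I_empirical:
  assumes "f ` X \<subseteq> X" "x \<in> X" "n > 0"
  shows "I (empirical_measure X f x n) = (1 / real n) *\<^sub>R birkhoff_sum f E n x"
proof (rule bcontfun_eqI)
  fix c
  have "\<Phi> c \<in> borel_measurable (restrict_space borel X)"
    by (rule borel_measurable_continuous_on_restrict[OF cont])
  then show "apply_bcontfun (I (empirical_measure X f x n)) c = apply_bcontfun ((1 / real n) *\<^sub>R birkhoff_sum f E n x) c"
    using empirical_measure_borel_probs[OF assms] funpow_in[OF assms(1,2)]
    by (simp add: I_apply birkhoff_sum_def sum_bcontfun_apply E_apply)
qed

end

section \<open>Weak limits of empirical measures\<close>

text \<open>The first digit in which two expansions with ternary digits \<open>0\<close> and \<open>1\<close> differ outweighs all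
  later ones.\<close>

lemma ternary_digits_determined:
  fixes a b :: "nat \<Rightarrow> bool"
  defines "v \<equiv> \<lambda>a. (\<Sum>j. of_bool (a j) * (1/3) ^ j :: real)"
  assumes close: "\<bar>v a - v b\<bar> < (1/3) ^ n / 2" and m: "m \<le> n"
  shows "a m = b m"
proof (rule ccontr)
  assume ne: "a m \<noteq> b m"
  define k where "k = (LEAST m. a m \<noteq> b m)"
  have k: "a k \<noteq> b k" "\<And>j. j < k \<Longrightarrow> a j = b j" "k \<le> m"
    unfolding k_def by (rule LeastI[of "\<lambda>m. a m \<noteq> b m", OF ne], use not_less_Least in blast, rule Least_le[of "\<lambda>m. a m \<noteq> b m", OF ne])
  have geo: "summable (\<lambda>j. (1/3 :: real) ^ j)" by (rule summable_geometric) simp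
  have sm: "summable (\<lambda>j. of_bool (a j) * (1/3 :: real) ^ j)" for a
    by (rule summable_comparison_test[OF _ geo]) auto
  define D where "D j = (of_bool (a j) - of_bool (b j) :: real) * (1/3) ^ j" for j
  have sD: "summable D" unfolding D_def left_diff_distrib by (intro summable_diff sm)
  have "v a - v b = suminf D"
    unfolding v_def D_def left_diff_distrib by (rule suminf_diff[OF sm sm])
  also have "\<dots> = (\<Sum>j. D (j + Suc k)) + sum D {..<Suc k}" by (rule suminf_split_initial_segment[OF sD])
  also have "sum D {..<Suc k} = D k" using k(2) by (simp add: D_def)
  finally have eq: "D k = (v a - v b) - (\<Sum>j. D (j + Suc k))" by simp
  have "norm (\<Sum>j. D (j + Suc k)) \<le> (\<Sum>j. (1/3) ^ j * (1/3) ^ Suc k)"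
    by (rule norm_suminf_le) (use geo in \<open>auto simp: D_def power_add abs_mult summable_mult2 intro!: mult_left_le_one_le\<close>)
  also have "\<dots> = (1/3) ^ k / 2"
    using suminf_mult2[OF geo, of "(1/3) ^ Suc k"] suminf_geometric[of "1/3::real"] by simp
  finally have tail: "\<bar>\<Sum>j. D (j + Suc k)\<bar> \<le> (1/3) ^ k / 2" by simp
  have "\<bar>D k\<bar> = (1/3) ^ k" using k(1) by (auto simp: D_def)
  moreover have "\<bar>D k\<bar> \<le> \<bar>v a - v b\<bar> + \<bar>\<Sum>j. D (j + Suc k)\<bar>" unfolding eq by (rule abs_triangle_ineq4)
  moreover have "(1/3 :: real) ^ n \<le> (1/3) ^ k" using k(3) m by (intro power_decreasing) auto
  ultimately show False using close tail by linarith
qed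

text \<open>The ternary digits of \<open>c x\<close> record to which of countably many balls the point \<open>x\<close> belongs. Finitely many
of the balls cover \<open>X\<close> with small radius, hence finitely many digits determine \<open>x\<close> up to a small error.\<close>

lemma compact_real_code:
  fixes X :: "'a::metric_space set"
  assumes X: "compact X" "X \<noteq> {}"
  shows "\<exists>c :: 'a \<Rightarrow> real. (\<forall>x. 0 \<le> c x \<and> c x \<le> 2) \<and>
    (\<forall>e>0. \<exists>d>0. \<forall>x\<in>X. \<forall>y\<in>X. \<bar>c x - c y\<bar> < d \<longrightarrow> dist x y < e)"
proof -
  obtain s :: "nat \<Rightarrow> 'a" where s: "range s \<subseteq> X" "X \<subseteq> closure (range s)"
    by (rule compact_countable_dense[OF X])
  define D where "D m x \<longleftrightarrow> (case prod_decode m of (i, k) \<Rightarrow> dist (s i) x < 1 / real (Suc k))" for m x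
  define c where "c x = (\<Sum>j. of_bool (D j x) * (1/3) ^ j :: real)" for x
  have geo: "summable (\<lambda>j. (1/3 :: real) ^ j)" by (rule summable_geometric) simp
  have sm: "summable (\<lambda>j. of_bool (D j x) * (1/3 :: real) ^ j)" for x
    by (rule summable_comparison_test[OF _ geo]) auto
  show ?thesis
  proof (intro exI[of _ c] conjI allI impI)
    show "0 \<le> c x" for x unfolding c_def by (rule suminf_nonneg[OF sm]) simp
    show "c x \<le> 2" for x
    proof -
      have "c x \<le> (\<Sum>j. (1/3) ^ j)" unfolding c_def by (rule suminf_le[OF _ sm geo]) auto
      then show ?thesis using suminf_geometric[of "1/3::real"] by simp
    qed
    fix e :: real assume e: "e > 0"
    then obtain k :: nat where k: "1 / Suc k < e / 2" using nat_approx_posE[of "e / 2"] by auto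
    have cover: "X \<subseteq> (\<Union>i\<in>UNIV. ball (s i) (1 / Suc k))"
      using s(2) unfolding closure_approachable subset_iff by auto
    obtain J where J: "finite J" "X \<subseteq> (\<Union>i\<in>J. ball (s i) (1 / Suc k))"
      by (rule compactE_image[OF X(1) _ cover]) auto
    define n where "n = Max (insert 0 ((\<lambda>i. prod_encode (i, k)) ` J))"
    have n: "prod_encode (i, k) \<le> n" if "i \<in> J" for i using J(1) that by (auto simp: n_def)
    have "dist x y < e" if xy: "x \<in> X" "y \<in> X" "\<bar>c x - c y\<bar> < (1/3) ^ n / 2" for x y
    proof -
      obtain i where i: "i \<in> J" "dist (s i) x < 1 / Suc k" using J(2) xy(1) by auto
      have "D (prod_encode (i, k)) x = D (prod_encode (i, k)) y"
        by (rule ternary_digits_determined[OF _ n[OF i(1)]]) (use xy(3) in \<open>simp add: c_def\<close>)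
      then have "dist (s i) y < 1 / Suc k" using i(2) by (simp add: D_def)
      then show ?thesis using i(2) k dist_triangle3[of x y "s i"] by linarith
    qed
    then show "\<exists>d>0. \<forall>x\<in>X. \<forall>y\<in>X. \<bar>c x - c y\<bar> < d \<longrightarrow> dist x y < e"
      by (intro exI[of _ "(1/3) ^ n / 2"]) auto
  qed
qed

text \<open>A limit of codes determines a point of \<open>X\<close>, since points with nearby codes are close and \<open>X\<close> is compact.\<close>

lemma code_inverse:
  fixes X :: "'a::metric_space set" and c :: "'a \<Rightarrow> real"
  assumes X: "compact X"
    and uc: "\<And>e. e > 0 \<Longrightarrow> \<exists>d>0. \<forall>x\<in>X. \<forall>y\<in>X. \<bar>c x - c y\<bar> < d \<longrightarrow> dist x y < e"
  shows "\<exists>g. continuous_on (closure (c ` X)) g \<and> g ` closure (c ` X) \<subseteq> X \<and> (\<forall>x\<in>X. g (c x) = x)"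
proof -
  have "\<exists>p\<in>X. \<forall>e>0. \<exists>d>0. \<forall>x\<in>X. \<bar>c x - t\<bar> < d \<longrightarrow> dist x p < e" if t: "t \<in> closure (c ` X)" for t
  proof -
    obtain z where z: "\<And>n. z n \<in> c ` X" "z \<longlonglongrightarrow> t" using t unfolding closure_sequential by blast
    have "\<exists>x. x \<in> X \<and> z n = c x" for n using z(1)[of n] by auto
    then obtain x where x: "\<And>n. x n \<in> X" "\<And>n. z n = c (x n)" by metis
    obtain p r where p: "p \<in> X" "strict_mono r" "(x \<circ> r) \<longlonglongrightarrow> p"
      using X x(1) unfolding compact_eq_seq_compact_metric seq_compact_def by metis
    have zr: "(\<lambda>n. c (x (r n))) \<longlonglongrightarrow> t"
      using LIMSEQ_subseq_LIMSEQ[OF z(2) p(2)] x(2) by (simp add: o_def)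
    have "\<exists>d>0. \<forall>x\<in>X. \<bar>c x - t\<bar> < d \<longrightarrow> dist x p < e" if e: "e > 0" for e
    proof -
      obtain d where d: "d > 0" "\<forall>x\<in>X. \<forall>y\<in>X. \<bar>c x - c y\<bar> < d \<longrightarrow> dist x y < e / 2"
        using uc[of "e / 2"] e by auto
      have "\<forall>\<^sub>F n in sequentially. dist (x (r n)) p < e / 2" using tendstoD[OF p(3), of "e / 2"] e by (simp add: o_def)
      moreover have "\<forall>\<^sub>F n in sequentially. dist (c (x (r n))) t < d / 2" using tendstoD[OF zr, of "d / 2"] d by simp
      ultimately have "\<forall>\<^sub>F n in sequentially. dist (x (r n)) p < e / 2 \<and> dist (c (x (r n))) t < d / 2"
        by (rule eventually_conj)
      from eventually_happens'[OF sequentially_bot this]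
      obtain n where n: "dist (x (r n)) p < e / 2" "\<bar>c (x (r n)) - t\<bar> < d / 2"
        by (auto simp: dist_real_def)
      have "dist y p < e" if "y \<in> X" "\<bar>c y - t\<bar> < d / 2" for y
      proof -
        have "\<bar>c y - c (x (r n))\<bar> < d" using n(2) that(2) by linarith
        then have "dist y (x (r n)) < e / 2" using d(2) that(1) x(1) by blast
        then show ?thesis using n(1) dist_triangle[of y p "x (r n)"] by linarith
      qed
      then show ?thesis using d(1) by (intro exI[of _ "d / 2"]) auto
    qed
    then show ?thesis using p(1) by blast
  qed
  then obtain g where g: "\<And>t. t \<in> closure (c ` X) \<Longrightarrow> g t \<in> X"
    "\<And>t e. t \<in> closure (c ` X) \<Longrightarrow> e > 0 \<Longrightarrow> \<exists>d>0. \<forall>x\<in>X. \<bar>c x - t\<bar> < d \<longrightarrow> dist x (g t) < e"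
    by metis
  have gc: "g (c x) = x" if x: "x \<in> X" for x
  proof -
    have "c x \<in> closure (c ` X)" using x closure_subset[of "c ` X"] by auto
    then have "dist x (g (c x)) < e" if "e > 0" for e using g(2)[of "c x" e] that x by fastforce
    then show ?thesis by (metis dist_pos_lt less_irrefl)
  qed
  have "continuous_on (closure (c ` X)) g"
    unfolding continuous_on_iff
  proof (intro ballI allI impI)
    fix t e assume t: "t \<in> closure (c ` X)" and e: "e > (0::real)"
    obtain d where d: "d > 0" "\<forall>x\<in>X. \<bar>c x - t\<bar> < d \<longrightarrow> dist x (g t) < e / 2" using g(2)[OF t, of "e / 2"] e by auto
    have "dist (g t') (g t) < e" if t': "t' \<in> closure (c ` X)" "dist t' t < d / 2" for t'
    proof -
      obtain d' where d': "d' > 0" "\<forall>x\<in>X. \<bar>c x - t'\<bar> < d' \<longrightarrow> dist x (g t') < e / 2" using g(2)[OF t'(1), of "e / 2"] e by auto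
      have "min d' (d / 2) > 0" using d d' by simp
      then obtain x where x: "x \<in> X" "dist (c x) t' < min d' (d / 2)"
        using t'(1) unfolding closure_approachable by blast
      have "\<bar>c x - t\<bar> < d" using x(2) t'(2) unfolding dist_real_def min_less_iff_conj by linarith
      then have "dist x (g t) < e / 2" "dist x (g t') < e / 2" using d(2) d'(2) x by (auto simp: dist_real_def)
      then show ?thesis using dist_triangle3[of "g t'" "g t" x] by linarith
    qed
    then show "\<exists>d>0. \<forall>t'\<in>closure (c ` X). dist t' t < d \<longrightarrow> dist (g t') (g t) < e"
      using d(1) by (intro exI[of _ "d / 2"]) auto
  qed
  then show ?thesis using g(1) gc by (intro exI[of _ g]) auto
qed

text \<open>The orbit is transported to a bounded set of real numbers by the code, where Helly's theorem provides
a weakly convergent subsequence. The limit is carried by the closure of the set of codes, from which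
the inverse of the code takes it back to \<open>X\<close>.\<close>

lemma weak_limit_exists:
  fixes X :: "'a::metric_space set"
  assumes X: "compact X" "f ` X \<subseteq> X" "q \<in> X" and r: "\<And>n. r n > 0"
  shows "\<exists>s \<nu>. strict_mono (s :: nat \<Rightarrow> nat) \<and> \<nu> \<in> borel_probs X \<and>
    (\<forall>\<phi> :: 'a \<Rightarrow> real. continuous_on X \<phi> \<longrightarrow>
      (\<lambda>n. (\<Sum>i<r (s n). \<phi> ((f ^^ i) q)) / real (r (s n))) \<longlonglongrightarrow> (\<integral>x. \<phi> x \<partial>\<nu>))"
proof -
  have ne: "X \<noteq> {}" using X by blast
  obtain c :: "'a \<Rightarrow> real" where c: "\<And>x. 0 \<le> c x" "\<And>x. c x \<le> 2"
    "\<And>e. e > 0 \<Longrightarrow> \<exists>d>0. \<forall>x\<in>X. \<forall>y\<in>X. \<bar>c x - c y\<bar> < d \<longrightarrow> dist x y < e"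
    using compact_real_code[OF X(1) ne] by metis
  define C where "C = closure (c ` X)"
  obtain g where g: "continuous_on C g" "g ` C \<subseteq> X" "\<And>x. x \<in> X \<Longrightarrow> g (c x) = x"
    using code_inverse[OF X(1) c(3)] unfolding C_def by metis
  have C: "closed C" "C \<noteq> {}" "\<And>x. x \<in> X \<Longrightarrow> c x \<in> C"
    using ne closure_subset[of "c ` X"] by (auto simp: C_def)
  have orb: "(f ^^ i) q \<in> X" for i by (rule funpow_in[OF X(2,3)])
  define m where "m n = distr (uniform_count_measure {..<r n}) borel (\<lambda>i. c ((f ^^ i) q))" for n
  have meas: "(\<lambda>i. c ((f ^^ i) q)) \<in> measurable (uniform_count_measure {..<r n}) borel" for n
    by (auto simp: measurable_def space_uniform_count_measure sets_uniform_count_measure)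
  have pm: "prob_space (m n)" for n
    unfolding m_def using r[of n]
    by (intro prob_space.prob_space_distr prob_space_uniform_count_measure meas) auto
  have rd: "real_distribution (m n)" for n
    unfolding real_distribution_def real_distribution_axioms_def using pm[of n] by (simp add: m_def)
  have int_m: "(\<integral>t. h t \<partial>m n) = (\<Sum>i<r n. h (c ((f ^^ i) q))) / real (r n)" if "h \<in> borel_measurable borel" for h :: "real \<Rightarrow> real" and n
    unfolding m_def by (simp add: integral_distr[OF meas that] integral_uniform_count_measure)
  have "tight m"
    unfolding tight_def
  proof (intro conjI allI impI)
    show "real_distribution (m n)" for n by (rule rd)
    fix \<epsilon> :: real assume \<epsilon>: "\<epsilon> > 0"
    have "measure (m n) {-1<..2} = 1" for n
    proof -
      have "c ((f ^^ i) q) \<in> {-1<..2}" for i using c(1,2)[of "(f ^^ i) q"] by auto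
      then have "(\<lambda>i. c ((f ^^ i) q)) -` {-1<..2} \<inter> {..<r n} = {..<r n}" by auto
      then show ?thesis unfolding m_def using r[of n]
        by (subst measure_distr[OF meas]) (auto simp: space_uniform_count_measure measure_uniform_count_measure)
    qed
    then show "\<exists>a b. a < b \<and> (\<forall>n. measure (m n) {a<..b} > 1 - \<epsilon>)" using \<epsilon> by (intro exI[of _ "-1"] exI[of _ 2]) auto
  qed
  then obtain s M where s: "strict_mono s" "real_distribution M" "weak_conv_m (m \<circ> id \<circ> s) M"
    using tight_imp_convergent_subsubsequence[of m id] strict_mono_id by blast
  interpret M: real_distribution M by (rule s(2))
  have conv: "(\<lambda>n. (\<Sum>i<r (s n). h (c ((f ^^ i) q))) / real (r (s n))) \<longlonglongrightarrow> (\<integral>t. h t \<partial>M)"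
    if h: "continuous_on UNIV h" "\<And>t. norm (h t) \<le> b" for h :: "real \<Rightarrow> real" and b
  proof -
    have "(\<lambda>n. \<integral>t. h t \<partial>(m \<circ> id \<circ> s) n) \<longlonglongrightarrow> (\<integral>t. h t \<partial>M)"
      by (rule weak_conv_imp_integral_bdd_continuous_conv[OF _ s(2,3)])
        (use h rd in \<open>auto simp: continuous_on_eq_continuous_at\<close>)
    moreover have "h \<in> borel_measurable borel" using h(1) by (rule borel_measurable_continuous_onI)
    ultimately show ?thesis using int_m by simp
  qed
  \<comment> \<open>The distance to \<open>C\<close> has integral \<open>0\<close> along the sequence, hence also in the limit.\<close>
  have "AE t in M. t \<in> C"
  proof -
    let ?h = "\<lambda>t. min 1 (infdist t C)"
    have hc: "continuous_on UNIV ?h" by (intro continuous_intros)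
    have hb: "norm (?h t) \<le> 1" for t by (auto simp: infdist_nonneg)
    have "(\<lambda>n. (\<Sum>i<r (s n). ?h (c ((f ^^ i) q))) / real (r (s n))) = (\<lambda>_. 0)"
      using C(3)[OF orb] by simp
    with conv[OF hc hb] have "(\<integral>t. ?h t \<partial>M) = 0" by (simp add: LIMSEQ_const_iff)
    moreover have "?h \<in> borel_measurable M" using borel_measurable_continuous_onI[OF hc] by simp
    then have "integrable M ?h" using hb by (intro M.integrable_const_bound[of _ 1]) auto
    ultimately have "AE t in M. ?h t = 0"
      by (subst (asm) integral_nonneg_eq_0_iff_AE) (auto simp: infdist_nonneg)
    then show ?thesis
    proof eventually_elim
      case (elim t)
      then have "infdist t C = 0" by (simp add: min_def split: if_splits)
      then show ?case using C in_closed_iff_infdist_zero by blast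
    qed
  qed
  define g' where "g' t = (if t \<in> C then g t else q)" for t
  have g'm: "g' \<in> measurable M (restrict_space borel X)"
  proof (rule measurable_restrict_space2)
    show "g' \<in> space M \<rightarrow> X" using g(2) X(3) by (auto simp: g'_def image_subset_iff)
    have "g' \<in> borel_measurable borel"
      unfolding g'_def by (rule borel_measurable_continuous_on_if) (use C(1) g(1) in auto)
    then show "g' \<in> borel_measurable M" by simp
  qed
  define \<nu> where "\<nu> = distr M (restrict_space borel X) g'"
  have \<nu>: "\<nu> \<in> borel_probs X"
    unfolding borel_probs_def \<nu>_def using M.prob_space_distr[OF g'm] by simp
  have "(\<lambda>n. (\<Sum>i<r (s n). \<phi> ((f ^^ i) q)) / real (r (s n))) \<longlonglongrightarrow> (\<integral>x. \<phi> x \<partial>\<nu>)"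
    if \<phi>: "continuous_on X \<phi>" for \<phi> :: "'a \<Rightarrow> real"
  proof -
    obtain b where b: "\<And>x. x \<in> X \<Longrightarrow> norm (\<phi> x) \<le> b"
      using compact_imp_bounded[OF compact_continuous_image[OF \<phi> X(1)]] unfolding bounded_iff by auto
    have b0: "0 \<le> b" using b[OF X(3)] norm_ge_zero order_trans by blast
    have "continuous_on C (\<lambda>t. \<phi> (g t))"
      using continuous_on_compose[OF g(1) continuous_on_subset[OF \<phi> g(2)]] by (simp add: o_def)
    then obtain h where h: "continuous_on UNIV h" "\<And>t. t \<in> C \<Longrightarrow> h t = \<phi> (g t)" "\<And>t. t \<in> UNIV \<Longrightarrow> norm (h t) \<le> b"
      by (rule Tietze[of C _ UNIV b]) (use C(1) b b0 g(2) in auto)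
    have "(\<integral>x. \<phi> x \<partial>\<nu>) = (\<integral>t. \<phi> (g' t) \<partial>M)"
      unfolding \<nu>_def by (rule integral_distr[OF g'm borel_measurable_continuous_on_restrict[OF \<phi>]])
    also have "\<dots> = (\<integral>t. h t \<partial>M)"
    proof (rule integral_cong_AE)
      show "(\<lambda>t. \<phi> (g' t)) \<in> borel_measurable M"
        using measurable_compose[OF g'm borel_measurable_continuous_on_restrict[OF \<phi>]] .
      show "h \<in> borel_measurable M" using borel_measurable_continuous_onI[OF h(1)] by simp
      show "AE t in M. \<phi> (g' t) = h t" using \<open>AE t in M. t \<in> C\<close> by eventually_elim (simp add: g'_def h(2))
    qed
    finally have "(\<integral>x. \<phi> x \<partial>\<nu>) = (\<integral>t. h t \<partial>M)" .
    moreover have "h (c ((f ^^ i) q)) = \<phi> ((f ^^ i) q)" for i using h(2)[OF C(3)[OF orb]] g(3)[OF orb] by simp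
    ultimately show ?thesis using conv[OF h(1) h(3)[OF UNIV_I]] by simp
  qed
  then show ?thesis using s(1) \<nu> by blast
qed

text \<open>By compactness a sequence of empirical measures with a single accumulation point converges.\<close>

lemma (in weak_coordinates) unique_accumulation_converges:
  assumes f: "f ` X \<subseteq> X" and q: "q \<in> G_set X f {\<mu>}" and e: "e > 0"
  shows "\<forall>\<^sub>F n in sequentially. deviation f E n q (I \<mu>) \<le> e * real n"
proof (rule ccontr)
  have qX: "q \<in> X" and V: "V_set X f q = {\<mu>}" using q by (auto simp: G_set_def)
  assume "\<not> ?thesis"
  then have "\<exists>\<^sub>F n in sequentially. \<not> deviation f E n q (I \<mu>) \<le> e * real n"
    by (simp add: not_eventually)
  then have "infinite {n. \<not> deviation f E n q (I \<mu>) \<le> e * real n}"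
    by (simp add: frequently_cofinite flip: cofinite_eq_sequentially)
  from infinite_enumerate[OF this] obtain r :: "nat \<Rightarrow> nat"
    where r: "strict_mono r" "\<And>n. \<not> deviation f E (r n) q (I \<mu>) \<le> e * real (r n)"
    by auto
  have rpos: "r n > 0" for n using r(2)[of n] by (cases "r n") (auto simp: birkhoff_sum_def)
  obtain s \<nu> where s': "strict_mono s \<and> \<nu> \<in> borel_probs X \<and>
    (\<forall>\<phi> :: 'a \<Rightarrow> real. continuous_on X \<phi> \<longrightarrow>
      (\<lambda>n. (\<Sum>i<r (s n). \<phi> ((f ^^ i) q)) / real (r (s n))) \<longlonglongrightarrow> (\<integral>x. \<phi> x \<partial>\<nu>))"
    using weak_limit_exists[OF X(1) f qX, of r, OF rpos] by (elim exE)
  have s: "strict_mono s" "\<nu> \<in> borel_probs X"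
    "\<And>\<phi> :: 'a \<Rightarrow> real. continuous_on X \<phi> \<Longrightarrow>
      (\<lambda>n. (\<Sum>i<r (s n). \<phi> ((f ^^ i) q)) / real (r (s n))) \<longlonglongrightarrow> (\<integral>x. \<phi> x \<partial>\<nu>)"
    using s' by simp_all
  let ?em = "empirical_measure X f q"
  have em: "?em (r (s n)) \<in> borel_probs X" for n by (rule empirical_measure_borel_probs[OF f qX rpos])
  have conv: "\<forall>\<^sub>F n in sequentially. norm (I (?em (r (s n))) - I \<nu>) < d" if d: "d > 0" for d
  proof -
    obtain C where C: "\<And>a b c. c \<ge> C \<Longrightarrow> \<bar>a\<bar> \<le> (1/2) ^ c \<Longrightarrow> \<bar>b\<bar> \<le> (1/2) ^ c \<Longrightarrow> \<bar>a - b\<bar> \<le> d / 2"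
      using tail_small[of "d / 2"] d by auto
    have "\<forall>\<^sub>F n in sequentially. dist ((\<Sum>i<r (s n). \<Phi> c ((f ^^ i) q)) / real (r (s n))) (\<integral>x. \<Phi> c x \<partial>\<nu>) < d / 2" for c
      using tendstoD[OF s(3)[OF cont], of "d / 2" c] d by simp
    then have "\<forall>\<^sub>F n in sequentially. \<forall>c\<in>{..<C}. dist ((\<Sum>i<r (s n). \<Phi> c ((f ^^ i) q)) / real (r (s n))) (\<integral>x. \<Phi> c x \<partial>\<nu>) < d / 2"
      by (intro eventually_ball_finite) auto
    then show ?thesis
    proof eventually_elim
      case (elim n)
      have cm: "(\<integral>x. \<Phi> c x \<partial>?em (r (s n))) = (\<Sum>i<r (s n). \<Phi> c ((f ^^ i) q)) / real (r (s n))" for c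
        by (rule empirical_measure_borel_probs(2)[OF f qX rpos borel_measurable_continuous_on_restrict[OF cont]])
      have "\<bar>(\<integral>x. \<Phi> c x \<partial>?em (r (s n))) - (\<integral>x. \<Phi> c x \<partial>\<nu>)\<bar> \<le> d / 2" for c
      proof (cases "c < C")
        case True
        then show ?thesis using elim cm[of c] by (simp add: dist_real_def less_imp_le)
      qed (use C[of c] mean_bound em s(2) in auto)
      then have "norm (I (?em (r (s n))) - I \<nu>) \<le> d / 2"
        by (intro norm_bcontfun_le) (simp add: I_apply em s(2))
      then show ?case using d by simp
    qed
  qed
  have "\<nu> \<in> V_set X f q"
    unfolding V_set_def
  proof (intro CollectI conjI allI impI s(2))
    fix W assume W: "openin (weak_star X) W \<and> \<nu> \<in> W"
    obtain d where d: "d > 0" "\<And>\<rho>. \<rho> \<in> borel_probs X \<Longrightarrow> norm (I \<rho> - I \<nu>) < d \<Longrightarrow> \<rho> \<in> W"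
      using weak_star_nbhd[OF conjunct1[OF W] conjunct2[OF W]] by blast
    obtain n0 where n0: "\<And>n. n \<ge> n0 \<Longrightarrow> norm (I (?em (r (s n))) - I \<nu>) < d"
      using conv[OF d(1)] unfolding eventually_sequentially by blast
    show "\<exists>\<^sub>F n in sequentially. ?em n \<in> W"
      unfolding frequently_sequentially
    proof
      fix n
      have "n \<le> r (s (max n n0))"
        using seq_suble[OF strict_mono_o[OF r(1) s(1)], of "max n n0"] by simp
      then show "\<exists>m\<ge>n. ?em m \<in> W" using d(2)[OF em n0[of "max n n0"]] by (intro exI[of _ "r (s (max n n0))"]) auto
    qed
  qed
  then have "\<nu> = \<mu>" using V by simp
  with eventually_happens'[OF sequentially_bot conv[OF e]]
  obtain n where n: "norm (I (?em (r (s n))) - I \<mu>) < e" by auto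
  let ?n = "r (s n)"
  have "birkhoff_sum f E ?n q - real ?n *\<^sub>R I \<mu> = real ?n *\<^sub>R (I (?em ?n) - I \<mu>)"
    using rpos[of "s n"] by (simp add: I_empirical[OF f qX] scaleR_diff_right)
  then have "deviation f E ?n q (I \<mu>) = real ?n * norm (I (?em ?n) - I \<mu>)" by simp
  also have "\<dots> \<le> real ?n * e" using n by (intro mult_left_mono) auto
  finally show False using r(2)[of "s n"] by (simp add: mult.commute)
qed

section \<open>Approximating invariant measures by orbit segments\<close>

lemma ball_partition:
  fixes Y :: "'a::metric_space set" and F :: "'a \<Rightarrow> 'b::metric_space"
  assumes Y: "compact Y" and F: "continuous_on Y F" and \<delta>: "\<delta> > 0"
  obtains s :: nat and c P where "\<And>i. i < s \<Longrightarrow> c i \<in> Y" "\<And>i. i < s \<Longrightarrow> P i \<in> sets borel"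
    "\<And>i. i < s \<Longrightarrow> P i \<subseteq> Y" "\<And>i x. i < s \<Longrightarrow> x \<in> P i \<Longrightarrow> dist (F x) (F (c i)) < \<delta>"
    "disjoint_family_on P {..<s}" "(\<Union>i<s. P i) = Y"
proof -
  obtain \<eta> where \<eta>: "\<eta> > 0" "\<And>x y. x \<in> Y \<Longrightarrow> y \<in> Y \<Longrightarrow> dist x y < \<eta> \<Longrightarrow> dist (F x) (F y) < \<delta>"
    using compact_uniformly_continuous[OF F Y] \<delta> unfolding uniformly_continuous_on_def by metis
  obtain A where A: "finite A" "A \<subseteq> Y" "Y \<subseteq> (\<Union>x\<in>A. ball x \<eta>)"
    using seq_compact_imp_totally_bounded[of Y] Y \<eta>(1) unfolding compact_eq_seq_compact_metric by blast
  obtain cs where cs: "set cs = A" using A(1) finite_list by blast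
  define s where "s = length cs"
  define Q where "Q i = Y \<inter> ball (cs ! i) \<eta>" for i
  define P where "P = disjointed Q"
  have Qs: "Q i \<in> sets borel" for i unfolding Q_def using compact_imp_closed[OF Y] by auto
  have Ps: "P i \<in> sets borel" for i unfolding P_def disjointed_def using Qs by auto
  have sub: "P i \<subseteq> Q i" for i by (simp add: P_def disjointed_subset)
  have cY: "cs ! i \<in> Y" if "i < s" for i using that cs A(2) by (auto simp: s_def)
  show ?thesis
  proof (rule that[of s "\<lambda>i. cs ! i" P])
    show "cs ! i \<in> Y" "P i \<in> sets borel" "P i \<subseteq> Y" if "i < s" for i
      using cY[OF that] Ps sub[of i] by (auto simp: Q_def)
    show "dist (F x) (F (cs ! i)) < \<delta>" if "i < s" "x \<in> P i" for i x
      using that sub[of i] cY by (intro \<eta>(2)) (auto simp: Q_def dist_commute)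
    show "disjoint_family_on P {..<s}"
      using disjoint_family_disjointed[of Q] unfolding P_def disjoint_family_on_def by blast
    have "(\<Union>i<s. P i) = (\<Union>i<s. Q i)"
      using finite_UN_disjointed_eq[of Q s] by (simp add: P_def atLeast0LessThan)
    also have "\<dots> = Y" using A(3) cs by (force simp: Q_def s_def set_conv_nth)
    finally show "(\<Union>i<s. P i) = Y" .
  qed
qed

lemma step_integral:
  fixes \<phi> :: "'a::metric_space \<Rightarrow> real" and s :: nat
  assumes X: "compact X" "\<nu> \<in> borel_probs X" "continuous_on X \<phi>" and b: "\<And>x. x \<in> X \<Longrightarrow> \<bar>\<phi> x\<bar> \<le> 1"
    and Y: "Y \<subseteq> X" and P: "\<And>i. i < s \<Longrightarrow> P i \<in> sets borel" "disjoint_family_on P {..<s}" "(\<Union>i<s. P i) = Y"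
    and c: "\<And>i x. i < s \<Longrightarrow> x \<in> P i \<Longrightarrow> \<bar>\<phi> x - \<phi> (c i)\<bar> \<le> \<delta>" and \<delta>: "\<delta> \<ge> 0"
  shows "\<bar>(\<integral>x. \<phi> x \<partial>\<nu>) - (\<Sum>i<s. measure \<nu> (P i) * \<phi> (c i))\<bar> \<le> \<delta> + (1 - measure \<nu> Y)"
    and "(\<Sum>i<s. measure \<nu> (P i)) = measure \<nu> Y"
proof -
  interpret prob_space \<nu> using X by (simp add: borel_probs_def)
  have sp: "space \<nu> = X" using borel_probs_space[OF X(2)] .
  have Ps: "P i \<in> sets \<nu>" if "i < s" for i
  proof -
    have "P i = X \<inter> P i" using Y P(3) that by blast
    then have "P i \<in> sets (restrict_space borel X)" unfolding sets_restrict_space using P(1)[OF that] by blast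
    then show ?thesis using X(2) by (simp add: borel_probs_def)
  qed
  have Ys: "Y \<in> sets \<nu>" unfolding P(3)[symmetric] by (intro sets.finite_UN) (auto simp: Ps)
  show "(\<Sum>i<s. measure \<nu> (P i)) = measure \<nu> Y"
    unfolding P(3)[symmetric] using P(2) Ps by (intro finite_measure_finite_Union[symmetric]) auto
  define g where "g x = (\<Sum>i<s. indicator (P i) x * \<phi> (c i))" for x
  have gi: "integrable \<nu> g" unfolding g_def using Ps
    by (intro Bochner_Integration.integrable_sum integrable_mult_left) (auto simp: emeasure_eq_measure)
  have PX: "P i \<inter> X = P i" if "i < s" for i using P(3) Y that by blast
  have int_g: "(\<integral>x. g x \<partial>\<nu>) = (\<Sum>i<s. measure \<nu> (P i) * \<phi> (c i))"
    unfolding g_def using Ps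
    by (subst Bochner_Integration.integral_sum) (auto simp: emeasure_eq_measure sp PX intro!: sum.cong)
  have \<phi>i: "integrable \<nu> \<phi>" by (rule borel_probs_integrable[OF X])
  have pt: "\<bar>\<phi> x - g x\<bar> \<le> \<delta> + indicator (X - Y) x" if x: "x \<in> X" for x
  proof (cases "x \<in> Y")
    case True
    then obtain i where i: "i < s" "x \<in> P i" using P(3) by auto
    have "x \<notin> P j" if "j < s" "j \<noteq> i" for j
      using disjoint_family_onD[OF P(2), of j i] i that by auto
    then have "g x = (\<Sum>j<s. if j = i then \<phi> (c i) else 0)"
      unfolding g_def using i by (intro sum.cong) auto
    then have "g x = \<phi> (c i)" using i by simp
    then show ?thesis using c[OF i] True by simp
  next
    case False
    then have "x \<notin> P i" if "i < s" for i using P(3) that by blast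
    then have "g x = 0" unfolding g_def by (intro sum.neutral) auto
    then show ?thesis using b[OF x] False x \<delta> by simp
  qed
  have XY: "X - Y \<in> sets \<nu>" using Ys sets.compl_sets[OF Ys] sp by simp
  have "(\<integral>x. \<phi> x \<partial>\<nu>) - (\<integral>x. g x \<partial>\<nu>) = (\<integral>x. \<phi> x - g x \<partial>\<nu>)" using \<phi>i gi by simp
  also have "\<bar>\<dots>\<bar> \<le> (\<integral>x. \<bar>\<phi> x - g x\<bar> \<partial>\<nu>)" by (rule integral_abs_bound)
  also have "\<dots> \<le> (\<integral>x. \<delta> + indicator (X - Y) x \<partial>\<nu>)"
    using pt \<phi>i gi XY sp by (intro integral_mono) (auto simp: emeasure_eq_measure)
  also have "\<dots> = \<delta> + measure \<nu> (X - Y)"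
    using XY sp sets.sets_into_space[OF XY]
    by (subst Bochner_Integration.integral_add) (auto simp: emeasure_eq_measure prob_space Int_absorb2)
  also have "measure \<nu> (X - Y) = 1 - measure \<nu> Y" using prob_compl[OF Ys] sp by simp
  finally show "\<bar>(\<integral>x. \<phi> x \<partial>\<nu>) - (\<Sum>i<s. measure \<nu> (P i) * \<phi> (c i))\<bar> \<le> \<delta> + (1 - measure \<nu> Y)"
    using int_g by simp
qed

text \<open>Integrals are limits of sums over fine partitions, and these sums are linear in the measure.\<close>

lemma mixture_integral:
  fixes \<phi> :: "'a::metric_space \<Rightarrow> real"
  assumes X: "compact X" "\<mu> \<in> borel_probs X" "\<mu>1 \<in> borel_probs X" "\<mu>2 \<in> borel_probs X"
    and \<theta>: "0 \<le> \<theta>" "\<theta> \<le> 1"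
    and mix: "\<And>A. A \<in> sets \<mu> \<Longrightarrow> measure \<mu> A = \<theta> * measure \<mu>1 A + (1 - \<theta>) * measure \<mu>2 A"
    and \<phi>: "continuous_on X \<phi>" and b: "\<And>x. x \<in> X \<Longrightarrow> \<bar>\<phi> x\<bar> \<le> 1"
  shows "(\<integral>x. \<phi> x \<partial>\<mu>) = \<theta> * (\<integral>x. \<phi> x \<partial>\<mu>1) + (1 - \<theta>) * (\<integral>x. \<phi> x \<partial>\<mu>2)"
proof -
  have "\<bar>(\<integral>x. \<phi> x \<partial>\<mu>) - (\<theta> * (\<integral>x. \<phi> x \<partial>\<mu>1) + (1 - \<theta>) * (\<integral>x. \<phi> x \<partial>\<mu>2))\<bar> \<le> 0 + e" if e: "e > 0" for e
  proof -
    have e2: "e / 2 > 0" using e by simp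
    obtain s :: nat and c P where P: "\<And>i. i < s \<Longrightarrow> c i \<in> X" "\<And>i. i < s \<Longrightarrow> P i \<in> sets borel"
      "\<And>i. i < s \<Longrightarrow> P i \<subseteq> X" "\<And>i x. i < s \<Longrightarrow> x \<in> P i \<Longrightarrow> dist (\<phi> x) (\<phi> (c i)) < e / 2"
      "disjoint_family_on P {..<s}" "(\<Union>i<s. P i) = X"
      using ball_partition[OF X(1) \<phi> e2] by metis
    define S where "S \<rho> = (\<Sum>i<s. measure \<rho> (P i) * \<phi> (c i))" for \<rho>
    have near: "\<bar>(\<integral>x. \<phi> x \<partial>\<rho>) - S \<rho>\<bar> \<le> e / 2" if \<rho>: "\<rho> \<in> borel_probs X" for \<rho>
    proof -
      interpret prob_space \<rho> using \<rho> by (simp add: borel_probs_def)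
      have "\<bar>(\<integral>x. \<phi> x \<partial>\<rho>) - S \<rho>\<bar> \<le> e / 2 + (1 - measure \<rho> X)"
        unfolding S_def
        by (rule step_integral(1)[OF X(1) \<rho> \<phi> b order_refl P(2,5,6)])
          (use P(4) e in \<open>auto simp: dist_real_def intro: less_imp_le\<close>)
      then show ?thesis using prob_space borel_probs_space[OF \<rho>] by simp
    qed
    have Ps: "P i \<in> sets \<mu>" if "i < s" for i
    proof -
      have "P i = X \<inter> P i" using P(3)[OF that] by blast
      then have "P i \<in> sets (restrict_space borel X)" unfolding sets_restrict_space using P(2)[OF that] by blast
      then show ?thesis using X(2) by (simp add: borel_probs_def)
    qed
    have "S \<mu> = \<theta> * S \<mu>1 + (1 - \<theta>) * S \<mu>2"
      unfolding S_def sum_distrib_left sum.distrib[symmetric]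
      by (intro sum.cong) (simp_all add: mix Ps algebra_simps)
    then have "(\<integral>x. \<phi> x \<partial>\<mu>) - (\<theta> * (\<integral>x. \<phi> x \<partial>\<mu>1) + (1 - \<theta>) * (\<integral>x. \<phi> x \<partial>\<mu>2)) =
      ((\<integral>x. \<phi> x \<partial>\<mu>) - S \<mu>) - (\<theta> * ((\<integral>x. \<phi> x \<partial>\<mu>1) - S \<mu>1) + (1 - \<theta>) * ((\<integral>x. \<phi> x \<partial>\<mu>2) - S \<mu>2))"
      by (simp add: algebra_simps)
    also have "\<bar>\<dots>\<bar> \<le> \<bar>(\<integral>x. \<phi> x \<partial>\<mu>) - S \<mu>\<bar> + (\<theta> * \<bar>(\<integral>x. \<phi> x \<partial>\<mu>1) - S \<mu>1\<bar> + (1 - \<theta>) * \<bar>(\<integral>x. \<phi> x \<partial>\<mu>2) - S \<mu>2\<bar>)"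
      using \<theta> by (intro order_trans[OF abs_triangle_ineq4] add_left_mono order_trans[OF abs_triangle_ineq]) (simp add: abs_mult)
    also have "\<dots> \<le> e / 2 + (\<theta> * (e / 2) + (1 - \<theta>) * (e / 2))"
      using near X \<theta> by (intro add_mono mult_left_mono) auto
    also have "\<dots> = e" by (simp add: field_simps)
    finally show ?thesis by simp
  qed
  then have "\<bar>(\<integral>x. \<phi> x \<partial>\<mu>) - (\<theta> * (\<integral>x. \<phi> x \<partial>\<mu>1) + (1 - \<theta>) * (\<integral>x. \<phi> x \<partial>\<mu>2))\<bar> \<le> 0"
    by (rule field_le_epsilon)
  then show ?thesis by simp
qed

lemma sum_list_replicate_scaleR:
  fixes h :: "'a \<Rightarrow> 'e::real_vector"
  shows "(\<Sum>x\<leftarrow>replicate n a. h x) = real n *\<^sub>R h a"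
  by (induction n) (auto simp: algebra_simps)

lemma sum_list_concat_replicate:
  fixes h :: "'a \<Rightarrow> 'e::real_vector"
  shows "(\<Sum>x\<leftarrow>concat (map (\<lambda>i. replicate (k i) (c i)) [0..<s]). h x) = (\<Sum>i<s. real (k i) *\<^sub>R h (c i))"
  by (induction s) (simp_all add: sum_list_replicate_scaleR del: map_replicate)

text \<open>Rounding: a convex combination is nearly a plain average in which every point is repeated
  according to its weight.\<close>

lemma convex_combination_as_average:
  fixes F :: "'a \<Rightarrow> 'e::real_normed_vector"
  assumes w: "\<And>i. i < s \<Longrightarrow> w i \<ge> 0" "(\<Sum>i<s. w i) \<le> 1" and s: "s > (0::nat)" and \<delta>: "\<delta> > 0"
    and F: "\<And>i. i < s \<Longrightarrow> norm (F (c i)) \<le> 1"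
  obtains xs where "xs \<noteq> []" "set xs \<subseteq> c ` {..<s}"
    "norm ((\<Sum>x\<leftarrow>xs. F x) - real (length xs) *\<^sub>R (\<Sum>i<s. w i *\<^sub>R F (c i))) \<le> (\<delta> + (1 - (\<Sum>i<s. w i))) * real (length xs)"
proof -
  obtain r :: nat where r: "2 * real s / \<delta> < real r" using reals_Archimedean2 by blast
  have rs: "2 * real s \<le> \<delta> * real r" using r \<delta> by (simp add: field_simps)
  have r0: "r > 0" using r s \<delta> by (metis divide_nonneg_pos mult_nonneg_nonneg not_gr_zero not_less of_nat_0 of_nat_0_le_iff zero_le_numeral)
  define k where "k i = nat \<lfloor>real r * w i\<rfloor>" for i
  have k: "real (k i) \<le> real r * w i" "real r * w i - 1 \<le> real (k i)" if "i < s" for i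
  proof -
    have "\<lfloor>real r * w i\<rfloor> \<ge> 0" using w(1)[OF that] by simp
    then have "real (k i) = real_of_int \<lfloor>real r * w i\<rfloor>" by (simp add: k_def)
    then show "real (k i) \<le> real r * w i" "real r * w i - 1 \<le> real (k i)" by linarith+
  qed
  define W where "W = (\<Sum>i<s. w i)"
  have "real (\<Sum>i<s. k i) \<le> (\<Sum>i<s. real r * w i)" unfolding of_nat_sum using k(1) by (intro sum_mono) auto
  also have "\<dots> = real r * W" by (simp add: W_def sum_distrib_left)
  also have "\<dots> \<le> real r" using w(2) mult_left_mono[of W 1 "real r"] by (simp add: W_def)
  finally have kr: "(\<Sum>i<s. k i) \<le> r" by (simp only: of_nat_le_iff)
  define m where "m = r - (\<Sum>i<s. k i)"
  have "real r * W - real s = (\<Sum>i<s. real r * w i - 1)" by (simp add: W_def sum_distrib_left sum_subtractf)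
  also have "\<dots> \<le> real (\<Sum>i<s. k i)" unfolding of_nat_sum using k(2) by (intro sum_mono) auto
  finally have m: "real m \<le> real r * (1 - W) + real s" using kr by (simp add: m_def of_nat_diff algebra_simps)
  \<comment> \<open>Rounding down leaves \<open>m\<close> of the \<open>r\<close> places free; they are filled with copies of \<open>c 0\<close>.\<close>
  define xs where "xs = concat (map (\<lambda>i. replicate (k i) (c i)) [0..<s]) @ replicate m (c 0)"
  have len: "length xs = r"
  proof -
    have "length (concat (map (\<lambda>i. replicate (k i) (c i)) [0..<s])) = (\<Sum>i<s. k i)"
      by (induction s) auto
    then show ?thesis using kr by (simp add: xs_def m_def)
  qed
  have sub: "set xs \<subseteq> c ` {..<s}" using s by (auto simp: xs_def)
  have "(\<Sum>x\<leftarrow>xs. F x) - real r *\<^sub>R (\<Sum>i<s. w i *\<^sub>R F (c i)) =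
    (\<Sum>i<s. (real (k i) - real r * w i) *\<^sub>R F (c i)) + real m *\<^sub>R F (c 0)"
    unfolding xs_def by (simp add: sum_list_concat_replicate sum_list_replicate_scaleR scaleR_sum_right sum_subtractf scaleR_left_diff_distrib del: map_replicate)
  also have "norm \<dots> \<le> real s * 1 + real m * 1"
  proof (intro norm_triangle_mono norm_sum_bound)
    fix i assume i: "i < s"
    have "norm ((real (k i) - real r * w i) *\<^sub>R F (c i)) \<le> 1 * 1"
      unfolding norm_scaleR using k[OF i] F[OF i] by (intro mult_mono) auto
    then show "norm ((real (k i) - real r * w i) *\<^sub>R F (c i)) \<le> 1" by simp
  next
    show "norm (real m *\<^sub>R F (c 0)) \<le> real m * 1"
      unfolding norm_scaleR using F[OF s] by (intro mult_mono) auto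
  qed
  also have "\<dots> \<le> (\<delta> + (1 - W)) * real r" using m rs by (simp add: algebra_simps)
  finally show ?thesis using that[of xs] len r0 sub by (auto simp: W_def)
qed

context weak_coordinates
begin

lemma norm_E: "x \<in> X \<Longrightarrow> norm (E x) \<le> 1"
  by (intro norm_bcontfun_le) (simp add: E_apply order_trans[OF bound half_power_le_1])

lemma norm_I: "\<nu> \<in> borel_probs X \<Longrightarrow> norm (I \<nu>) \<le> 1"
  by (intro norm_bcontfun_le) (simp add: I_apply order_trans[OF mean_bound half_power_le_1])

text \<open>Integrals against an invariant measure do not change when a function is replaced by its
  Birkhoff averages of some length \<open>m\<close>. Approximating the latter integral by a finite sum shows that
  the measure is approximated by finitely many orbit segments of equal length. Mass outside \<open>Y\<close> is
  small, so that the segments may be taken in \<open>Y\<close>.\<close>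

lemma invariant_block_approximable:
  assumes f: "continuous_on X f" "f ` X \<subseteq> X" and \<nu>: "\<nu> \<in> inv_measures X f"
    and Y: "compact Y" "Y \<subseteq> X" and mY: "measure \<nu> Y > 1 - \<delta>" and \<delta>: "0 < \<delta>" "\<delta> < 1"
    and u: "norm (I \<nu> - u) \<le> \<delta>"
  shows "block_approximable f E Y u False \<tau> (6 * \<delta>)"
  unfolding block_approximable_def
proof
  fix n0
  define m where "m = Suc n0"
  define F where "F x = (1 / real m) *\<^sub>R birkhoff_sum f E m x" for x
  have \<nu>b: "\<nu> \<in> borel_probs X" and inv: "distr \<nu> \<nu> f = \<nu>" using \<nu> by (auto simp: inv_measures_def)
  interpret prob_space \<nu> using \<nu>b by (simp add: borel_probs_def)
  have sets\<nu>: "sets \<nu> = sets (restrict_space borel X)" using \<nu>b by (simp add: borel_probs_def)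
  have fm: "f \<in> measurable \<nu> \<nu>"
  proof -
    have "f \<in> measurable (restrict_space borel X) (restrict_space borel X)"
      using f borel_measurable_continuous_on_restrict[OF f(1)]
      by (intro measurable_restrict_space2) (auto simp: space_restrict_space)
    then show ?thesis by (simp add: measurable_cong_sets[OF sets\<nu> sets\<nu>])
  qed
  have orbX: "(f ^^ i) x \<in> X" if "x \<in> X" for i x by (rule funpow_in[OF f(2) that])
  have shift: "(\<integral>x. \<phi> ((f ^^ i) x) \<partial>\<nu>) = (\<integral>x. \<phi> x \<partial>\<nu>)" if \<phi>: "continuous_on X \<phi>" for \<phi> :: "'a \<Rightarrow> real" and i
  proof (induction i)
    case (Suc i)
    have c: "continuous_on X (\<lambda>x. \<phi> ((f ^^ i) x))"
      using continuous_on_compose[OF continuous_on_funpow[OF f] continuous_on_subset[OF \<phi>]] orbX by (force simp: o_def)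
    have "(\<integral>x. \<phi> ((f ^^ i) x) \<partial>\<nu>) = (\<integral>x. \<phi> ((f ^^ i) x) \<partial>distr \<nu> \<nu> f)" by (simp add: inv)
    also have "\<dots> = (\<integral>x. \<phi> ((f ^^ i) (f x)) \<partial>\<nu>)"
      by (rule integral_distr[OF fm borel_probs_measurable[OF \<nu>b c]])
    finally show ?case using Suc by (simp add: funpow_swap1)
  qed simp
  have Fc: "apply_bcontfun (F x) c = (\<Sum>i<m. \<Phi> c ((f ^^ i) x)) / real m" if "x \<in> X" for x c
    using orbX[OF that] by (simp add: F_def birkhoff_sum_def sum_bcontfun_apply E_apply)
  have "norm (birkhoff_sum f E m x) \<le> real m * 1" if "x \<in> X" for x
    unfolding birkhoff_sum_def by (intro norm_sum_bound norm_E orbX that)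
  then have F1: "norm (F x) \<le> 1" if "x \<in> X" for x using that by (simp add: F_def m_def field_simps)
  have Ff: "continuous_on X (\<lambda>x. E ((f ^^ i) x))" for i
    using continuous_on_compose[OF continuous_on_funpow[OF f] continuous_on_subset[OF E_cont]] orbX by (force simp: o_def)
  have Fcont: "continuous_on X F" unfolding F_def birkhoff_sum_def by (intro continuous_intros Ff)
  have Fcc: "continuous_on X (\<lambda>x. apply_bcontfun (F x) c)" for c
  proof -
    have "continuous_on X (\<lambda>x. \<Phi> c ((f ^^ i) x))" for i
      using continuous_on_compose[OF continuous_on_funpow[OF f] continuous_on_subset[OF cont]] orbX by (force simp: o_def)
    then have "continuous_on X (\<lambda>x. (\<Sum>i<m. \<Phi> c ((f ^^ i) x)) / real m)" by (intro continuous_intros) (auto simp: m_def)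
    then show ?thesis by (rule continuous_on_eq) (simp add: Fc)
  qed
  have mean: "(\<integral>x. apply_bcontfun (F x) c \<partial>\<nu>) = apply_bcontfun (I \<nu>) c" for c
  proof -
    have ci: "integrable \<nu> (\<lambda>x. \<Phi> c ((f ^^ i) x))" for i
      using continuous_on_compose[OF continuous_on_funpow[OF f] continuous_on_subset[OF cont]] orbX
      by (intro borel_probs_integrable[OF X(1) \<nu>b]) (force simp: o_def)
    have "(\<integral>x. apply_bcontfun (F x) c \<partial>\<nu>) = (\<integral>x. (\<Sum>i<m. \<Phi> c ((f ^^ i) x)) / real m \<partial>\<nu>)"
      by (rule Bochner_Integration.integral_cong) (simp_all add: borel_probs_space[OF \<nu>b] Fc)
    also have "\<dots> = (\<Sum>i<m. \<integral>x. \<Phi> c ((f ^^ i) x) \<partial>\<nu>) / real m"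
      using ci by simp
    also have "\<dots> = (\<integral>x. \<Phi> c x \<partial>\<nu>)" by (simp add: shift[OF cont] m_def)
    finally show ?thesis by (simp add: I_apply[OF \<nu>b])
  qed
  obtain s :: nat and c P where P: "\<And>i. i < s \<Longrightarrow> c i \<in> Y" "\<And>i. i < s \<Longrightarrow> P i \<in> sets borel"
      "\<And>i. i < s \<Longrightarrow> P i \<subseteq> Y" "\<And>i x. i < s \<Longrightarrow> x \<in> P i \<Longrightarrow> dist (F x) (F (c i)) < \<delta>"
      "disjoint_family_on P {..<s}" "(\<Union>i<s. P i) = Y"
    using ball_partition[OF Y(1) continuous_on_subset[OF Fcont Y(2)] \<delta>(1)] by metis
  have s: "s > 0"
  proof (rule ccontr)
    assume "\<not> s > 0"
    then have "Y = {}" using P(6) by auto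
    then show False using mY \<delta> by simp
  qed
  define w where "w i = measure \<nu> (P i)" for i
  have cX: "c i \<in> X" if "i < s" for i using P(1)[OF that] Y(2) by blast
  have diff: "\<bar>apply_bcontfun (F x) k - apply_bcontfun (F y) k\<bar> \<le> dist (F x) (F y)" for x y k
    using dist_bounded[of "F x" k "F y"] by (simp add: dist_real_def)
  have wY: "(\<Sum>i<s. w i) = measure \<nu> Y"
    unfolding w_def
    by (rule step_integral(2)[OF X(1) \<nu>b continuous_on_const[of _ 0] _ Y(2) P(2,5,6), where \<delta> = 0]) auto
  have I_step: "norm (I \<nu> - (\<Sum>i<s. w i *\<^sub>R F (c i))) \<le> 2 * \<delta>"
  proof (rule norm_bcontfun_le)
    fix k
    have "\<bar>(\<integral>x. apply_bcontfun (F x) k \<partial>\<nu>) - (\<Sum>i<s. measure \<nu> (P i) * apply_bcontfun (F (c i)) k)\<bar> \<le> \<delta> + (1 - measure \<nu> Y)"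
    proof (rule step_integral(1)[OF X(1) \<nu>b Fcc _ Y(2) P(2,5,6)])
      show "\<bar>apply_bcontfun (F x) k\<bar> \<le> 1" if "x \<in> X" for x
        using norm_bounded[of "F x" k] F1[OF that] by simp
      show "\<bar>apply_bcontfun (F x) k - apply_bcontfun (F (c i)) k\<bar> \<le> \<delta>" if "i < s" "x \<in> P i" for i x
        using diff[of x k "c i"] P(4)[OF that] by linarith
    qed (use \<delta> in auto)
    then show "\<bar>apply_bcontfun (I \<nu> - (\<Sum>i<s. w i *\<^sub>R F (c i))) k\<bar> \<le> 2 * \<delta>"
      using mY by (simp add: mean sum_bcontfun_apply w_def)
  qed
  obtain xs where xs: "xs \<noteq> []" "set xs \<subseteq> c ` {..<s}"
    "norm ((\<Sum>x\<leftarrow>xs. F x) - real (length xs) *\<^sub>R (\<Sum>i<s. w i *\<^sub>R F (c i))) \<le> (\<delta> + (1 - (\<Sum>i<s. w i))) * real (length xs)"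
    by (rule convex_combination_as_average[of s w \<delta> F c]) (use s \<delta> F1 cX wY in \<open>auto simp: w_def\<close>)
  define r where "r = length xs"
  have "(\<delta> + (1 - (\<Sum>i<s. w i))) * real r \<le> 2 * \<delta> * real r"
    using mY wY by (intro mult_right_mono) auto
  with xs(3) have xs3: "norm ((\<Sum>x\<leftarrow>xs. F x) - real r *\<^sub>R (\<Sum>i<s. w i *\<^sub>R F (c i))) \<le> 2 * \<delta> * real r" by (simp add: r_def)
  have dec: "(\<Sum>x\<leftarrow>xs. birkhoff_sum f E m x - real m *\<^sub>R u) = real m *\<^sub>R
     (((\<Sum>x\<leftarrow>xs. F x) - real r *\<^sub>R (\<Sum>i<s. w i *\<^sub>R F (c i))) +
      real r *\<^sub>R ((\<Sum>i<s. w i *\<^sub>R F (c i)) - I \<nu>) + real r *\<^sub>R (I \<nu> - u))"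
  proof -
    have "birkhoff_sum f E m x = real m *\<^sub>R F x" for x by (simp add: F_def m_def)
    then have "(\<Sum>x\<leftarrow>xs. birkhoff_sum f E m x - real m *\<^sub>R u) = real m *\<^sub>R ((\<Sum>x\<leftarrow>xs. F x) - real r *\<^sub>R u)"
      unfolding r_def by (induction xs) (auto simp: algebra_simps)
    then show ?thesis by (simp add: algebra_simps)
  qed
  have est: "norm (\<Sum>x\<leftarrow>xs. birkhoff_sum f E m x - real m *\<^sub>R u) \<le> 6 * \<delta> * real (m * r)"
  proof -
    have "norm (((\<Sum>x\<leftarrow>xs. F x) - real r *\<^sub>R (\<Sum>i<s. w i *\<^sub>R F (c i))) +
      real r *\<^sub>R ((\<Sum>i<s. w i *\<^sub>R F (c i)) - I \<nu>) + real r *\<^sub>R (I \<nu> - u)) \<le> 2 * \<delta> * real r + real r * (2 * \<delta>) + real r * \<delta>"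
      using I_step u xs3 by (intro norm_triangle_mono) (auto simp: norm_minus_commute intro!: mult_left_mono)
    also have "\<dots> \<le> 6 * \<delta> * real r" using \<delta> by (simp add: algebra_simps)
    finally have "real m * norm (((\<Sum>x\<leftarrow>xs. F x) - real r *\<^sub>R (\<Sum>i<s. w i *\<^sub>R F (c i))) +
      real r *\<^sub>R ((\<Sum>i<s. w i *\<^sub>R F (c i)) - I \<nu>) + real r *\<^sub>R (I \<nu> - u)) \<le> real m * (6 * \<delta> * real r)"
      by (rule mult_left_mono) simp
    also have "real m * (6 * \<delta> * real r) = 6 * \<delta> * real (m * r)" by simp
    finally show ?thesis unfolding dec norm_scaleR abs_of_nat .
  qed
  have sub: "set xs \<subseteq> Y" using xs(2) P(1) by auto
  show "\<exists>m\<ge>n0. \<exists>zs. zs \<noteq> [] \<and> set zs \<subseteq> Y \<times> Y \<and>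
     norm (\<Sum>z\<leftarrow>zs. birkhoff_sum f E m (fst z) - real m *\<^sub>R u) \<le> 6 * \<delta> * real (m * length zs) \<and>
     norm (\<Sum>z\<leftarrow>zs. birkhoff_sum f E m (snd z) - real m *\<^sub>R u) \<le> 6 * \<delta> * real (m * length zs) \<and>
     (False \<longrightarrow> (\<forall>z\<in>set zs. close_time f \<tau> m (fst z) (snd z) \<le> 6 * \<delta> * real m))"
    by (intro exI[of _ m] conjI exI[of _ "map (\<lambda>x. (x, x)) xs"])
      (use xs(1) sub est in \<open>auto simp: m_def o_def r_def simp del: of_nat_mult\<close>)
qed

lemma distal_pair_eventually:
  assumes "distal_pair f p q"
  obtains \<tau> i0 where "\<tau> > 0" "\<And>i. i \<ge> i0 \<Longrightarrow> dist ((f ^^ i) p) ((f ^^ i) q) \<ge> \<tau>"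
proof -
  have "0 < liminf (\<lambda>i. ereal (dist ((f ^^ i) p) ((f ^^ i) q)))" using assms by (simp add: distal_pair_def)
  then obtain \<tau> where \<tau>: "0 < ereal \<tau>" "ereal \<tau> < liminf (\<lambda>i. ereal (dist ((f ^^ i) p) ((f ^^ i) q)))"
    using ereal_dense2 by blast
  have "\<forall>\<^sub>F i in sequentially. ereal \<tau> < ereal (dist ((f ^^ i) p) ((f ^^ i) q))" by (rule less_LiminfD[OF \<tau>(2)])
  then show ?thesis using that[of \<tau>] \<tau>(1) unfolding eventually_sequentially by (auto intro: less_imp_le)
qed

text \<open>Concatenating copies of the generic orbits of \<open>p1\<close> and \<open>p2\<close> in the proportion
  \<open>\<theta> : (1 - \<theta>)\<close>, and likewise those of \<open>q1\<close> and \<open>q2\<close>, approximates the mixture by two orbits that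
  stay apart most of the time.\<close>

lemma distal_block_approximable:
  assumes f: "f ` X \<subseteq> X" and \<mu>: "\<mu>1 \<in> borel_probs X" "\<mu>2 \<in> borel_probs X" and \<theta>: "0 \<le> \<theta>" "\<theta> \<le> 1"
    and p: "{p1, q1} \<subseteq> G_set X f {\<mu>1} \<inter> Y" "{p2, q2} \<subseteq> G_set X f {\<mu>2} \<inter> Y"
    and d: "\<And>i. i \<ge> start \<Longrightarrow> dist ((f ^^ i) p1) ((f ^^ i) q1) \<ge> \<tau>" "\<And>i. i \<ge> start \<Longrightarrow> dist ((f ^^ i) p2) ((f ^^ i) q2) \<ge> \<tau>"
    and \<delta>: "\<delta> > 0"
  shows "block_approximable f E Y (\<theta> *\<^sub>R I \<mu>1 + (1 - \<theta>) *\<^sub>R I \<mu>2) True \<tau> \<delta>"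
  unfolding block_approximable_def
proof
  fix n0
  let ?u = "\<theta> *\<^sub>R I \<mu>1 + (1 - \<theta>) *\<^sub>R I \<mu>2"
  have d2: "\<delta> / 2 > 0" using \<delta> by simp
  have "\<forall>\<^sub>F m in sequentially. deviation f E m x (I \<mu>1) \<le> \<delta> / 2 * real m" if "x \<in> {p1, q1}" for x
    using p(1) that by (intro unique_accumulation_converges[OF f _ d2]) auto
  moreover have "\<forall>\<^sub>F m in sequentially. deviation f E m x (I \<mu>2) \<le> \<delta> / 2 * real m" if "x \<in> {p2, q2}" for x
    using p(2) that by (intro unique_accumulation_converges[OF f _ d2]) auto
  moreover have "\<forall>\<^sub>F m in sequentially. real start \<le> \<delta> * real m"
    using filterlim_tendsto_pos_mult_at_top[OF tendsto_const \<delta> filterlim_real_sequentially]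
    unfolding filterlim_at_top by blast
  ultimately have "\<forall>\<^sub>F m in sequentially. m \<ge> n0 \<and> real start \<le> \<delta> * real m \<and>
     deviation f E m p1 (I \<mu>1) \<le> \<delta> / 2 * real m \<and> deviation f E m q1 (I \<mu>1) \<le> \<delta> / 2 * real m \<and>
     deviation f E m p2 (I \<mu>2) \<le> \<delta> / 2 * real m \<and> deviation f E m q2 (I \<mu>2) \<le> \<delta> / 2 * real m"
    by (intro eventually_conj eventually_ge_at_top) auto
  from eventually_happens'[OF sequentially_bot this] obtain m where m: "m \<ge> n0" "real start \<le> \<delta> * real m"
     "deviation f E m p1 (I \<mu>1) \<le> \<delta> / 2 * real m" "deviation f E m q1 (I \<mu>1) \<le> \<delta> / 2 * real m"
     "deviation f E m p2 (I \<mu>2) \<le> \<delta> / 2 * real m" "deviation f E m q2 (I \<mu>2) \<le> \<delta> / 2 * real m"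
    by auto
  obtain r :: nat where r: "4 / \<delta> < real r" using reals_Archimedean2 by blast
  have r4: "2 \<le> \<delta> / 2 * real r" using r \<delta> by (simp add: field_simps)
  have r0: "r > 0" using r4 by (cases r) auto
  define k where "k = nat \<lfloor>\<theta> * real r\<rfloor>"
  have fl: "\<lfloor>\<theta> * real r\<rfloor> \<ge> 0" using \<theta> by simp
  then have kf: "real k = real_of_int \<lfloor>\<theta> * real r\<rfloor>" by (simp add: k_def)
  have k1: "\<bar>real k - \<theta> * real r\<bar> \<le> 1" using kf by linarith
  have "\<theta> * real r \<le> 1 * real r" using \<theta> by (intro mult_right_mono) auto
  then have kr: "k \<le> r" using kf by linarith
  have est: "norm (\<Sum>x\<leftarrow>replicate k a @ replicate (r - k) b. birkhoff_sum f E m x - real m *\<^sub>R ?u) \<le> \<delta> * real (m * r)"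
    if ab: "deviation f E m a (I \<mu>1) \<le> \<delta> / 2 * real m" "deviation f E m b (I \<mu>2) \<le> \<delta> / 2 * real m" for a b
  proof -
    have I12: "norm (I \<mu>1 - I \<mu>2) \<le> 2" using norm_triangle_ineq4[of "I \<mu>1" "I \<mu>2"] norm_I[OF \<mu>(1)] norm_I[OF \<mu>(2)] by linarith
    have "(\<Sum>x\<leftarrow>replicate k a @ replicate (r - k) b. birkhoff_sum f E m x - real m *\<^sub>R ?u) =
      real k *\<^sub>R (birkhoff_sum f E m a - real m *\<^sub>R I \<mu>1) + real (r - k) *\<^sub>R (birkhoff_sum f E m b - real m *\<^sub>R I \<mu>2) +
      real m *\<^sub>R ((real k - \<theta> * real r) *\<^sub>R (I \<mu>1 - I \<mu>2))"
      unfolding map_append sum_list_append sum_list_replicate_scaleR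
      using kr by (simp add: of_nat_diff algebra_simps)
    also have "norm \<dots> \<le> real k * (\<delta> / 2 * real m) + real (r - k) * (\<delta> / 2 * real m) + real m * (1 * 2)"
    proof (intro norm_triangle_mono)
      show "norm (real k *\<^sub>R (birkhoff_sum f E m a - real m *\<^sub>R I \<mu>1)) \<le> real k * (\<delta> / 2 * real m)"
        unfolding norm_scaleR abs_of_nat using ab(1) by (rule mult_left_mono) simp
      show "norm (real (r - k) *\<^sub>R (birkhoff_sum f E m b - real m *\<^sub>R I \<mu>2)) \<le> real (r - k) * (\<delta> / 2 * real m)"
        unfolding norm_scaleR abs_of_nat using ab(2) by (rule mult_left_mono) simp
      show "norm (real m *\<^sub>R ((real k - \<theta> * real r) *\<^sub>R (I \<mu>1 - I \<mu>2))) \<le> real m * (1 * 2)"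
        unfolding norm_scaleR abs_of_nat by (intro mult_left_mono mult_mono k1 I12) auto
    qed
    also have "\<dots> = \<delta> / 2 * real (m * r) + real m * 2" using kr by (simp add: of_nat_diff field_simps)
    also have "\<dots> \<le> \<delta> / 2 * real (m * r) + real m * (\<delta> / 2 * real r)" using r4 by (intro add_left_mono mult_left_mono) auto
    finally show ?thesis by (simp add: algebra_simps)
  qed
  have close: "close_time f \<tau> m a b \<le> \<delta> * real m" if "\<And>i. i \<ge> start \<Longrightarrow> dist ((f ^^ i) a) ((f ^^ i) b) \<ge> \<tau>" for a b
  proof -
    have "card {i\<in>{..<m}. dist ((f ^^ i) a) ((f ^^ i) b) < \<tau>} \<le> card {..<start}"
      using that by (intro card_mono) (auto simp: not_le[symmetric])
    then show ?thesis unfolding close_time_card using m(2) by simp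
  qed
  define zs where "zs = replicate k (p1, q1) @ replicate (r - k) (p2, q2)"
  have len: "length zs = r" using kr by (simp add: zs_def)
  have e1: "norm (\<Sum>z\<leftarrow>zs. birkhoff_sum f E m (fst z) - real m *\<^sub>R ?u) \<le> \<delta> * real (m * length zs)"
    and e2: "norm (\<Sum>z\<leftarrow>zs. birkhoff_sum f E m (snd z) - real m *\<^sub>R ?u) \<le> \<delta> * real (m * length zs)"
    using est[OF m(3,5)] est[OF m(4,6)] unfolding len
    by (simp_all add: zs_def)
  have set: "set zs \<subseteq> {(p1, q1), (p2, q2)}" by (auto simp: zs_def)
  show "\<exists>m\<ge>n0. \<exists>zs. zs \<noteq> [] \<and> set zs \<subseteq> Y \<times> Y \<and>
     norm (\<Sum>z\<leftarrow>zs. birkhoff_sum f E m (fst z) - real m *\<^sub>R ?u) \<le> \<delta> * real (m * length zs) \<and>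
     norm (\<Sum>z\<leftarrow>zs. birkhoff_sum f E m (snd z) - real m *\<^sub>R ?u) \<le> \<delta> * real (m * length zs) \<and>
     (True \<longrightarrow> (\<forall>z\<in>set zs. close_time f \<tau> m (fst z) (snd z) \<le> \<delta> * real m))"
  proof (intro exI[of _ m] conjI exI[of _ zs] impI ballI)
    show "zs \<noteq> []" using len r0 by auto
    show "set zs \<subseteq> Y \<times> Y" using set p by auto
    show "close_time f \<tau> m (fst z) (snd z) \<le> \<delta> * real m" if "z \<in> set zs" for z
      using set that close[OF d(1)] close[OF d(2)] by auto
  qed (use m e1 e2 in auto)
qed

end

section \<open>Distributional chaos in saturated sets\<close>

lemma liminf_ratio_eq_0:
  fixes a :: "nat \<Rightarrow> real"
  assumes nn: "\<And>n. a n \<ge> 0" and small: "\<And>e. e > 0 \<Longrightarrow> \<exists>\<^sub>F n in sequentially. a n \<le> e * real n"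
  shows "liminf (\<lambda>n. ereal (a n / real n)) = 0"
proof (rule antisym)
  show "0 \<le> liminf (\<lambda>n. ereal (a n / real n))"
    by (rule Liminf_bounded) (use nn in auto)
  show "liminf (\<lambda>n. ereal (a n / real n)) \<le> 0"
  proof (rule ccontr)
    assume "\<not> ?thesis"
    then obtain e where e: "0 < ereal e" "ereal e < liminf (\<lambda>n. ereal (a n / real n))"
      using ereal_dense2[of 0] by (auto simp: not_le)
    have "\<forall>\<^sub>F n in sequentially. ereal e < ereal (a n / real n)" by (rule less_LiminfD[OF e(2)])
    moreover have "\<forall>\<^sub>F n in sequentially. n > (0::nat)" by (rule eventually_gt_at_top)
    ultimately have "\<forall>\<^sub>F n in sequentially. \<not> a n \<le> e * real n"
      by eventually_elim (simp add: pos_less_divide_eq)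
    then show False using small[of e] e(1) by (simp add: frequently_def)
  qed
qed

lemma limsup_ratio_eq_1:
  fixes a :: "nat \<Rightarrow> real"
  assumes le: "\<And>n. a n \<le> real n" and large: "\<And>e. e > 0 \<Longrightarrow> \<exists>\<^sub>F n in sequentially. a n \<ge> (1 - e) * real n"
  shows "limsup (\<lambda>n. ereal (a n / real n)) = 1"
proof (rule antisym)
  have "a n / real n \<le> 1" for n using le[of n] by (cases "n = 0") (auto simp: divide_le_eq_1)
  then show "limsup (\<lambda>n. ereal (a n / real n)) \<le> 1"
    by (intro Limsup_bounded) auto
  show "1 \<le> limsup (\<lambda>n. ereal (a n / real n))"
  proof (rule ccontr)
    assume "\<not> ?thesis"
    then obtain c where c: "limsup (\<lambda>n. ereal (a n / real n)) < ereal c" "ereal c < 1"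
      using ereal_dense2[of _ 1] by (auto simp: not_le)
    have "\<forall>\<^sub>F n in sequentially. ereal (a n / real n) < ereal c" by (rule Limsup_lessD[OF c(1)])
    moreover have "\<forall>\<^sub>F n in sequentially. n > (0::nat)" by (rule eventually_gt_at_top)
    ultimately have "\<forall>\<^sub>F n in sequentially. \<not> a n \<ge> (1 - (1 - c)) * real n"
      by eventually_elim (simp add: pos_divide_less_eq)
    then show False using large[of "1 - c"] c(2) by (simp add: frequently_def one_ereal_def)
  qed
qed

lemma close_time_nonneg: "close_time f t n x y \<ge> 0"
  unfolding close_time_card by simp

lemma close_time_le: "close_time f t n x y \<le> real n"
proof -
  have "card {i\<in>{..<n}. dist ((f ^^ i) x) ((f ^^ i) y) < t} \<le> card {..<n}" by (intro card_mono) auto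
  then show ?thesis unfolding close_time_card by simp
qed

context weak_coordinates
begin

text \<open>Weak* neighbourhoods of a measure correspond to norm neighbourhoods of its coordinates, hence the
accumulation points of the empirical measures can be found from the Birkhoff averages.\<close>

lemma V_set_eqI:
  assumes f: "f ` X \<subseteq> X" "x \<in> X" and K: "K \<subseteq> borel_probs X" "compact (I ` K)"
    and near: "\<And>e. e > 0 \<Longrightarrow> \<forall>\<^sub>F n in sequentially. \<exists>u\<in>I ` K. deviation f E n x u \<le> e * real n"
    and acc: "\<And>u e. u \<in> I ` K \<Longrightarrow> e > 0 \<Longrightarrow> \<exists>\<^sub>F n in sequentially. deviation f E n x u \<le> e * real n"
  shows "V_set X f x = K"
proof -
  let ?em = "empirical_measure X f x"
  have dev: "norm (I (?em n) - u) \<le> e" if "n > 0" "deviation f E n x u \<le> e * real n" for n u e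
  proof -
    have "birkhoff_sum f E n x - real n *\<^sub>R u = real n *\<^sub>R (I (?em n) - u)"
      using that(1) by (simp add: I_empirical[OF f] scaleR_diff_right)
    then have "real n * norm (I (?em n) - u) \<le> real n * e" using that(2) by (simp add: mult.commute)
    then show ?thesis using that(1) by simp
  qed
  have pos: "\<forall>\<^sub>F n in sequentially. n > (0::nat)" by (rule eventually_gt_at_top)
  show ?thesis
  proof
    show "K \<subseteq> V_set X f x"
    proof
      fix \<nu> assume \<nu>: "\<nu> \<in> K"
      show "\<nu> \<in> V_set X f x"
        unfolding V_set_def
      proof (intro CollectI conjI allI impI)
        show "\<nu> \<in> borel_probs X" using \<nu> K by blast
        fix W assume W: "openin (weak_star X) W \<and> \<nu> \<in> W"
        obtain d where d: "d > 0" "\<And>\<rho>. \<rho> \<in> borel_probs X \<Longrightarrow> norm (I \<rho> - I \<nu>) < d \<Longrightarrow> \<rho> \<in> W"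
          using weak_star_nbhd[OF conjunct1[OF W] conjunct2[OF W]] by blast
        have d2: "d / 2 > 0" using d by simp
        have "\<exists>\<^sub>F n in sequentially. deviation f E n x (I \<nu>) \<le> d / 2 * real n \<and> n > 0"
          by (rule frequently_eventually_frequently[OF acc[OF imageI[OF \<nu>] d2] pos])
        then show "\<exists>\<^sub>F n in sequentially. ?em n \<in> W"
        proof (rule frequently_elim1)
          fix n assume n: "deviation f E n x (I \<nu>) \<le> d / 2 * real n \<and> n > 0"
          then have "norm (I (?em n) - I \<nu>) < d" using dev[of n "I \<nu>" "d / 2"] d by simp
          then show "?em n \<in> W" using d(2) empirical_measure_borel_probs(1)[OF f] n by blast
        qed
      qed
    qed
    show "V_set X f x \<subseteq> K"
    proof
      fix \<nu> assume "\<nu> \<in> V_set X f x"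
      then have \<nu>: "\<nu> \<in> borel_probs X" "\<And>W. openin (weak_star X) W \<Longrightarrow> \<nu> \<in> W \<Longrightarrow> \<exists>\<^sub>F n in sequentially. ?em n \<in> W"
        by (auto simp: V_set_def)
      have "I \<nu> \<in> closure (I ` K)"
        unfolding closure_approachable
      proof (intro allI impI)
        fix e :: real assume e: "e > 0"
        let ?W = "{\<rho> \<in> topspace (weak_star X). I \<rho> \<in> ball (I \<nu>) (e / 2)}"
        have "openin (weak_star X) ?W"
          by (rule openin_continuous_map_preimage[OF continuous_map_I]) (simp flip: open_openin)
        then have fr: "\<exists>\<^sub>F n in sequentially. ?em n \<in> ?W" using \<nu> e by (intro \<nu>(2)) (auto simp: topspace_weak_star)
        have e4: "e / 4 > 0" using e by simp
        have "\<exists>\<^sub>F n in sequentially. ?em n \<in> ?W \<and> ((\<exists>u\<in>I ` K. deviation f E n x u \<le> e / 4 * real n) \<and> n > 0)"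
          by (rule frequently_eventually_frequently[OF fr eventually_conj[OF near[OF e4] pos]])
        then obtain n u where n: "?em n \<in> ?W" "u \<in> I ` K" "deviation f E n x u \<le> e / 4 * real n" "n > 0"
          using frequently_ex by blast
        have "dist (I (?em n)) u \<le> e / 4" using dev[OF n(4,3)] by (simp add: dist_norm)
        moreover have "dist (I \<nu>) (I (?em n)) < e / 2" using n(1) by simp
        ultimately have "dist u (I \<nu>) < e" using e dist_triangle3[of u "I \<nu>" "I (?em n)"] by (simp add: dist_commute)
        then show "\<exists>y\<in>I ` K. dist y (I \<nu>) < e" using n(2) by blast
      qed
      then have "I \<nu> \<in> I ` K" using compact_imp_closed[OF K(2)] by simp
      then obtain \<rho> where "\<rho> \<in> K" "I \<nu> = I \<rho>" by blast
      then show "\<nu> \<in> K" using I_eqD[OF \<nu>(1)] K(1) by blast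
    qed
  qed
qed

end

lemma homeo_invariant_subset:
  assumes "is_homeo X f" and Y: "Y \<subseteq> X" "f ` Y = Y"
  shows "is_homeo Y f" "y \<in> Y \<Longrightarrow> int_iterate Y f i y = int_iterate X f i y"
proof -
  obtain h where h: "homeomorphism X X f h" using assms(1) by (auto simp: is_homeo_def)
  have inj: "inj_on f X" using h by (metis homeomorphism_def inj_on_inverseI)
  show "is_homeo Y f" unfolding is_homeo_def
    using homeomorphism_of_subsets[OF h Y(1) Y(1)] Y(2) by blast
  have eq: "inv_into Y f y = inv_into X f y" if "y \<in> Y" for y
  proof -
    from that have "y \<in> f ` Y" by (simp only: Y(2))
    then obtain p where p: "p \<in> Y" "y = f p" by (rule imageE) auto
    have "p \<in> X" using p Y(1) by blast
    then show ?thesis using inv_into_f_f[OF inj] inv_into_f_f[OF inj_on_subset[OF inj Y(1)]] p by simp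
  qed
  have inY: "inv_into Y f y \<in> Y" if "y \<in> Y" for y
    by (rule inv_into_into) (simp only: Y(2) that)
  have "(inv_into Y f ^^ n) y \<in> Y \<and> (inv_into Y f ^^ n) y = (inv_into X f ^^ n) y" if "y \<in> Y" for n y
    using that
  proof (induction n)
    case (Suc n)
    then have z: "(inv_into X f ^^ n) y \<in> Y" "(inv_into Y f ^^ n) y = (inv_into X f ^^ n) y" by auto
    then show ?case using inY[OF z(1)] eq[OF z(1)] by simp
  qed simp
  then show "y \<in> Y \<Longrightarrow> int_iterate Y f i y = int_iterate X f i y" by (simp add: int_iterate_def)
qed

lemma gluing_cong:
  assumes "\<And>j y. y \<in> Y \<Longrightarrow> B j y = B' j y"
  shows "gluing f B summed Y \<epsilon> g \<longleftrightarrow> gluing f B' summed Y \<epsilon> g"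
  unfolding gluing_def by (intro ball_cong refl all_cong1 bex_cong) (simp add: assms)

theorem theorem3:
  fixes X :: "'a::metric_space set" and f :: "'a \<Rightarrow> 'a" and Xs :: "nat \<Rightarrow> 'a set"
    and K :: "'a measure set" and \<mu> \<mu>1 \<mu>2 :: "'a measure" and \<theta> :: real and l0 :: nat
    and p1 q1 p2 q2 :: 'a
  assumes "dynamical_system X f"
    and "\<And>n. n \<ge> 1 \<Longrightarrow> compact (Xs n) \<and> invariant_subset X f (Xs n)"
    and "\<And>m n. 1 \<le> m \<Longrightarrow> m \<le> n \<Longrightarrow> Xs m \<subseteq> Xs n"
    and "closure (\<Union>n\<in>{1..}. Xs n) = X"
    and "K \<noteq> {}"
    and "compactin (inv_weak_star X f) K"
    and "connectedin (inv_weak_star X f) K"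
    and "K \<subseteq> (inv_weak_star X f) closure_of
           {\<nu> \<in> inv_measures X f. measure \<nu> (\<Union>n\<in>{1..}. Xs n) = 1}"
    and "\<mu> \<in> K"
    and "0 \<le> \<theta>" and "\<theta> \<le> 1"
    and "\<mu>1 \<in> inv_measures X f" and "\<mu>2 \<in> inv_measures X f"
    and "\<And>A. A \<in> sets \<mu> \<Longrightarrow> measure \<mu> A = \<theta> * measure \<mu>1 A + (1 - \<theta>) * measure \<mu>2 A"
    and "l0 \<ge> 1" and "measure \<mu> (Xs l0) = 1"
    and "p1 \<in> G_set X f {\<mu>1} \<inter> Xs l0" and "q1 \<in> G_set X f {\<mu>1} \<inter> Xs l0" and "distal_pair f p1 q1"
    and "p2 \<in> G_set X f {\<mu>2} \<inter> Xs l0" and "q2 \<in> G_set X f {\<mu>2} \<inter> Xs l0" and "distal_pair f p2 q2"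
  shows "((\<forall>n\<ge>1. specification_property (Xs n) f) \<longrightarrow>
           (\<forall>U. openin (top_of_set X) U \<and> U \<noteq> {} \<longrightarrow>
              one_chaotic f (G_set X f K \<inter> U \<inter> Trans X f))) \<and>
         ((\<forall>n\<ge>1. exp_specification_property (Xs n) f) \<longrightarrow>
           (\<forall>U. openin (top_of_set X) U \<and> U \<noteq> {} \<longrightarrow>
              strongly_dist_chaotic f (G_set X f K \<inter> U \<inter> Trans X f)) \<and>
           (is_homeo X f \<longrightarrow>
              (\<forall>z\<in>(\<Union>n\<in>{1..}. Xs n). \<forall>\<epsilon>>0.
                 strongly_dist_chaotic f (G_set X f K \<inter> local_unstable X f \<epsilon> z \<inter> Trans X f))))"
proof -
  have sys: "compact X" "continuous_on X f" "f ` X \<subseteq> X" using assms(1) by (auto simp: dynamical_system_def)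
  have Xne: "X \<noteq> {}" using assms(1) by (auto simp: dynamical_system_def)
  have Xs: "compact (Xs n)" "Xs n \<subseteq> X" "f ` Xs n \<subseteq> Xs n" "is_homeo X f \<Longrightarrow> f ` Xs n = Xs n" if "n \<ge> 1" for n
    using assms(2)[OF that] by (auto simp: invariant_subset_def)
  obtain \<Phi> where "weak_coordinates X \<Phi>" using ex_weak_coordinates[OF sys(1) Xne] by blast
  then interpret weak_coordinates X \<Phi> .
  have top: "topspace (inv_weak_star X f) = inv_measures X f"
    by (auto simp: inv_weak_star_def topspace_weak_star inv_measures_def)
  have Kinv: "K \<subseteq> inv_measures X f" using compactin_subset_topspace[OF assms(6)] top by simp
  have Kb: "K \<subseteq> borel_probs X" using Kinv by (auto simp: inv_measures_def)
  have contI: "continuous_map (inv_weak_star X f) euclidean I"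
    unfolding inv_weak_star_def by (rule continuous_map_from_subtopology[OF continuous_map_I])
  have IK: "compact (I ` K)" "connected (I ` K)"
    using image_compactin[OF assms(6) contI] connectedin_continuous_map_image[OF contI assms(7)] by auto
  have \<mu>b: "\<mu> \<in> borel_probs X" "\<mu>1 \<in> borel_probs X" "\<mu>2 \<in> borel_probs X"
    using Kb assms by (auto simp: inv_measures_def)
  have I\<mu>: "I \<mu> = \<theta> *\<^sub>R I \<mu>1 + (1 - \<theta>) *\<^sub>R I \<mu>2"
  proof (rule bcontfun_eqI)
    fix c
    have "\<bar>\<Phi> c x\<bar> \<le> 1" if "x \<in> X" for x using bound[OF that, of c] half_power_le_1[of c] by linarith
    then show "apply_bcontfun (I \<mu>) c = apply_bcontfun (\<theta> *\<^sub>R I \<mu>1 + (1 - \<theta>) *\<^sub>R I \<mu>2) c"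
      using mixture_integral[OF sys(1) \<mu>b assms(10,11,14) cont, of c] by (simp add: I_apply \<mu>b)
  qed
  obtain \<tau>1 i1 where d1: "\<tau>1 > 0" "\<And>i. i \<ge> i1 \<Longrightarrow> dist ((f ^^ i) p1) ((f ^^ i) q1) \<ge> \<tau>1"
    using distal_pair_eventually[OF assms(19)] by metis
  obtain \<tau>2 i2 where d2: "\<tau>2 > 0" "\<And>i. i \<ge> i2 \<Longrightarrow> dist ((f ^^ i) p2) ((f ^^ i) q2) \<ge> \<tau>2"
    using distal_pair_eventually[OF assms(22)] by metis
  \<comment> \<open>The distance \<open>\<tau>\<close> is halved when the orbits of the distal pairs are glued, and again when the
    glued orbits are shadowed; hence the points found below are separated by \<open>\<tau>/4\<close>.\<close>
  define \<tau> where "\<tau> = min \<tau>1 \<tau>2"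
  have \<tau>: "\<tau> > 0" "\<tau> / 2 > 0" using d1 d2 by (auto simp: \<tau>_def)
  have appv: "\<exists>l\<ge>1. \<exists>T. \<forall>L. \<exists>y\<in>Xs l. \<exists>y'\<in>Xs l. tracked f E (I \<mu>) True (\<tau> / 2) \<delta> T L y y'"
    if sp: "\<forall>n\<ge>1. specification_property (Xs n) f" and \<delta>: "\<delta> > 0" for \<delta>
  proof -
    have "block_approximable f E (Xs l0) (I \<mu>) True \<tau> (\<delta> / 4)"
      unfolding I\<mu>
    proof (rule distal_block_approximable[OF sys(3) \<mu>b(2,3) assms(10,11), where start = "max i1 i2"])
      show "dist ((f ^^ i) p1) ((f ^^ i) q1) \<ge> \<tau>" "dist ((f ^^ i) p2) ((f ^^ i) q2) \<ge> \<tau>" if "i \<ge> max i1 i2" for i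
        using d1(2)[of i] d2(2)[of i] that by (auto simp: \<tau>_def)
    qed (use assms \<delta> in auto)
    then show ?thesis
      using specification_tracked[OF sys(1) E_cont sys(3) Xs(2) _ \<tau>(1) \<delta>, of l0] sp assms(15) by blast
  qed
  have app: "\<exists>l\<ge>1. \<exists>T. \<forall>L. \<exists>y\<in>Xs l. \<exists>y'\<in>Xs l. tracked f E u False (\<tau> / 2) \<delta> T L y y'"
    if sp: "\<forall>n\<ge>1. specification_property (Xs n) f" and u: "u \<in> I ` K" and \<delta>: "\<delta> > 0" for u \<delta>
  proof -
    obtain \<nu> where \<nu>: "\<nu> \<in> K" "u = I \<nu>" using u by blast
    \<comment> \<open>The approximation of a measure by orbit segments multiplies the error by \<open>6\<close>, and gluing the
      segments multiplies it by \<open>4\<close>.\<close>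
    define e where "e = min (\<delta> / 24) (1/2)"
    have e: "e > 0" "e < 1" "6 * e \<le> \<delta> / 4" using \<delta> by (auto simp: e_def)
    let ?W = "{\<rho> \<in> topspace (inv_weak_star X f). I \<rho> \<in> ball (I \<nu>) e}"
    have "openin (inv_weak_star X f) ?W"
      by (rule openin_continuous_map_preimage[OF contI]) (simp flip: open_openin)
    moreover have "\<nu> \<in> ?W" using \<nu>(1) Kinv top e by auto
    moreover have "\<nu> \<in> inv_weak_star X f closure_of {\<nu> \<in> inv_measures X f. measure \<nu> (\<Union>n\<in>{1..}. Xs n) = 1}"
      using assms(8) \<nu>(1) by (rule subsetD)
    ultimately have "\<exists>\<rho>. \<rho> \<in> {\<nu> \<in> inv_measures X f. measure \<nu> (\<Union>n\<in>{1..}. Xs n) = 1} \<and> \<rho> \<in> ?W"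
      by (simp only: in_closure_of)
    then obtain \<rho> where "\<rho> \<in> {\<nu> \<in> inv_measures X f. measure \<nu> (\<Union>n\<in>{1..}. Xs n) = 1} \<and> \<rho> \<in> ?W"
      by (elim exE)
    then have \<rho>: "\<rho> \<in> inv_measures X f" "measure \<rho> (\<Union>n\<in>{1..}. Xs n) = 1" "I \<rho> \<in> ball (I \<nu>) e"
      by simp_all
    have \<rho>b: "\<rho> \<in> borel_probs X" using \<rho>(1) by (simp add: inv_measures_def)
    interpret prob_space \<rho> using \<rho>b by (simp add: borel_probs_def)
    have Xss: "Xs n \<in> sets \<rho>" if "n \<ge> 1" for n
    proof -
      have "Xs n = X \<inter> Xs n" using Xs(2)[OF that] by blast
      moreover have "Xs n \<in> sets borel" using compact_imp_closed[OF Xs(1)[OF that]] by simp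
      ultimately have "Xs n \<in> sets (restrict_space borel X)" unfolding sets_restrict_space by blast
      then show ?thesis using \<rho>b by (simp add: borel_probs_def)
    qed
    have "(\<lambda>n. measure \<rho> (Xs (Suc n))) \<longlonglongrightarrow> measure \<rho> (\<Union>n. Xs (Suc n))"
      by (rule finite_Lim_measure_incseq) (use Xss assms(3) in \<open>auto simp: incseq_def\<close>)
    moreover have "(\<Union>n. Xs (Suc n)) = (\<Union>n\<in>{1..}. Xs n)"
    proof (intro equalityI subsetI)
      fix y assume "y \<in> (\<Union>n\<in>{1..}. Xs n)"
      then obtain n where "n \<ge> 1" "y \<in> Xs n" by auto
      then show "y \<in> (\<Union>n. Xs (Suc n))" by (cases n) auto
    qed auto
    ultimately have "(\<lambda>n. measure \<rho> (Xs (Suc n))) \<longlonglongrightarrow> 1" using \<rho>(2) by simp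
    then have "\<forall>\<^sub>F n in sequentially. measure \<rho> (Xs (Suc n)) > 1 - e" using e by (intro order_tendstoD(1)) auto
    from eventually_happens'[OF sequentially_bot this] obtain n where n: "measure \<rho> (Xs (Suc n)) > 1 - e" by blast
    define l where "l = Suc n"
    have l: "l \<ge> 1" by (simp add: l_def)
    have "block_approximable f E (Xs l) u False \<tau> (6 * e)"
      by (rule invariant_block_approximable[OF sys(2,3) \<rho>(1) Xs(1,2)[OF l]])
        (use n e \<rho>(3) \<nu>(2) in \<open>auto simp: l_def dist_norm norm_minus_commute intro: less_imp_le\<close>)
    moreover have "6 * e * real k \<le> \<delta> / 4 * real k" for k using e by (intro mult_right_mono) auto
    ultimately have "block_approximable f E (Xs l) u False \<tau> (\<delta> / 4)"
      unfolding block_approximable_def using order_trans by (smt (verit, best))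
    then show ?thesis
      using specification_tracked[OF sys(1) E_cont sys(3) Xs(2)[OF l] _ \<tau>(1) \<delta>] sp l by blast
  qed
  \<comment> \<open>The scrambled family, with the base point and the backward maps still to be chosen.\<close>
  have family: "\<exists>S \<subseteq> {x \<in> G_set X f K \<inter> Trans X f. dist x z0 \<le> r \<and>
        (\<forall>j. dist (B j x) (B j z0) \<le> r) \<and> (\<lambda>j. dist (B j x) (B j z0)) \<longlonglongrightarrow> 0}.
      uncountable S \<and> pairwise (\<lambda>x y. DC1_pair f x y \<and> (summed \<longrightarrow> growth_DC1_pair f \<alpha> x y)) S"
    if sp: "\<forall>n\<ge>1. specification_property (Xs n) f"
      and gl: "\<And>l \<epsilon>. l \<ge> 1 \<Longrightarrow> \<epsilon> > 0 \<Longrightarrow> \<exists>g. gluing f B summed (Xs l) \<epsilon> g"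
      and B: "\<And>j. continuous_on X (B j)" and z0: "lz \<ge> 1" "z0 \<in> Xs lz" and r: "r > 0"
      and \<alpha>: "filterlim \<alpha> at_top sequentially"
    for B summed z0 lz r and \<alpha> :: "nat \<Rightarrow> real"
  proof -
    have dense: "X \<subseteq> closure (\<Union>l\<in>{1..}. Xs l)" using assms(4) by simp
    obtain x :: "(nat \<Rightarrow> bool) \<Rightarrow> 'a" where x': "(\<forall>\<xi>. x \<xi> \<in> X \<and> dist (x \<xi>) z0 \<le> r \<and> (\<forall>j. dist (B j (x \<xi>)) (B j z0) \<le> r) \<and>
      (\<lambda>j. dist (B j (x \<xi>)) (B j z0)) \<longlonglongrightarrow> 0 \<and> x \<xi> \<in> Trans X f) \<and>
    (\<forall>\<xi>. \<forall>e>0. \<forall>\<^sub>F n in sequentially. \<exists>u\<in>I ` K. deviation f E n (x \<xi>) u \<le> e * real n) \<and>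
    (\<forall>\<xi>. \<forall>u\<in>I ` K. \<forall>e>0. \<exists>\<^sub>F n in sequentially. deviation f E n (x \<xi>) u \<le> e * real n) \<and>
    (\<forall>\<xi> \<eta>. \<forall>e>0. \<xi> \<noteq> \<eta> \<longrightarrow> (\<exists>\<^sub>F n in sequentially. close_time f (\<tau> / 2 / 2) n (x \<xi>) (x \<eta>) \<le> e * real n)) \<and>
    (\<forall>\<xi> \<eta>. \<forall>t>0. \<forall>e>0. \<exists>\<^sub>F n in sequentially. close_time f t n (x \<xi>) (x \<eta>) \<ge> (1 - e) * real n) \<and>
    (summed \<longrightarrow> (\<forall>\<xi> \<eta>. \<forall>t>0. \<forall>e>0. \<exists>\<^sub>F n in sequentially.
       real (card {i\<in>{1..n}. (\<Sum>j<i. dist ((f ^^ j) (x \<xi>)) ((f ^^ j) (x \<eta>))) < \<alpha> i * t}) \<ge> (1 - e) * real n))"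
      by (rule exE[OF scrambled_family[OF sys B Xs(2) assms(3) dense gl E_cont IK imageI[OF assms(9)] \<tau>(2) app[OF sp] appv[OF sp] z0 r \<alpha>]])
    note x1 = conjunct1[OF x'] and rest1 = conjunct2[OF x']
    note near = conjunct1[OF rest1, rule_format] and rest2 = conjunct2[OF rest1]
    note acc = conjunct1[OF rest2, rule_format] and rest3 = conjunct2[OF rest2]
    note apart = conjunct1[OF rest3, rule_format] and rest4 = conjunct2[OF rest3]
    note prox = conjunct1[OF rest4, rule_format] and prox_growth = conjunct2[OF rest4, rule_format]
    have x: "x \<xi> \<in> X" "dist (x \<xi>) z0 \<le> r" "\<forall>j. dist (B j (x \<xi>)) (B j z0) \<le> r"
      "(\<lambda>j. dist (B j (x \<xi>)) (B j z0)) \<longlonglongrightarrow> 0" "x \<xi> \<in> Trans X f" for \<xi>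
      using spec[OF x1, of \<xi>] by simp_all
    have "V_set X f (x \<xi>) = K" for \<xi>
      by (rule V_set_eqI[OF sys(3) x(1) Kb IK(1) near acc])
    then have G: "x \<xi> \<in> G_set X f K" for \<xi> using x(1) by (simp add: G_set_def)
    have inj: "inj x"
    proof (rule injI, rule ccontr)
      fix \<xi> \<eta> assume eq: "x \<xi> = x \<eta>" and ne: "\<xi> \<noteq> \<eta>"
      have "close_time f (\<tau> / 2 / 2) n (x \<xi>) (x \<eta>) = real n" for n
        using \<tau> eq by (simp add: close_time_def)
      then have "\<exists>\<^sub>F n in sequentially. real n \<le> 1/2 * real n" using apart[OF _ ne, of "1/2"] by simp
      then have "\<exists>\<^sub>F n in sequentially. real n \<le> 1/2 * real n \<and> n > 0"
        by (rule frequently_eventually_frequently[OF _ eventually_gt_at_top])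
      then show False using frequently_ex by fastforce
    qed
    have low: "Phi_lower f (x \<xi>) (x \<eta>) (\<tau> / 4) = 0" if "\<xi> \<noteq> \<eta>" for \<xi> \<eta>
      using liminf_ratio_eq_0[OF close_time_nonneg apart[OF _ that]]
      unfolding Phi_lower_def Phi_n_def close_time_card by simp
    have up: "Phi_upper f (x \<xi>) (x \<eta>) t = 1" if "t > 0" for \<xi> \<eta> t
      using limsup_ratio_eq_1[OF close_time_le prox[OF that]]
      unfolding Phi_upper_def Phi_n_def close_time_card .
    have growth: "Phi_upper_growth f \<alpha> (x \<xi>) (x \<eta>) t = 1" if "summed" "t > 0" for \<xi> \<eta> t
      unfolding Phi_upper_growth_def
    proof (rule limsup_ratio_eq_1[OF _ prox_growth[OF that]])
      fix n
      have "card {i\<in>{1..n}. (\<Sum>j<i. dist ((f ^^ j) (x \<xi>)) ((f ^^ j) (x \<eta>))) < \<alpha> i * t} \<le> card {1..n}"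
        by (intro card_mono) auto
      then show "real (card {i\<in>{1..n}. (\<Sum>j<i. dist ((f ^^ j) (x \<xi>)) ((f ^^ j) (x \<eta>))) < \<alpha> i * t}) \<le> real n" by simp
    qed
    have "uncountable (range x)"
      using inj uncountable_bool_sequences countable_image_inj_eq by blast
    moreover have "pairwise (\<lambda>x y. DC1_pair f x y \<and> (summed \<longrightarrow> growth_DC1_pair f \<alpha> x y)) (range x)"
    proof (rule pairwiseI)
      fix a b assume "a \<in> range x" "b \<in> range x" "a \<noteq> b"
      then obtain \<xi> \<eta> where ab: "a = x \<xi>" "b = x \<eta>" "\<xi> \<noteq> \<eta>" by auto
      have "\<tau> / 4 > 0" using \<tau> by simp
      then show "DC1_pair f a b \<and> (summed \<longrightarrow> growth_DC1_pair f \<alpha> a b)"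
        unfolding DC1_pair_def growth_DC1_pair_def ab using low[OF ab(3)] up growth by blast
    qed
    moreover have "range x \<subseteq> {x \<in> G_set X f K \<inter> Trans X f. dist x z0 \<le> r \<and>
        (\<forall>j. dist (B j x) (B j z0) \<le> r) \<and> (\<lambda>j. dist (B j x) (B j z0)) \<longlonglongrightarrow> 0}"
      using G x by blast
    ultimately show ?thesis by (intro exI[of _ "range x"] conjI)
  qed
  have base: "\<exists>z0 lz r. lz \<ge> 1 \<and> z0 \<in> Xs lz \<and> r > 0 \<and> (\<forall>x\<in>X. dist x z0 \<le> r \<longrightarrow> x \<in> U)"
    if U: "openin (top_of_set X) U \<and> U \<noteq> {}" for U
  proof -
    obtain V where V: "open V" "U = X \<inter> V" using U unfolding openin_open by blast
    then obtain p where p: "p \<in> X" "p \<in> V" using U by blast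
    then have "p \<in> closure (\<Union>n\<in>{1..}. Xs n)" using assms(4) by simp
    then obtain z0 where z0: "z0 \<in> (\<Union>n\<in>{1..}. Xs n)" "z0 \<in> V"
      using V(1) p(2) closure_iff_nhds_not_empty[of p] by (metis IntE Int_emptyI order_refl)
    obtain r where r: "r > 0" "cball z0 r \<subseteq> V" using V(1) z0(2) unfolding open_contains_cball by blast
    have "\<forall>x\<in>X. dist x z0 \<le> r \<longrightarrow> x \<in> U" using r(2) V(2) by (auto simp: dist_commute)
    then show ?thesis using z0(1) r(1) by auto
  qed
  have part1: "one_chaotic f (G_set X f K \<inter> U \<inter> Trans X f)"
    if sp: "\<forall>n\<ge>1. specification_property (Xs n) f" and U: "openin (top_of_set X) U \<and> U \<noteq> {}" for U
  proof -
    obtain z0 lz r where z0: "lz \<ge> 1" "z0 \<in> Xs lz" "r > 0" "\<forall>x\<in>X. dist x z0 \<le> r \<longrightarrow> x \<in> U"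
      using base[OF U] by blast
    have gl: "\<exists>g. gluing f (\<lambda>_ _. z0) False (Xs l) \<epsilon> g" if "l \<ge> 1" "\<epsilon> > 0" for l \<epsilon>
      using gluing_of_specification sp that by blast
    obtain S where S: "S \<subseteq> {x \<in> G_set X f K \<inter> Trans X f. dist x z0 \<le> r}" "uncountable S" "pairwise (DC1_pair f) S"
      by (rule exE[OF family[OF sp gl continuous_on_const z0(1,2,3) filterlim_real_sequentially]])
        (auto simp: pairwise_def)
    then have "S \<subseteq> G_set X f K \<inter> U \<inter> Trans X f" using z0(4) by (auto simp: G_set_def)
    with S show ?thesis unfolding one_chaotic_def by blast
  qed
  have exp_sp: "\<forall>n\<ge>1. specification_property (Xs n) f" if "\<forall>n\<ge>1. exp_specification_property (Xs n) f"
    using that specification_of_exp_specification by blast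
  have part2: "strongly_dist_chaotic f (G_set X f K \<inter> U \<inter> Trans X f)"
    if sp: "\<forall>n\<ge>1. exp_specification_property (Xs n) f" and U: "openin (top_of_set X) U \<and> U \<noteq> {}" for U
    unfolding strongly_dist_chaotic_def
  proof
    fix \<alpha> assume "\<alpha> \<in> growth_functions"
    then have \<alpha>: "filterlim \<alpha> at_top sequentially" by (simp add: growth_functions_def)
    obtain z0 lz r where z0: "lz \<ge> 1" "z0 \<in> Xs lz" "r > 0" "\<forall>x\<in>X. dist x z0 \<le> r \<longrightarrow> x \<in> U"
      using base[OF U] by blast
    have gl: "\<exists>g. gluing f (\<lambda>_ _. z0) True (Xs l) \<epsilon> g" if "l \<ge> 1" "\<epsilon> > 0" for l \<epsilon>
      using gluing_of_exp_specification sp that by blast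
    obtain S where S: "S \<subseteq> {x \<in> G_set X f K \<inter> Trans X f. dist x z0 \<le> r}" "uncountable S" "pairwise (growth_DC1_pair f \<alpha>) S"
      by (rule exE[OF family[OF exp_sp[OF sp] gl continuous_on_const z0(1,2,3) \<alpha>]]) (auto simp: pairwise_def)
    then have "S \<subseteq> G_set X f K \<inter> U \<inter> Trans X f" using z0(4) by (auto simp: G_set_def)
    with S show "\<exists>S\<subseteq>G_set X f K \<inter> U \<inter> Trans X f. uncountable S \<and> pairwise (growth_DC1_pair f \<alpha>) S" by blast
  qed
  have part3: "strongly_dist_chaotic f (G_set X f K \<inter> local_unstable X f \<epsilon> z \<inter> Trans X f)"
    if sp: "\<forall>n\<ge>1. exp_specification_property (Xs n) f" and h: "is_homeo X f"
      and z: "z \<in> (\<Union>n\<in>{1..}. Xs n)" and \<epsilon>: "\<epsilon> > 0" for z \<epsilon>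
    unfolding strongly_dist_chaotic_def
  proof
    fix \<alpha> assume "\<alpha> \<in> growth_functions"
    then have \<alpha>: "filterlim \<alpha> at_top sequentially" by (simp add: growth_functions_def)
    obtain lz where z0: "lz \<ge> 1" "z \<in> Xs lz" using z by auto
    let ?B = "\<lambda>j. int_iterate X f (- int j)"
    have gl: "\<exists>g. gluing f ?B True (Xs l) \<epsilon> g" if l: "l \<ge> 1" and "\<epsilon> > 0" for l \<epsilon>
    proof -
      note sub = homeo_invariant_subset[OF h Xs(2)[OF l] Xs(4)[OF l h]]
      have "\<exists>g. gluing f (\<lambda>j. int_iterate (Xs l) f (- int j)) True (Xs l) \<epsilon> g"
        using gluing_of_exp_specification_homeo[OF _ \<open>\<epsilon> > 0\<close> Xs(1)[OF l] sub(1)] sp l by blast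
      then show ?thesis using gluing_cong[of "Xs l" "\<lambda>j. int_iterate (Xs l) f (- int j)" ?B] sub(2) by blast
    qed
    have Bc: "continuous_on X (?B j)" for j using homeo_int_iterate(3)[OF h] Xne by blast
    obtain S where S: "S \<subseteq> {x \<in> G_set X f K \<inter> Trans X f. dist x z \<le> \<epsilon> \<and>
        (\<forall>j. dist (?B j x) (?B j z) \<le> \<epsilon>) \<and> (\<lambda>j. dist (?B j x) (?B j z)) \<longlonglongrightarrow> 0}"
        "uncountable S" "pairwise (growth_DC1_pair f \<alpha>) S"
      by (rule exE[OF family[OF exp_sp[OF sp] gl Bc z0 \<epsilon> \<alpha>]]) (auto simp: pairwise_def)
    then have "S \<subseteq> G_set X f K \<inter> local_unstable X f \<epsilon> z \<inter> Trans X f"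
      by (auto simp: local_unstable_def G_set_def dist_commute)
    with S show "\<exists>S\<subseteq>G_set X f K \<inter> local_unstable X f \<epsilon> z \<inter> Trans X f. uncountable S \<and> pairwise (growth_DC1_pair f \<alpha>) S" by blast
  qed
  show ?thesis using part1 part2 part3 by blast
qed

end
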